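(* There exists a positive constant $C$ such that for integers $k\ge 2$ and $n\ge 2k+C\sqrt{k\ln k}$, almost all intersecting families in $\binom{[n]}{k}$ are trivial. In particular, the number of intersecting families in $\binom{[n]}{k}$ is $(n+o(1))2^{\binom{n-1}{k-1}}$, where the term $o(1)$ tends to $0$ as $n\to\infty$.
   Context: $\binom{[n]}{k}$ is the family of all $k$-element subsets of $[n]=\{1,\dots,n\}$. A family $\mathcal{F}\subseteq\binom{[n]}{k}$ is intersecting if any two of its sets share a common element, and it is trivial if there is an element of $[n]$ contained in all sets of $\mathcal{F}$. "Almost all intersecting families in $\binom{[n]}{k}$ are trivial" means that the proportion of intersecting families $\mathcal{F}\subseteq\binom{[n]}{k}$ that are trivial tends to $1$ as $n\to\infty$. Here $k$ is allowed to vary with $n$ subject to the stated constraints (so the error terms are bounded by functions of $n$ alone tending to $0$). *)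

theory Defs
  imports Complex_Main "HOL-Library.Ramsey"
begin

definition intersecting :: "'a set set \<Rightarrow> bool" where
  "intersecting F \<longleftrightarrow> (\<forall>A\<in>F. \<forall>B\<in>F. A \<inter> B \<noteq> {})"

(* The common element is taken from the ground set V, so for nonempty V the empty family
   is trivial. *)
definition trivial_on :: "'a set \<Rightarrow> 'a set set \<Rightarrow> bool" where
  "trivial_on V F \<longleftrightarrow> (\<exists>x\<in>V. \<forall>A\<in>F. x \<in> A)"

definition intersecting_families :: "nat \<Rightarrow> nat \<Rightarrow> nat set set set" where
  "intersecting_families n k = {F. F \<subseteq> nsets {1..n} k \<and> intersecting F}"

definition trivial_proportion :: "nat \<Rightarrow> nat \<Rightarrow> real" where
  "trivial_proportion n k =
     real (card {F \<in> intersecting_families n k. trivial_on {1..n} F})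
       / real (card (intersecting_families n k))"

end

(* Write a family F as its part in a star together with its part A away from that
   star. Arranging the ground set in a random cyclic order, Katona's argument shows that a family C
   with few disjoint pairs has at most k arcs in almost every order, and that equality forces the
   arcs to be exactly those through one point. For orders of the last kind, swapping two adjacent
   elements other than that point cannot change the point. Since adjacent swaps connect all
   orders within n^2 steps, the orders centred at a fixed x satisfy an isoperimetric inequality: if C is almost
   as large as a star, then almost all orders are centred at one x, and a set W of missing members
   of the star of x costs C at least |W| / poly(n) members. All losses are polynomial in n, while
   the degree (n-k choose k) of the Kneser graph exceeds n^20 once k^8 > n. Hence fingerprints
   (small subfamilies whose neighbourhoods nearly determine everything excluded by F) are
   cheaper than these savings: families far from every star are covered by few containers of
   size at most (1 - 1/poly(n)) times a star, and families near a star with A nonempty lose a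
   factor 2^(|W|/poly(n)) where |W| is at least degree/poly(n). For k^8 <= n a nontrivial
   family has at most k^2 (n-2 choose k-2) members, and counting all families of that size is
   enough. *)

theory Submission
  imports Defs "HOL-Combinatorics.Permutations"
begin

section \<open>Counting and permutation lemmas\<close>

text \<open>The delicate families lie almost inside one star and contain only a few sets off it.
  Adding off-star sets blocks w members of the star, and w may be a tiny fraction of the star, so
  both the price of describing the off-star part and the members lost must be proportional to w.
  Here the price is at most w / (16 n^4) bits and the loss at least w / (8 n^4). The error from
  disjoint pairs has to be proportional to w as well. One fingerprint does not give this: its
  container has few disjoint pairs compared only with all k-sets. Hence a second fingerprint is
  taken inside a set of size at most 2 n w. Isoperimetry alone says that some point is the common
  centre; the near case needs a prescribed x. For w at most sz / (4 n) a union bound over the k arcs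
  through x provides it, and for larger w the whole off-star part can be listed. The exponent 20
  makes the fingerprint threshold at least n^11 / 128, which beats the powers of n lost
  above.\<close>

lemma uniform_fibres_card:
  assumes "finite \<Omega>" "finite Y" and f: "f \<in> \<Omega> \<rightarrow> Y" and "C \<subseteq> Y"
    and move: "\<And>y y'. y \<in> Y \<Longrightarrow> y' \<in> Y \<Longrightarrow>
      \<exists>g. inj_on g \<Omega> \<and> g ` \<Omega> \<subseteq> \<Omega> \<and> (\<forall>\<omega>\<in>\<Omega>. f \<omega> = y \<longrightarrow> f (g \<omega>) = y')"
  shows "card {\<omega> \<in> \<Omega>. f \<omega> \<in> C} * card Y = card C * card \<Omega>"
proof -
  define c where "c y = card {\<omega> \<in> \<Omega>. f \<omega> = y}" for y
  \<comment> \<open>The injection for the pair y, y' embeds one fibre into the other; exchanging y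
    and y' makes all fibres equally large.\<close>
  have le: "c y \<le> c y'" if y: "y \<in> Y" "y' \<in> Y" for y y'
  proof -
    obtain g where g: "inj_on g \<Omega>" "g ` \<Omega> \<subseteq> \<Omega>" "\<forall>\<omega>\<in>\<Omega>. f \<omega> = y \<longrightarrow> f (g \<omega>) = y'"
      using move[OF y] by blast
    show ?thesis unfolding c_def
    proof (rule card_inj_on_le)
      show "inj_on g {\<omega> \<in> \<Omega>. f \<omega> = y}" using g(1) by (rule inj_on_subset) auto
      show "g ` {\<omega> \<in> \<Omega>. f \<omega> = y} \<subseteq> {\<omega> \<in> \<Omega>. f \<omega> = y'}" using g by auto
    qed (use assms in auto)
  qed
  have eq: "c y = c y'" if "y \<in> Y" "y' \<in> Y" for y y' using le that by (meson le_antisym)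
  have sum: "card {\<omega> \<in> \<Omega>. f \<omega> \<in> B} = (\<Sum>y\<in>B. c y)" if "B \<subseteq> Y" for B
  proof -
    have "{\<omega> \<in> \<Omega>. f \<omega> \<in> B} = (\<Union>y\<in>B. {\<omega> \<in> \<Omega>. f \<omega> = y})" by auto
    moreover have "finite B" using that assms finite_subset by blast
    ultimately show ?thesis using assms unfolding c_def
      by (simp only:) (subst card_UN_disjoint, auto)
  qed
  have all: "{\<omega> \<in> \<Omega>. f \<omega> \<in> Y} = \<Omega>" using f by auto
  show ?thesis
  proof (cases "Y = {}")
    case False
    then obtain y0 where y0: "y0 \<in> Y" by blast
    have "(\<Sum>y\<in>B. c y) = card B * c y0" if "B \<subseteq> Y" for B
    proof -
      have "(\<Sum>y\<in>B. c y) = (\<Sum>y\<in>B. c y0)"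
        by (intro sum.cong refl eq) (use y0 that in auto)
      thus ?thesis by simp
    qed
    thus ?thesis using sum[OF \<open>C \<subseteq> Y\<close>] sum[of Y] all \<open>C \<subseteq> Y\<close> by simp
  qed (use assms in auto)
qed

text \<open>Transitivity of the symmetric group on ordered pairs of disjoint sets of given sizes. It
  supplies the maps that \<open>uniform_fibres_card\<close> asks for.\<close>

lemma ex_permutes_image2:
  assumes "finite V" "S \<subseteq> V" "T \<subseteq> V" "S \<inter> T = {}" "S' \<subseteq> V" "T' \<subseteq> V" "S' \<inter> T' = {}"
    and "card S = card S'" "card T = card T'"
  shows "\<exists>\<pi>. \<pi> permutes V \<and> \<pi> ` S = S' \<and> \<pi> ` T = T'"
proof -
  have fin: "finite S" "finite S'" "finite T" "finite T'" using assms finite_subset by blast+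
  obtain f where f: "bij_betw f S S'" using fin assms(8) by (meson finite_same_card_bij)
  obtain g where g: "bij_betw g T T'" using fin assms(9) by (meson finite_same_card_bij)
  have "card (V - (S \<union> T)) = card (V - (S' \<union> T'))"
    using assms fin by (simp add: card_Diff_subset card_Un_disjoint)
  then obtain h where h: "bij_betw h (V - (S \<union> T)) (V - (S' \<union> T'))"
    using assms(1) by (meson finite_Diff finite_same_card_bij)
  define \<pi> where "\<pi> x = (if x \<in> S then f x else if x \<in> T then g x else if x \<in> V then h x else x)" for x
  have 1: "bij_betw \<pi> S S'" using f by (rule bij_betw_cong[THEN iffD1, rotated]) (auto simp: \<pi>_def)
  have 2: "bij_betw \<pi> T T'" using g
    by (rule bij_betw_cong[THEN iffD1, rotated]) (use assms(4) in \<open>auto simp: \<pi>_def\<close>)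
  have 3: "bij_betw \<pi> (V - (S \<union> T)) (V - (S' \<union> T'))" using h
    by (rule bij_betw_cong[THEN iffD1, rotated]) (auto simp: \<pi>_def)
  have "bij_betw \<pi> (S \<union> T) (S' \<union> T')" by (rule bij_betw_combine[OF 1 2 assms(7)])
  hence "bij_betw \<pi> ((S \<union> T) \<union> (V - (S \<union> T))) ((S' \<union> T') \<union> (V - (S' \<union> T')))"
    by (rule bij_betw_combine[OF _ 3]) auto
  moreover have "(S \<union> T) \<union> (V - (S \<union> T)) = V" "(S' \<union> T') \<union> (V - (S' \<union> T')) = V"
    using assms by auto
  ultimately have "bij_betw \<pi> V V" by simp
  hence "\<pi> permutes V" using assms by (intro bij_imp_permutes) (auto simp: \<pi>_def)
  thus ?thesis using 1 2 by (auto simp: bij_betw_def)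
qed

text \<open>A word-length estimate: a permutation of {a..b} is a product of at most b
  transpositions, each a product of fewer than 2 b adjacent swaps, and a subadditive
  \<open>f\<close> pays at most c for each. In the application \<open>f\<close> counts the orders
  that leave a given set.\<close>

lemma permutes_subadditive_bound:
  fixes f :: "(nat \<Rightarrow> nat) \<Rightarrow> nat"
  assumes "1 \<le> a" and id: "f id = 0"
    and sub: "\<And>\<pi> \<rho>. \<pi> permutes {a..b} \<Longrightarrow> \<rho> permutes {a..b} \<Longrightarrow> f (\<pi> \<circ> \<rho>) \<le> f \<pi> + f \<rho>"
    and adj: "\<And>q. a \<le> q \<Longrightarrow> q < b \<Longrightarrow> f (transpose q (Suc q)) \<le> c"
    and \<pi>: "\<pi> permutes {a..b}"
  shows "f \<pi> \<le> 2 * b ^ 2 * c"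
proof -
  have tr: "f (transpose i (i + Suc d)) \<le> (2 * d + 1) * c" if "a \<le> i" "i + Suc d \<le> b" for i d
    using that
  proof (induction d)
    case 0
    then show ?case using adj[of i] by simp
  next
    case (Suc d)
    let ?s = "transpose (i + Suc d) (Suc (i + Suc d))" and ?t = "transpose i (i + Suc d)"
    have p: "?s permutes {a..b}" "?t permutes {a..b}"
      using Suc.prems by (auto intro!: permutes_swap_id)
    \<comment> \<open>Conjugation by one adjacent swap extends the reach of a transposition by one
      and costs two further swaps.\<close>
    have eq: "transpose i (i + Suc (Suc d)) = ?s \<circ> (?t \<circ> ?s)"
      by (auto simp: fun_eq_iff transpose_def)
    have "f (transpose i (i + Suc (Suc d))) \<le> f ?s + f (?t \<circ> ?s)"
      unfolding eq using p by (intro sub permutes_compose)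
    also have "f (?t \<circ> ?s) \<le> f ?t + f ?s" using p by (intro sub)
    finally have "f (transpose i (i + Suc (Suc d))) \<le> 2 * f ?s + f ?t" by simp
    moreover have "f ?s \<le> c" using Suc.prems by (intro adj) auto
    moreover have "f ?t \<le> (2 * d + 1) * c" using Suc by simp
    ultimately show ?case by (simp add: algebra_simps)
  qed
  have tr': "f (transpose i j) \<le> 2 * b * c" if "i \<in> {a..b}" "j \<in> {a..b}" for i j
  proof -
    have *: "f (transpose i j) \<le> 2 * b * c" if "i < j" "i \<in> {a..b}" "j \<in> {a..b}" for i j
    proof -
      obtain d where d: "j = i + Suc d" using \<open>i < j\<close> less_imp_Suc_add by force
      have "f (transpose i j) \<le> (2 * d + 1) * c" unfolding d using that d by (intro tr) auto
      also have "\<dots> \<le> (2 * b) * c" using that d by (intro mult_right_mono) auto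
      finally show ?thesis .
    qed
    consider "i < j" | "j < i" | "i = j" by linarith
    thus ?thesis
    proof cases
      case 2
      then show ?thesis using *[of j i] that by (simp add: transpose_commute)
    qed (use * that id in \<open>auto simp: id_def\<close>)
  qed
  have "f \<pi> \<le> card S * (2 * b * c)" if "\<pi> permutes S" "finite S" "S \<subseteq> {a..b}" for \<pi> S
    using that(2,1,3)
  proof (induction S arbitrary: \<pi> rule: finite_induct)
    case empty
    then show ?case using id by (simp add: id_def)
  next
    case (insert x S)
    have "\<pi> \<in> {p. p permutes insert x S}" using insert.prems by simp
    then obtain y q where yq: "\<pi> = transpose x y \<circ> q" "y \<in> insert x S" "q permutes S"
      unfolding permutes_insert by auto
    have q: "q permutes {a..b}" using yq(3) insert.prems by (meson insert_subset permutes_subset)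
    have "f \<pi> \<le> f (transpose x y) + f q"
      unfolding yq(1) using yq(2) insert.prems q by (intro sub permutes_swap_id) auto
    also have "f (transpose x y) \<le> 2 * b * c" using yq(2) insert.prems by (intro tr') auto
    also have "f q \<le> card S * (2 * b * c)" using insert yq by auto
    finally show ?case using insert by simp
  qed
  from this[OF \<pi>] have "f \<pi> \<le> card {a..b} * (2 * b * c)" by simp
  also have "\<dots> \<le> b * (2 * b * c)" using \<open>1 \<le> a\<close> by (intro mult_right_mono) auto
  finally show ?thesis by (simp add: power2_eq_square algebra_simps)
qed

section \<open>Arcs on a cycle\<close>

text \<open>Sets of residues modulo n are encoded as periodic predicates on the integers, so that a
  window may start anywhere and distances are handled by linear arithmetic.\<close>

definition periodic :: "nat \<Rightarrow> (int \<Rightarrow> bool) \<Rightarrow> bool" where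
  "periodic n P \<longleftrightarrow> (\<forall>i. P (i + int n) = P i)"

text \<open>Over one full period, the selected starts are those of the k arcs of length k that
  contain the point c.\<close>

definition centred :: "nat \<Rightarrow> nat \<Rightarrow> (int \<Rightarrow> bool) \<Rightarrow> int \<Rightarrow> bool" where
  "centred n k P c \<longleftrightarrow> (\<forall>i\<in>{c - int k + 1..<c - int k + 1 + int n}. P i \<longleftrightarrow> i \<le> c)"

lemma periodic_add: "P (i + m * int n) = P i" if "periodic n P"
proof -
  have nat: "P (i + int m * int n) = P i" for i m
  proof (induction m)
    case (Suc m)
    have "P (i + int (Suc m) * int n) = P (i + int m * int n + int n)" by (simp add: algebra_simps)
    then show ?case using Suc that by (simp add: periodic_def)
  qed simp
  show ?thesis
  proof (cases "m \<ge> 0")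
    case True
    then show ?thesis using nat[of i "nat m"] by simp
  next
    case False
    then show ?thesis using nat[of "i + m * int n" "nat (- m)"] by (simp add: algebra_simps)
  qed
qed

lemma periodic_mod: "P (i mod int n) = P i" if "periodic n P"
proof -
  have "P (i mod int n + (i div int n) * int n) = P (i mod int n)"
    by (rule periodic_add[OF that])
  thus ?thesis by simp
qed

lemma periodic_window_card:
  assumes "periodic n P" "n > 0"
  shows "card {i\<in>{a..<a + int n}. P i} = card {i\<in>{0..<int n}. P i}"
proof -
  have inj: "inj_on (\<lambda>i. i mod int n) {a..<a + int n}"
  proof (rule inj_onI)
    fix i j assume "i \<in> {a..<a + int n}" "j \<in> {a..<a + int n}" "i mod int n = j mod int n"
    hence "int n dvd i - j" "\<bar>i - j\<bar> < int n" by (auto simp: mod_eq_dvd_iff)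
    thus "i = j" by (metis abs_of_nat dvd_imp_le_int eq_iff_diff_eq_0 linorder_not_less)
  qed
  have "(\<lambda>i. i mod int n) ` {i\<in>{a..<a + int n}. P i} = {i\<in>{0..<int n}. P i}"
  proof (intro equalityI subsetI)
    fix j assume j: "j \<in> {i\<in>{0..<int n}. P i}"
    define i where "i = a + (j - a) mod int n"
    have "i mod int n = j" using j unfolding i_def by (simp add: mod_simps)
    moreover have "i \<in> {a..<a + int n}" using assms by (simp add: i_def)
    moreover have "P i" using periodic_mod[OF assms(1), of i] j \<open>i mod int n = j\<close> by simp
    ultimately show "j \<in> (\<lambda>i. i mod int n) ` {i\<in>{a..<a + int n}. P i}" by force
  qed (use assms periodic_mod in auto)
  moreover have "inj_on (\<lambda>i. i mod int n) {i\<in>{a..<a + int n}. P i}"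
    by (rule inj_on_subset[OF inj]) auto
  ultimately show ?thesis by (metis card_image)
qed

lemma centred_shift: "centred n k P (c + m * int n) \<longleftrightarrow> centred n k P c" if "periodic n P"
proof -
  have imp: "centred n k P (c + m * int n)" if c: "centred n k P c" for c m
    unfolding centred_def
  proof
    fix i assume "i \<in> {c + m * int n - int k + 1..<c + m * int n - int k + 1 + int n}"
    hence "i + (- m) * int n \<in> {c - int k + 1..<c - int k + 1 + int n}" by auto
    hence "P (i + (- m) * int n) \<longleftrightarrow> i + (- m) * int n \<le> c" using c unfolding centred_def by blast
    thus "P i \<longleftrightarrow> i \<le> c + m * int n" using periodic_add[OF \<open>periodic n P\<close>, of i "- m"] by auto
  qed
  show ?thesis using imp[of c m] imp[of "c + m * int n" "- m"] by auto
qed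

text \<open>Here \<open>P i\<close> says that the arc of length \<open>k\<close> starting at \<open>i\<close> is selected. Given \<open>P i0\<close>, Katona's
  pairing of \<open>m\<close> with \<open>m + k\<close> allows at most one selected start in each pair.\<close>

lemma
  assumes per: "periodic n P" and k: "k \<ge> 1" "2 * k \<le> n"
    and no: "\<And>i j. P i \<Longrightarrow> P j \<Longrightarrow> int k \<le> j - i \<Longrightarrow> j - i \<le> int n - int k \<Longrightarrow> False"
  shows card_arcs_le: "card {i\<in>{0..<int n}. P i} \<le> k"
    and card_arcs_eq: "card {i\<in>{0..<int n}. P i} = k \<Longrightarrow> 2 * k < n \<Longrightarrow>
      \<exists>c\<in>{0..<int n}. centred n k P c"
proof -
  \<comment> \<open>Folding identifies m with m + k. Relative to a selected start i0, all selected
    starts of the window land in the k slots up to i0, and a collision would mean two selected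
    starts at distance k.\<close>
  define g where "g i0 j = (if j \<le> i0 then j else j - int k)" for i0 j
  let ?W = "\<lambda>i0. {i\<in>{i0 - int k + 1..<i0 - int k + 1 + int n}. P i}"
  have W: "j \<le> i0 + int k - 1" if "P i0" "j \<in> ?W i0" for i0 j
    using no[of i0 j] that by fastforce
  have inj: "inj_on (g i0) (?W i0)" if i0: "P i0" for i0
  proof (rule inj_onI)
    fix i j assume ij: "i \<in> ?W i0" "j \<in> ?W i0" "g i0 i = g i0 j"
    show "i = j"
    proof (rule ccontr)
      assume "i \<noteq> j"
      hence "j - i = int k \<or> i - j = int k" using ij(3) unfolding g_def by (auto split: if_splits)
      thus False using no[of i j] no[of j i] ij k by auto
    qed
  qed
  have sub: "g i0 ` ?W i0 \<subseteq> {i0 - int k + 1..i0}" if i0: "P i0" for i0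
    using W[OF i0] unfolding g_def by fastforce
  have card: "card (?W i0) = card {i\<in>{0..<int n}. P i}" for i0
    using periodic_window_card[OF per] k by simp
  show le: "card {i\<in>{0..<int n}. P i} \<le> k"
  proof (cases "\<exists>i0. P i0")
    case True
    then obtain i0 where "P i0" by blast
    hence "card (?W i0) \<le> card {i0 - int k + 1..i0}" by (intro card_inj_on_le[OF inj sub]) auto
    thus ?thesis using card[of i0] by simp
  qed auto
  show "\<exists>c\<in>{0..<int n}. centred n k P c"
    if eq: "card {i\<in>{0..<int n}. P i} = k" and lt: "2 * k < n"
  proof -
    have "{i\<in>{0..<int n}. P i} \<noteq> {}" using eq k by (metis card.empty not_one_le_zero)
    then obtain i0 where i0: "P i0" by blast
    \<comment> \<open>With k selected starts the folding is onto, so every pair m, m + k has a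
      selected member.\<close>
    have "g i0 ` ?W i0 = {i0 - int k + 1..i0}"
      using sub[OF i0] inj[OF i0] card[of i0] eq by (intro card_subset_eq) (auto simp: card_image)
    hence or: "P m \<or> P (m + int k)" if "m \<in> {i0 - int k + 1..i0}" for m
      using that unfolding g_def set_eq_iff image_iff by (fastforce split: if_splits)
    \<comment> \<open>Otherwise m + 1 + k is selected, at distance k + 1 from m. This distance is at
      most n - k because 2 k < n.\<close>
    have up: "P (m + 1)" if "P m" "m \<in> {i0 - int k + 1..i0 - 1}" for m
    proof (rule ccontr)
      assume "\<not> P (m + 1)"
      hence "P (m + 1 + int k)" using or[of "m + 1"] that by auto
      thus False using no[of m "m + 1 + int k"] that lt by auto
    qed
    define m0 where "m0 = Min {m\<in>{i0 - int k + 1..i0}. P m}"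
    have fin: "finite {m\<in>{i0 - int k + 1..i0}. P m}"
      by (rule finite_subset[of _ "{i0 - int k + 1..i0}"]) auto
    have ne: "{m\<in>{i0 - int k + 1..i0}. P m} \<noteq> {}" using i0 k by auto
    have m0: "m0 \<in> {i0 - int k + 1..i0}" "P m0"
      using Min_in[OF fin ne] unfolding m0_def by blast+
    have min: "\<not> P m" if "m \<in> {i0 - int k + 1..<m0}" for m
    proof
      assume "P m"
      hence "m0 \<le> m" unfolding m0_def using that m0 by (intro Min_le fin) auto
      thus False using that by simp
    qed
    have 1: "P m" if "m \<in> {m0..i0}" for m
    proof -
      have "m0 + int d \<le> i0 \<Longrightarrow> P (m0 + int d)" for d
      proof (induction d)
        case (Suc d)
        then show ?case using up[of "m0 + int d"] m0 by (simp add: algebra_simps)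
      qed (use m0 in simp)
      from this[of "nat (m - m0)"] show ?thesis using that by simp
    qed
    \<comment> \<open>The selected starts will be m0, ..., m0 + k - 1; their arcs share exactly the
      point m0 + k - 1.\<close>
    define c where "c = m0 + int k - 1"
    have 2: "P i" if "i \<in> {c - int k + 1..c}" for i
    proof (cases "i \<le> i0")
      case True
      then show ?thesis using 1 that by (simp add: c_def)
    next
      case False
      then show ?thesis using or[of "i - int k"] min[of "i - int k"] that m0 by (simp add: c_def)
    qed
    have eqW: "{c - int k + 1..c} = {i\<in>{c - int k + 1..<c - int k + 1 + int n}. P i}"
    proof (rule card_subset_eq)
      show "{c - int k + 1..c} \<subseteq> {i\<in>{c - int k + 1..<c - int k + 1 + int n}. P i}"
        using 2 lt by auto
      show "finite {i\<in>{c - int k + 1..<c - int k + 1 + int n}. P i}"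
        by (rule finite_subset[of _ "{c - int k + 1..<c - int k + 1 + int n}"]) auto
      show "card {c - int k + 1..c} = card {i\<in>{c - int k + 1..<c - int k + 1 + int n}. P i}"
        using periodic_window_card[OF per, of "c - int k + 1"] k eq by simp
    qed
    have "P i \<longleftrightarrow> i \<le> c" if "i \<in> {c - int k + 1..<c - int k + 1 + int n}" for i
    proof -
      have "i \<in> {c - int k + 1..c} \<longleftrightarrow> P i" unfolding eqW using that by simp
      thus ?thesis using that by simp
    qed
    hence "centred n k P c" unfolding centred_def by blast
    hence "centred n k P (c + (- (c div int n)) * int n)" using centred_shift[OF per] by blast
    hence "centred n k P (c mod int n)" by (simp add: minus_div_mult_eq_mod)
    moreover have "c mod int n \<in> {0..<int n}" using k by simp
    ultimately show ?thesis by blast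
  qed
qed

text \<open>Swapping the contents of positions q and q + 1 affects only the arcs that separate them,
  namely those starting at q + 1 or ending at q. A shift of the centre by one also changes just two
  starts, again k apart, but it would need q = 0 or q = n - 1, a swap that moves the centre itself.
  In the proof two disagreements determine q and the new centre, and a third disagreement
  contradicts them.\<close>

lemma centred_adjacent:
  fixes q :: int
  assumes per: "periodic n P'" and k: "k \<ge> 2" "2 * k < n"
    and cP: "centred n k P 0" and cP': "centred n k P' c" and q: "1 \<le> q" "q \<le> int n - 2"
    and agree: "\<And>i. 1 - int k \<le> i \<Longrightarrow> i \<le> int n - int k \<Longrightarrow> i \<noteq> q + 1 \<Longrightarrow> i \<noteq> q + 1 - int n \<Longrightarrow>
      i \<noteq> q - int k + 1 \<Longrightarrow> P i = P' i"
  shows "centred n k P' 0"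
proof -
  define N where "N = int n"
  define K where "K = int k"
  \<comment> \<open>The representative of the centre c in the window from 1 - K to N - K.\<close>
  define d where "d = (c + K - 1) mod N - K + 1"
  have "d = c + (- ((c + K - 1) div N)) * N"
    unfolding d_def by (simp add: minus_div_mult_eq_mod[symmetric])
  hence cd: "centred n k P' d" using cP' centred_shift[OF per] by (simp only: N_def)
  have NK: "K \<ge> 2" "2 * K < N" using k by (auto simp: N_def K_def)
  have d: "1 - K \<le> d" "d \<le> N - K" using pos_mod_sign[of N "c + K - 1"] pos_mod_bound[of N "c + K - 1"] NK
    unfolding d_def by linarith+
  have P: "P i \<longleftrightarrow> i \<le> 0" if "1 - K \<le> i" "i \<le> N - K" for i
    using cP that unfolding centred_def N_def K_def by auto
  have P'1: "P' i \<longleftrightarrow> i \<le> d" if "d - K + 1 \<le> i" "i \<le> d - K + N" for i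
    using cd that unfolding centred_def N_def K_def by auto
  have P'2: "P' i \<longleftrightarrow> i + N \<le> d" if "d - K + 1 \<le> i + N" "i + N \<le> d - K + N" for i
    using P'1[of "i + N"] that per unfolding periodic_def N_def by auto
  have P'3: "P' i \<longleftrightarrow> i - N \<le> d" if "d - K + 1 \<le> i - N" "i - N \<le> d - K + N" for i
    using P'1[of "i - N"] that per unfolding periodic_def N_def by (metis diff_add_cancel)
  have ag: "P i = P' i" if "1 - K \<le> i" "i \<le> N - K" "i \<noteq> q + 1" "i \<noteq> q + 1 - N" "i \<noteq> q - K + 1" for i
    using agree[of i] that unfolding N_def K_def by auto
  have q': "1 \<le> q" "q \<le> N - 2" using q by (auto simp: N_def)
  consider "d = 0" | "d \<ge> 1" | "d \<le> -1" by linarith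
  hence "d = 0"
  proof cases
    case 2
    have "P (1 - K)" "\<not> P' (1 - K)" using P[of "1 - K"] P'2[of "1 - K"] NK d 2 by auto
    hence qn: "q = N - K" using ag[of "1 - K"] NK q' by force
    have "\<not> P d" "P' d" using P[of d] P'1[of d] NK d 2 by auto
    hence dn: "d = N - 2 * K + 1" using ag[of d] NK q' 2 d qn by force
    have "\<not> P (d - 1)" "P' (d - 1)" using P[of "d - 1"] P'1[of "d - 1"] NK d dn by auto
    thus ?thesis using ag[of "d - 1"] NK d qn dn by force
  next
    case 3
    have "P 0" "\<not> P' 0" using P[of 0] P'1[of 0] NK d 3 by auto
    hence qk: "q = K - 1" using ag[of 0] NK q' by force
    have "\<not> P (d - K + 1 + N)" "P' (d - K + 1 + N)"
      using P[of "d - K + 1 + N"] P'3[of "d - K + 1 + N"] NK d 3 by auto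
    hence dn: "d = 2 * K - 1 - N" using ag[of "d - K + 1 + N"] NK q' 3 d qk by force
    have "P (-1)" "\<not> P' (-1)" using P[of "-1"] P'1[of "-1"] NK d dn by auto
    thus ?thesis using ag[of "-1"] NK d qk dn by force
  qed
  thus ?thesis using cd by simp
qed

section \<open>Cyclic orders\<close>

lemma card_disjoint_pairs:
  assumes "finite V"
  shows "card {(S, T). S \<subseteq> V \<and> T \<subseteq> V \<and> card S = a \<and> card T = b \<and> S \<inter> T = {}} =
    (card V choose a) * ((card V - a) choose b)"
proof -
  have "{(S, T). S \<subseteq> V \<and> T \<subseteq> V \<and> card S = a \<and> card T = b \<and> S \<inter> T = {}} =
     (SIGMA S:{S. S \<subseteq> V \<and> card S = a}. {T. T \<subseteq> V - S \<and> card T = b})" by auto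
  moreover have "card {T. T \<subseteq> V - S \<and> card T = b} = (card V - a) choose b"
    if "S \<subseteq> V" "card S = a" for S
    using that assms by (subst n_subsets) (auto simp: card_Diff_subset finite_subset)
  ultimately show ?thesis using assms
    by (simp add: n_subsets)
qed

text \<open>A uniformly random permutation sends (P, Q) to a uniformly random ordered pair of
  disjoint sets of the same sizes. All later averages over orders are instances;
  \<open>Q = {}\<close> gives the law of a single arc.\<close>

lemma permutes_pair_count:
  assumes V: "finite V" and PQ: "P \<subseteq> V" "Q \<subseteq> V" "P \<inter> Q = {}"
    and X: "\<And>S T. (S, T) \<in> X \<Longrightarrow>
      S \<subseteq> V \<and> T \<subseteq> V \<and> card S = card P \<and> card T = card Q \<and> S \<inter> T = {}"
  shows "card {\<sigma>. \<sigma> permutes V \<and> (\<sigma> ` P, \<sigma> ` Q) \<in> X} *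
      ((card V choose card P) * ((card V - card P) choose card Q)) = card X * fact (card V)"
proof -
  define Y where "Y = {(S, T). S \<subseteq> V \<and> T \<subseteq> V \<and> card S = card P \<and> card T = card Q \<and> S \<inter> T = {}}"
  have "Y \<subseteq> Pow V \<times> Pow V" by (auto simp: Y_def)
  hence finY: "finite Y" by (rule finite_subset) (use V in auto)
  have "card {\<sigma> \<in> {\<sigma>. \<sigma> permutes V}. (\<sigma> ` P, \<sigma> ` Q) \<in> X} * card Y = card X * card {\<sigma>. \<sigma> permutes V}"
  proof (rule uniform_fibres_card[OF finite_permutations[OF V] finY])
    show "(\<lambda>\<sigma>. (\<sigma> ` P, \<sigma> ` Q)) \<in> {\<sigma>. \<sigma> permutes V} \<rightarrow> Y"
    proof
      fix \<sigma> assume "\<sigma> \<in> {\<sigma>. \<sigma> permutes V}"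
      hence \<sigma>: "\<sigma> permutes V" by simp
      have "inj \<sigma>" using \<sigma> by (rule permutes_inj)
      thus "(\<sigma> ` P, \<sigma> ` Q) \<in> Y" unfolding Y_def using PQ permutes_in_image[OF \<sigma>]
        by (auto simp: card_image inj_on_subset image_Int[symmetric])
    qed
    show "X \<subseteq> Y" using X unfolding Y_def by blast
  next
    fix y y' assume y: "y \<in> Y" "y' \<in> Y"
    obtain S T where S: "y = (S, T)" by (cases y)
    obtain S' T' where S': "y' = (S', T')" by (cases y')
    obtain \<pi> where \<pi>: "\<pi> permutes V" "\<pi> ` S = S'" "\<pi> ` T = T'"
      using ex_permutes_image2[OF V, of S T S' T'] y unfolding S S' Y_def by auto
    have "inj ((\<circ>) \<pi> :: ('a \<Rightarrow> 'a) \<Rightarrow> 'a \<Rightarrow> 'a)" using permutes_inj[OF \<pi>(1)] by (simp add: fun.inj_map)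
    thus "\<exists>g. inj_on g {\<sigma>. \<sigma> permutes V} \<and> g ` {\<sigma>. \<sigma> permutes V} \<subseteq> {\<sigma>. \<sigma> permutes V} \<and>
         (\<forall>\<sigma>\<in>{\<sigma>. \<sigma> permutes V}. (\<sigma> ` P, \<sigma> ` Q) = y \<longrightarrow> (g \<sigma> ` P, g \<sigma> ` Q) = y')"
      using \<pi> unfolding S S'
      by (intro exI[of _ "(\<circ>) \<pi>"]) (auto intro: inj_on_subset permutes_compose simp: image_comp[symmetric])
  qed
  moreover have "card Y = (card V choose card P) * ((card V - card P) choose card Q)"
    unfolding Y_def by (rule card_disjoint_pairs[OF V])
  ultimately show ?thesis using card_permutations[OF refl V] by simp
qed

locale cyclic_orders =
  fixes n k :: nat
  assumes k2: "2 \<le> k" and kn: "2 * k < n"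
begin

text \<open>Residue 0 is position 1 of the ground set {1..n}. An order \<sigma> places the element
  \<sigma> p at position p.\<close>

definition pos :: "int \<Rightarrow> nat" where
  "pos i = Suc (nat (i mod int n))"

definition block :: "int \<Rightarrow> nat set" where
  "block i = pos ` {i..<i + int k}"

definition orders :: "(nat \<Rightarrow> nat) set" where
  "orders = {\<sigma>. \<sigma> permutes {1..n}}"

definition arc_in :: "nat set set \<Rightarrow> (nat \<Rightarrow> nat) \<Rightarrow> int \<Rightarrow> bool" where
  "arc_in C \<sigma> i \<longleftrightarrow> \<sigma> ` block i \<in> C"

definition disjoint_pairs :: "nat set set \<Rightarrow> (nat set \<times> nat set) set" where
  "disjoint_pairs C = {(S, T). S \<in> C \<and> T \<in> C \<and> S \<inter> T = {}}"

definition bad :: "nat set set \<Rightarrow> (nat \<Rightarrow> nat) set" where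
  "bad C = {\<sigma> \<in> orders. \<exists>i\<in>{0..<int n}. \<exists>j\<in>{0..<int n}.
     arc_in C \<sigma> i \<and> arc_in C \<sigma> j \<and> block i \<inter> block j = {}}"

definition weight :: "nat set set \<Rightarrow> (nat \<Rightarrow> nat) \<Rightarrow> nat" where
  "weight C \<sigma> = card {i \<in> {0..<int n}. arc_in C \<sigma> i}"

text \<open>Outside this set Katona's bound holds with equality, so \<open>card_arcs_eq\<close>
  supplies a centre.\<close>

definition defective :: "nat set set \<Rightarrow> (nat \<Rightarrow> nat) set" where
  "defective C = {\<sigma> \<in> orders. \<sigma> \<in> bad C \<or> weight C \<sigma> \<noteq> k}"

text \<open>The arcs in \<open>C\<close> are exactly those through x. Requiring x at position 1
  picks one of the n rotations of such an order.\<close>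

definition pinned :: "nat set set \<Rightarrow> nat \<Rightarrow> (nat \<Rightarrow> nat) set" where
  "pinned C x = {\<sigma> \<in> orders - defective C. \<sigma> 1 = x \<and> centred n k (arc_in C \<sigma>) 0}"

lemma n_pos: "n > 0" and k_pos: "k > 0"
  using k2 kn by auto

lemma finite_orders [simp]: "finite orders"
  unfolding orders_def by (rule finite_permutations) simp

lemma card_orders: "card orders = fact n"
  unfolding orders_def by (subst card_permutations[of _ n]) auto

lemma bad_subset: "bad C \<subseteq> orders" and defective_subset: "defective C \<subseteq> orders"
  and pinned_subset: "pinned C x \<subseteq> orders"
  by (auto simp: bad_def defective_def pinned_def)

section \<open>Positions and arcs modulo n\<close>

lemma pos_in: "pos i \<in> {1..n}"
  using n_pos by (simp add: pos_def Suc_le_eq nat_less_iff)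

lemma pos_eq_iff: "pos i = pos j \<longleftrightarrow> i mod int n = j mod int n"
  using n_pos by (simp add: pos_def eq_nat_nat_iff)

lemma pos_shift: "pos (i + int n) = pos i"
  by (simp add: pos_def)

lemma pos_eq_window: "pos i = pos j \<longleftrightarrow> i = j" if "\<bar>i - j\<bar> < int n"
proof
  assume "pos i = pos j"
  hence "int n dvd i - j" by (simp add: pos_eq_iff mod_eq_dvd_iff)
  thus "i = j" using that by (metis abs_of_nat dvd_imp_le_int eq_iff_diff_eq_0 linorder_not_less)
qed simp

lemma pos_small: "pos i = nat (i + 1)" if "0 \<le> i" "i < int n"
  using that by (simp add: pos_def Suc_nat_eq_nat_zadd1 add.commute)

lemma block_subset: "block i \<subseteq> {1..n}"
  using pos_in by (auto simp: block_def)

lemma finite_block [simp]: "finite (block i)"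
  by (simp add: block_def)

lemma card_block [simp]: "card (block i) = k"
proof -
  have "inj_on pos {i..<i + int k}" by (rule inj_onI, subst (asm) pos_eq_window) (use kn in auto)
  thus ?thesis by (simp add: block_def card_image)
qed

lemma block_shift: "block (i + int n) = block i"
proof -
  have eq: "{i + int n..<i + int n + int k} = (\<lambda>j. j + int n) ` {i..<i + int k}"
    by (simp add: image_add_atLeastLessThan' add_ac)
  show ?thesis unfolding block_def eq image_image pos_shift ..
qed

lemma block_disjoint: "block i \<inter> block j = {}" if "int k \<le> j - i" "j - i \<le> int n - int k"
proof -
  have "pos a \<noteq> pos b" if "a \<in> {i..<i + int k}" "b \<in> {j..<j + int k}" for a b
    using that \<open>int k \<le> j - i\<close> \<open>j - i \<le> int n - int k\<close> by (subst pos_eq_window) auto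
  thus ?thesis unfolding block_def by blast
qed

lemma one_in_block: "1 \<in> block i \<longleftrightarrow> i \<le> 0" if "1 - int k \<le> i" "i \<le> int n - int k"
proof -
  have 1: "pos 0 = 1" using n_pos by (simp add: pos_def)
  have "1 \<in> block i \<longleftrightarrow> (\<exists>j\<in>{i..<i + int k}. pos 0 = pos j)" unfolding block_def 1 image_iff ..
  also have "\<dots> \<longleftrightarrow> (\<exists>j\<in>{i..<i + int k}. 0 = j)"
    using that kn by (intro bex_cong refl pos_eq_window) auto
  finally show ?thesis using that k_pos by auto
qed

lemma periodic_arc_in: "periodic n (arc_in C \<sigma>)"
  by (simp add: periodic_def arc_in_def block_shift)

lemma not_badD:
  assumes "\<sigma> \<in> orders" "\<sigma> \<notin> bad C" "arc_in C \<sigma> i" "arc_in C \<sigma> j"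
    "int k \<le> j - i" "j - i \<le> int n - int k"
  shows False
proof -
  have shift: "block (i mod int n) = block i" for i
  proof -
    have "i mod int n = i + (- (i div int n)) * int n" by (simp add: minus_div_mult_eq_mod[symmetric])
    moreover have "periodic n (\<lambda>j. block j = block i)" by (simp add: periodic_def block_shift)
    ultimately show ?thesis using periodic_add[of n "\<lambda>j. block j = block i" i "- (i div int n)"] by simp
  qed
  have "arc_in C \<sigma> (i mod int n)" "arc_in C \<sigma> (j mod int n)"
    "block (i mod int n) \<inter> block (j mod int n) = {}"
    using assms(3-6) block_disjoint by (simp_all add: shift arc_in_def)
  moreover have "i mod int n \<in> {0..<int n}" "j mod int n \<in> {0..<int n}" using n_pos by auto
  ultimately show False using assms(1,2) unfolding bad_def by blast
qed

lemma weight_le: "weight C \<sigma> \<le> k" if "\<sigma> \<in> orders" "\<sigma> \<notin> bad C"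
  unfolding weight_def using k2 kn not_badD[OF that] by (intro card_arcs_le periodic_arc_in) auto

lemma weight_le_n: "weight C \<sigma> \<le> n"
proof -
  have "weight C \<sigma> \<le> card {0..<int n}" unfolding weight_def by (rule card_mono) auto
  thus ?thesis by simp
qed

lemma ex_centre: "\<exists>c\<in>{0..<int n}. centred n k (arc_in C \<sigma>) c" if "\<sigma> \<in> orders - defective C"
proof -
  have "\<sigma> \<in> orders" "\<sigma> \<notin> bad C" "weight C \<sigma> = k" using that by (auto simp: defective_def)
  thus ?thesis using k2 kn not_badD unfolding weight_def
    by (intro card_arcs_eq periodic_arc_in) auto
qed

text \<open>The k arcs through position 1 already exhaust Katona's bound, so no further arc can lie
  in \<open>C\<close>.\<close>

lemma pinnedI:
  assumes "\<sigma> \<in> orders" "\<sigma> \<notin> bad C" "\<And>i. 1 - int k \<le> i \<Longrightarrow> i \<le> 0 \<Longrightarrow> arc_in C \<sigma> i" "\<sigma> 1 = x"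
  shows "\<sigma> \<in> pinned C x"
proof -
  let ?W = "{i\<in>{1 - int k..<1 - int k + int n}. arc_in C \<sigma> i}"
  have card: "card ?W = weight C \<sigma>"
    unfolding weight_def by (rule periodic_window_card[OF periodic_arc_in n_pos])
  have sub: "{1 - int k..0} \<subseteq> ?W" using assms(3) kn by auto
  have fin: "finite ?W" by (rule finite_subset[of _ "{1 - int k..<1 - int k + int n}"]) auto
  have "card {1 - int k..0} \<le> card ?W" by (rule card_mono[OF fin sub])
  hence w: "weight C \<sigma> = k" using card weight_le[OF assms(1,2)] by simp
  have eqW: "{1 - int k..0} = ?W" by (rule card_subset_eq[OF fin sub]) (use card w in simp)
  have "arc_in C \<sigma> i \<longleftrightarrow> i \<le> 0" if "i \<in> {0 - int k + 1..<0 - int k + 1 + int n}" for i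
  proof -
    have "i \<in> {1 - int k..0} \<longleftrightarrow> arc_in C \<sigma> i" unfolding eqW using that by simp
    thus ?thesis using that by simp
  qed
  hence "centred n k (arc_in C \<sigma>) 0" unfolding centred_def by blast
  thus ?thesis using assms w by (simp add: pinned_def defective_def)
qed

section \<open>Counting orders by the sets on their arcs\<close>

lemma arc_count:
  assumes "C \<subseteq> nsets {1..n} k"
  shows "card {\<sigma> \<in> orders. arc_in C \<sigma> i} * (n choose k) = card C * fact n"
proof -
  have "card {\<sigma>. \<sigma> permutes {1..n} \<and> (\<sigma> ` block i, \<sigma> ` {}) \<in> (\<lambda>S. (S, {})) ` C} *
      ((card {1..n} choose card (block i)) * ((card {1..n} - card (block i)) choose card ({} :: nat set)))
      = card ((\<lambda>S. (S, {} :: nat set)) ` C) * fact (card {1..n})"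
    using assms block_subset by (intro permutes_pair_count) (auto simp: nsets_def)
  moreover have "card ((\<lambda>S. (S, {} :: nat set)) ` C) = card C" by (rule card_image) (auto simp: inj_on_def)
  moreover have "{\<sigma>. \<sigma> permutes {1..n} \<and> (\<sigma> ` block i, \<sigma> ` {}) \<in> (\<lambda>S. (S, {})) ` C} =
     {\<sigma> \<in> orders. arc_in C \<sigma> i}" by (auto simp: orders_def arc_in_def)
  ultimately show ?thesis by simp
qed

lemma disjoint_arcs_count:
  assumes "C \<subseteq> nsets {1..n} k" "block i \<inter> block j = {}"
  shows "card {\<sigma> \<in> orders. arc_in C \<sigma> i \<and> arc_in C \<sigma> j} * ((n choose k) * ((n - k) choose k)) =
    card (disjoint_pairs C) * fact n"
proof -
  have "card {\<sigma>. \<sigma> permutes {1..n} \<and> (\<sigma> ` block i, \<sigma> ` block j) \<in> disjoint_pairs C} *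
      ((card {1..n} choose card (block i)) * ((card {1..n} - card (block i)) choose card (block j)))
      = card (disjoint_pairs C) * fact (card {1..n})"
    using assms block_subset
    by (intro permutes_pair_count) (auto simp: nsets_def disjoint_pairs_def)
  moreover have "(\<sigma> ` block i) \<inter> (\<sigma> ` block j) = {}" if "\<sigma> permutes {1..n}" for \<sigma>
    using assms(2) permutes_inj[OF that] by (simp add: image_Int[symmetric])
  hence "{\<sigma>. \<sigma> permutes {1..n} \<and> (\<sigma> ` block i, \<sigma> ` block j) \<in> disjoint_pairs C} =
     {\<sigma> \<in> orders. arc_in C \<sigma> i \<and> arc_in C \<sigma> j}" by (auto simp: orders_def arc_in_def disjoint_pairs_def)
  ultimately show ?thesis by simp
qed

text \<open>Given \<sigma> 1 = x, the rest of an arc through position 1 is a uniform (k-1)-subset of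
  the other elements. The count therefore treats {1} and the rest of the block as a disjoint
  pair.\<close>

lemma star_arc_count:
  assumes "W \<subseteq> nsets {1..n} k" "\<And>S. S \<in> W \<Longrightarrow> x \<in> S" "1 - int k \<le> i" "i \<le> 0"
  shows "card {\<sigma> \<in> orders. \<sigma> 1 = x \<and> arc_in W \<sigma> i} * (n * ((n - 1) choose (k - 1))) = card W * fact n"
proof -
  have one: "1 \<in> block i" using one_in_block[of i] assms kn by simp
  let ?X = "(\<lambda>S. ({x}, S - {x})) ` W"
  have "card {\<sigma>. \<sigma> permutes {1..n} \<and> (\<sigma> ` {1}, \<sigma> ` (block i - {1})) \<in> ?X} *
      ((card {1..n} choose card {1::nat}) * ((card {1..n} - card {1::nat}) choose card (block i - {1})))
      = card ?X * fact (card {1..n})"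
  proof (rule permutes_pair_count)
    fix S T assume "(S, T) \<in> ?X"
    then obtain R where R: "R \<in> W" "S = {x}" "T = R - {x}" by blast
    moreover from this have "x \<in> R" "R \<subseteq> {1..n}" "card R = k" using assms by (auto simp: nsets_def)
    ultimately show "S \<subseteq> {1..n} \<and> T \<subseteq> {1..n} \<and> card S = card {1::nat} \<and>
      card T = card (block i - {1}) \<and> S \<inter> T = {}" using one by auto
  qed (use block_subset[of i] n_pos in auto)
  moreover have "card ?X = card W" using assms(2) by (intro card_image) (auto simp: inj_on_def)
  moreover have "\<sigma> permutes {1..n} \<and> (\<sigma> ` {1}, \<sigma> ` (block i - {1})) \<in> ?X \<longleftrightarrow>
      \<sigma> \<in> orders \<and> \<sigma> 1 = x \<and> arc_in W \<sigma> i" for \<sigma>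
  proof (cases "\<sigma> permutes {1..n} \<and> \<sigma> 1 = x")
    case True
    define B where "B = \<sigma> ` block i"
    have "\<sigma> ` (block i - {1}) = B - {x}" unfolding B_def
      using True permutes_inj[of \<sigma> "{1..n}"] by (simp add: image_set_diff)
    moreover have "x \<in> B" using one True unfolding B_def by blast
    hence "({x}, B - {x}) \<in> ?X \<longleftrightarrow> B \<in> W"
    proof (intro iffI)
      assume "({x}, B - {x}) \<in> ?X"
      then obtain S where "S \<in> W" "B - {x} = S - {x}" by blast
      moreover from this have "B = S" using \<open>x \<in> B\<close> assms(2) by blast
      ultimately show "B \<in> W" by simp
    qed blast
    ultimately show ?thesis using True by (simp add: orders_def arc_in_def B_def)
  qed (auto simp: orders_def)
  hence "{\<sigma>. \<sigma> permutes {1..n} \<and> (\<sigma> ` {1}, \<sigma> ` (block i - {1})) \<in> ?X} =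
      {\<sigma> \<in> orders. \<sigma> 1 = x \<and> arc_in W \<sigma> i}" by blast
  ultimately show ?thesis using one by simp
qed

lemma nonstar_arc_count:
  assumes "U \<subseteq> nsets {1..n} k" "\<And>S. S \<in> U \<Longrightarrow> x \<notin> S" "x \<in> {1..n}" "1 \<le> i" "i \<le> int n - int k"
  shows "card {\<sigma> \<in> orders. \<sigma> 1 = x \<and> arc_in U \<sigma> i} * (n * ((n - 1) choose k)) = card U * fact n"
proof -
  have one: "1 \<notin> block i" using one_in_block[of i] assms kn by simp
  let ?X = "(\<lambda>S. ({x}, S)) ` U"
  have "card {\<sigma>. \<sigma> permutes {1..n} \<and> (\<sigma> ` {1}, \<sigma> ` block i) \<in> ?X} *
      ((card {1..n} choose card {1::nat}) * ((card {1..n} - card {1::nat}) choose card (block i)))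
      = card ?X * fact (card {1..n})"
  proof (rule permutes_pair_count)
    fix S T assume "(S, T) \<in> ?X"
    then obtain R where R: "R \<in> U" "S = {x}" "T = R" by blast
    moreover from this have "x \<notin> R" "R \<subseteq> {1..n}" "card R = k" using assms by (auto simp: nsets_def)
    ultimately show "S \<subseteq> {1..n} \<and> T \<subseteq> {1..n} \<and> card S = card {1::nat} \<and>
      card T = card (block i) \<and> S \<inter> T = {}" using assms(3) by auto
  qed (use block_subset[of i] one n_pos in auto)
  moreover have "card ?X = card U" by (intro card_image) (auto simp: inj_on_def)
  moreover have "{\<sigma>. \<sigma> permutes {1..n} \<and> (\<sigma> ` {1}, \<sigma> ` block i) \<in> ?X} =
      {\<sigma> \<in> orders. \<sigma> 1 = x \<and> arc_in U \<sigma> i}" by (auto simp: orders_def arc_in_def)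
  ultimately show ?thesis by simp
qed

end

section \<open>Isoperimetry for centred orders\<close>

context cyclic_orders
begin

definition star_orders :: "nat \<Rightarrow> (nat \<Rightarrow> nat) set" where
  "star_orders x = {\<sigma> \<in> orders. \<sigma> 1 = x}"

text \<open>An upper bound for the proportion of defective orders: the arcs that \<open>C\<close> lacks on average,
  plus the contribution of the orders containing disjoint arcs of \<open>C\<close>.\<close>

definition shortfall :: "nat set set \<Rightarrow> real" where
  "shortfall C = real n / real (n choose k) * (real ((n - 1) choose (k - 1)) - real (card C))
     + (real n + 1) * real n ^ 2 * real (card (disjoint_pairs C))
         / (real (n choose k) * real ((n - k) choose k))"

definition pin_ratio :: "nat set set \<Rightarrow> nat \<Rightarrow> real" where
  "pin_ratio C x = real (card (pinned C x)) / fact (n - 1)"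

lemma finite_star_orders [simp]: "finite (star_orders x)"
  by (simp add: star_orders_def)

lemma pinned_star: "pinned C x \<subseteq> star_orders x"
  by (auto simp: pinned_def star_orders_def)

lemma finite_pinned [simp]: "finite (pinned C x)"
  using pinned_star finite_star_orders by (rule finite_subset)

lemma finite_defective [simp]: "finite (defective C)"
  using defective_subset finite_orders by (rule finite_subset)

lemma card_star_orders: "card (star_orders x) = fact (n - 1)" if "x \<in> {1..n}"
proof -
  have "card {\<sigma>. \<sigma> permutes {1..n} \<and> (\<sigma> ` {1}, \<sigma> ` {}) \<in> {({x}, {})}} *
      ((card {1..n} choose card {1::nat}) * ((card {1..n} - card {1::nat}) choose card ({} :: nat set)))
      = card {({x}, {} :: nat set)} * fact (card {1..n})"
    using that n_pos by (intro permutes_pair_count) auto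
  moreover have "{\<sigma>. \<sigma> permutes {1..n} \<and> (\<sigma> ` {1}, \<sigma> ` {}) \<in> {({x}, {})}} = star_orders x"
    by (auto simp: star_orders_def orders_def)
  ultimately have "card (star_orders x) * n = fact n" by simp
  also have "\<dots> = fact (n - 1) * n" using n_pos by (simp add: fact_reduce)
  finally show ?thesis using n_pos by simp
qed

text \<open>A union bound over the n^2 pairs of starts.\<close>

lemma bad_card:
  assumes "C \<subseteq> nsets {1..n} k"
  shows "card (bad C) * ((n choose k) * ((n - k) choose k)) \<le> n ^ 2 * card (disjoint_pairs C) * fact n"
proof -
  let ?I = "{0..<int n}"
  define A where "A i j = (if block i \<inter> block j = {} then {\<sigma> \<in> orders. arc_in C \<sigma> i \<and> arc_in C \<sigma> j} else {})"
    for i j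
  let ?Q = "(n choose k) * ((n - k) choose k)"
  have A: "card (A i j) * ?Q \<le> card (disjoint_pairs C) * fact n" for i j
    using disjoint_arcs_count[OF assms, of i j] by (simp add: A_def)
  have "bad C \<subseteq> (\<Union>i\<in>?I. \<Union>j\<in>?I. A i j)" unfolding bad_def A_def by fastforce
  hence "card (bad C) \<le> card (\<Union>i\<in>?I. \<Union>j\<in>?I. A i j)"
    by (intro card_mono) (auto simp: A_def)
  also have "\<dots> \<le> (\<Sum>i\<in>?I. card (\<Union>j\<in>?I. A i j))" by (intro card_UN_le) auto
  also have "\<dots> \<le> (\<Sum>i\<in>?I. \<Sum>j\<in>?I. card (A i j))" by (intro sum_mono card_UN_le) auto
  finally have "card (bad C) * ?Q \<le> (\<Sum>i\<in>?I. \<Sum>j\<in>?I. card (A i j)) * ?Q" by (rule mult_right_mono) simp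
  also have "\<dots> = (\<Sum>i\<in>?I. \<Sum>j\<in>?I. card (A i j) * ?Q)" by (simp only: sum_distrib_right)
  also have "\<dots> \<le> (\<Sum>i\<in>?I. \<Sum>j\<in>?I. card (disjoint_pairs C) * fact n)" by (intro sum_mono A)
  finally show ?thesis by (simp add: power2_eq_square algebra_simps)
qed

lemma weight_sum:
  assumes "C \<subseteq> nsets {1..n} k"
  shows "(\<Sum>\<sigma>\<in>orders. weight C \<sigma>) * (n choose k) = n * card C * fact n"
proof -
  have "(\<Sum>\<sigma>\<in>orders. weight C \<sigma>) = (\<Sum>\<sigma>\<in>orders. \<Sum>i\<in>{0..<int n}. if arc_in C \<sigma> i then 1 else 0)"
    unfolding weight_def by (intro sum.cong refl) (simp add: sum.If_cases Int_def)
  also have "\<dots> = (\<Sum>i\<in>{0..<int n}. card {\<sigma> \<in> orders. arc_in C \<sigma> i})"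
    by (subst sum.swap) (simp add: sum.If_cases Int_def)
  finally have "(\<Sum>\<sigma>\<in>orders. weight C \<sigma>) * (n choose k) =
    (\<Sum>i\<in>{0..<int n}. card {\<sigma> \<in> orders. arc_in C \<sigma> i} * (n choose k))" by (simp add: sum_distrib_right)
  also have "\<dots> = (\<Sum>i\<in>{0..<int n}. card C * fact n)" by (intro sum.cong refl arc_count assms)
  finally show ?thesis by simp
qed

lemma choose_pos: "(n choose k) > 0" "((n - k) choose k) > 0" "((n - 1) choose (k - 1)) > 0"
  "((n - 1) choose k) > 0"
  using kn k2 by (auto simp: zero_less_binomial)

lemma star_choose: "k * (n choose k) = n * ((n - 1) choose (k - 1))"
  using binomial_absorption[of "k - 1" "n"] k_pos by simp

lemma card_defective:
  assumes "C \<subseteq> nsets {1..n} k"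
  shows "real (card (defective C)) \<le> shortfall C * fact n"
proof -
  let ?N = "real (n choose k)" and ?a = "real ((n - 1) choose (k - 1))"
  let ?D = "real ((n - k) choose k)"
  \<comment> \<open>A pointwise majorant of the weight. Without disjoint arcs the weight is at most
    k, and at most k - 1 if the order is defective; for a bad order the term n + 1 also covers the
    subtracted 1, since the weight never exceeds n. Averaging \<open>u\<close> bounds the defective
    orders.\<close>
  define u where "u \<sigma> = real k - (if \<sigma> \<in> defective C then 1 else 0) + (if \<sigma> \<in> bad C then real n + 1 else 0)" for \<sigma>
  have u: "real (weight C \<sigma>) \<le> u \<sigma>" if \<sigma>: "\<sigma> \<in> orders" for \<sigma>
  proof (cases "\<sigma> \<in> bad C")
    case True
    then show ?thesis using weight_le_n[of C \<sigma>] \<sigma> by (simp add: u_def defective_def)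
  next
    case False
    then show ?thesis using weight_le[OF \<sigma> False] \<sigma> by (auto simp: u_def defective_def)
  qed
  have "real (\<Sum>\<sigma>\<in>orders. weight C \<sigma>) \<le> (\<Sum>\<sigma>\<in>orders. u \<sigma>)"
    unfolding of_nat_sum by (rule sum_mono) (rule u)
  also have "\<dots> = real k * fact n - card (defective C) + (real n + 1) * card (bad C)"
  proof -
    have "orders \<inter> {x. x \<in> defective C} = defective C" "orders \<inter> {x. x \<in> bad C} = bad C"
      using bad_subset defective_subset by auto
    thus ?thesis unfolding u_def
      by (simp add: sum.distrib sum_subtractf sum.If_cases card_orders)
  qed
  finally have 1: "card (defective C) \<le> real k * fact n + (real n + 1) * card (bad C)
      - real (\<Sum>\<sigma>\<in>orders. weight C \<sigma>)" by simp
  have pos: "?N > 0" "?D > 0" using choose_pos by simp_all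
  have "real ((\<Sum>\<sigma>\<in>orders. weight C \<sigma>) * (n choose k)) = real (n * card C * fact n)"
    using weight_sum[OF assms] by simp
  hence 2: "real (\<Sum>\<sigma>\<in>orders. weight C \<sigma>) = real n * card C * fact n / ?N"
    using pos by (simp add: field_simps)
  have "real (card (bad C) * ((n choose k) * ((n - k) choose k))) \<le> real (n ^ 2 * card (disjoint_pairs C) * fact n)"
    using bad_card[OF assms] by (simp only: of_nat_le_iff)
  hence 3: "card (bad C) \<le> real n ^ 2 * card (disjoint_pairs C) * fact n / (?N * ?D)"
    using pos by (simp add: field_simps)
  have "real (k * (n choose k)) = real (n * ((n - 1) choose (k - 1)))" using star_choose by simp
  hence 4: "real k = real n * ?a / ?N" using pos by (simp add: field_simps)
  have "card (defective C) \<le> real n * ?a / ?N * fact n + (real n + 1) *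
     (real n ^ 2 * card (disjoint_pairs C) * fact n / (?N * ?D)) - real n * card C * fact n / ?N"
    using 1 mult_left_mono[OF 3, of "real n + 1"] unfolding 2 unfolding 4 by simp
  also have "\<dots> = shortfall C * fact n"
    unfolding shortfall_def by (simp add: algebra_simps diff_divide_distrib add_divide_distrib)
  finally show ?thesis .
qed

text \<open>The last alternative is an arc with negative start that wraps around and reaches j from
  the other end of the cycle.\<close>

lemma pos_in_block:
  assumes "0 \<le> j" "j < int n" "1 - int k \<le> i" "i \<le> int n - int k"
  shows "pos j \<in> block i \<longleftrightarrow> i \<le> j \<and> j < i + int k \<or> i \<le> j - int n"
proof -
  have "pos j \<in> block i \<longleftrightarrow> (\<exists>m\<in>{i..<i + int k}. pos j = pos m)" unfolding block_def image_iff ..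
  also have "\<dots> \<longleftrightarrow> (\<exists>m\<in>{i..<i + int k}. m = j \<or> m = j - int n)"
  proof (intro bex_cong refl)
    fix m assume m: "m \<in> {i..<i + int k}"
    show "pos j = pos m \<longleftrightarrow> m = j \<or> m = j - int n"
    proof (cases "m \<ge> 0")
      case True
      hence "\<bar>j - m\<bar> < int n" using m assms by auto
      thus ?thesis using pos_eq_window[of j m] True assms by auto
    next
      case False
      hence "\<bar>j - (m + int n)\<bar> < int n" using m assms kn by auto
      thus ?thesis using pos_eq_window[of j "m + int n"] pos_shift[of m] False assms by auto
    qed
  qed
  finally show ?thesis using assms by auto
qed

lemma transpose_image_same: "transpose a b ` B = B" if "a \<in> B \<longleftrightarrow> b \<in> B"
  using that by (auto simp: transpose_def image_iff)

text \<open>Positions q and q + 1 differ from position 1, so x stays put. The new order has some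
  centre because it is not defective, and \<open>centred_adjacent\<close> forces that centre to be
  x.\<close>

lemma pinned_adjacent:
  assumes \<sigma>: "\<sigma> \<in> pinned C x" and q: "2 \<le> q" "q < n"
    and nd: "\<sigma> \<circ> transpose q (Suc q) \<notin> defective C"
  shows "\<sigma> \<circ> transpose q (Suc q) \<in> pinned C x"
proof -
  let ?s = "transpose q (Suc q)"
  define j where "j = int q - 1"
  have j: "1 \<le> j" "j \<le> int n - 2" using q by (auto simp: j_def)
  have pj: "pos j = q" "pos (j + 1) = Suc q" using j pos_small[of j] pos_small[of "j + 1"] by (auto simp: j_def)
  have \<sigma>p: "\<sigma> permutes {1..n}" "\<sigma> 1 = x" "centred n k (arc_in C \<sigma>) 0"
    using \<sigma> by (auto simp: pinned_def orders_def)
  have "?s permutes {1..n}" using q by (intro permutes_swap_id) auto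
  hence o: "\<sigma> \<circ> ?s \<in> orders" using \<sigma>p by (simp add: orders_def permutes_compose)
  obtain c where c: "centred n k (arc_in C (\<sigma> \<circ> ?s)) c" using ex_centre[of "\<sigma> \<circ> ?s" C] o nd by blast
  have "centred n k (arc_in C (\<sigma> \<circ> ?s)) 0"
  proof (rule centred_adjacent[OF periodic_arc_in k2 kn \<sigma>p(3) c j])
    fix i assume i: "1 - int k \<le> i" "i \<le> int n - int k" "i \<noteq> j + 1" "i \<noteq> j + 1 - int n" "i \<noteq> j - int k + 1"
    have "pos j \<in> block i \<longleftrightarrow> pos (j + 1) \<in> block i"
      using i j by (subst (1 2) pos_in_block) auto
    hence "q \<in> block i \<longleftrightarrow> Suc q \<in> block i" unfolding pj .
    hence "?s ` block i = block i" by (rule transpose_image_same)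
    hence "(\<sigma> \<circ> ?s) ` block i = \<sigma> ` block i" by (metis image_comp)
    thus "arc_in C \<sigma> i = arc_in C (\<sigma> \<circ> ?s) i" by (simp add: arc_in_def)
  qed
  moreover have "(\<sigma> \<circ> ?s) 1 = x" using \<sigma>p q by (simp add: transpose_def)
  ultimately show ?thesis using o nd by (simp add: pinned_def)
qed

lemma compose_right_inj: "inj_on (\<lambda>\<sigma>. \<sigma> \<circ> \<pi>) A" if "surj \<pi>"
  by (rule inj_onI) (metis that comp_assoc comp_id surj_iff)

text \<open>Count the pairs of a pinned \<sigma> and a permutation \<pi> of {2..n} for which
  \<sigma> \<circ> \<pi> is not pinned. Each \<sigma> escapes to every unpinned order with x at
  position 1. For a fixed \<pi> the escapes are bounded by those of its adjacent factors, and an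
  adjacent swap can leave the pinned orders only into a defective one.\<close>

lemma isoperimetry:
  assumes x: "x \<in> {1..n}"
  shows "card (pinned C x) * (fact (n - 1) - card (pinned C x))
    \<le> fact (n - 1) * (2 * n ^ 2 * card (defective C))"
proof -
  let ?G = "pinned C x" and ?H = "{\<pi>. \<pi> permutes {2..n}}"
  define f where "f \<pi> = card {\<sigma> \<in> ?G. \<sigma> \<circ> \<pi> \<notin> ?G}" for \<pi>
  have finH: "finite ?H" and cardH: "card ?H = fact (n - 1)"
    by (auto intro!: finite_permutations card_permutations)
  have bound: "f \<pi> \<le> 2 * n ^ 2 * card (defective C)" if "\<pi> permutes {2..n}" for \<pi>
  proof (rule permutes_subadditive_bound[OF _ _ _ _ that])
    fix \<pi> \<rho> assume p: "\<pi> permutes {2..n}" "\<rho> permutes {2..n}"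
    have "{\<sigma> \<in> ?G. \<sigma> \<circ> (\<pi> \<circ> \<rho>) \<notin> ?G} \<subseteq> {\<sigma> \<in> ?G. \<sigma> \<circ> \<pi> \<notin> ?G} \<union> {\<sigma>. \<sigma> \<circ> \<pi> \<in> {\<sigma> \<in> ?G. \<sigma> \<circ> \<rho> \<notin> ?G}}"
      by (auto simp: comp_assoc)
    moreover have inj: "inj (\<lambda>\<sigma> :: nat \<Rightarrow> nat. \<sigma> \<circ> \<pi>)"
      using permutes_surj[OF p(1)] by (rule compose_right_inj)
    have vi: "{\<sigma>. \<sigma> \<circ> \<pi> \<in> {\<sigma> \<in> ?G. \<sigma> \<circ> \<rho> \<notin> ?G}} = (\<lambda>\<sigma>. \<sigma> \<circ> \<pi>) -` {\<sigma> \<in> ?G. \<sigma> \<circ> \<rho> \<notin> ?G}" by auto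
    have "finite {\<sigma>. \<sigma> \<circ> \<pi> \<in> {\<sigma> \<in> ?G. \<sigma> \<circ> \<rho> \<notin> ?G}}" unfolding vi
      by (rule finite_vimageI[OF _ inj]) simp
    ultimately have "f (\<pi> \<circ> \<rho>) \<le> card ({\<sigma> \<in> ?G. \<sigma> \<circ> \<pi> \<notin> ?G} \<union> {\<sigma>. \<sigma> \<circ> \<pi> \<in> {\<sigma> \<in> ?G. \<sigma> \<circ> \<rho> \<notin> ?G}})"
      unfolding f_def by (intro card_mono) auto
    also have "\<dots> \<le> f \<pi> + card {\<sigma>. \<sigma> \<circ> \<pi> \<in> {\<sigma> \<in> ?G. \<sigma> \<circ> \<rho> \<notin> ?G}}"
      unfolding f_def by (rule card_Un_le)
    also have "card {\<sigma>. \<sigma> \<circ> \<pi> \<in> {\<sigma> \<in> ?G. \<sigma> \<circ> \<rho> \<notin> ?G}} \<le> f \<rho>"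
      unfolding vi f_def using card_vimage_inj_on_le[OF inj, of "{\<sigma> \<in> ?G. \<sigma> \<circ> \<rho> \<notin> ?G}"] by simp
    finally show "f (\<pi> \<circ> \<rho>) \<le> f \<pi> + f \<rho>" by simp
  next
    fix q assume q: "2 \<le> q" "q < n"
    let ?s = "transpose q (Suc q)"
    have "(\<lambda>\<sigma>. \<sigma> \<circ> ?s) ` {\<sigma> \<in> ?G. \<sigma> \<circ> ?s \<notin> ?G} \<subseteq> defective C"
      using pinned_adjacent[OF _ q] by auto
    moreover have "inj_on (\<lambda>\<sigma>. \<sigma> \<circ> ?s) {\<sigma> \<in> ?G. \<sigma> \<circ> ?s \<notin> ?G}"
      by (rule compose_right_inj) simp
    ultimately show "f ?s \<le> card (defective C)" unfolding f_def by (intro card_inj_on_le) auto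
  qed (auto simp: f_def comp_def)
  \<comment> \<open>Composition with the permutations fixing 1 carries \<sigma> to all orders with x
    at position 1, hence to every unpinned one.\<close>
  have cov: "fact (n - 1) - card ?G \<le> card {\<pi> \<in> ?H. \<sigma> \<circ> \<pi> \<notin> ?G}" if "\<sigma> \<in> ?G" for \<sigma>
  proof -
    have \<sigma>: "\<sigma> permutes {1..n}" "\<sigma> 1 = x" using that by (auto simp: pinned_def orders_def)
    have "star_orders x - ?G \<subseteq> (\<lambda>\<pi>. \<sigma> \<circ> \<pi>) ` {\<pi> \<in> ?H. \<sigma> \<circ> \<pi> \<notin> ?G}"
    proof
      fix \<tau> assume \<tau>: "\<tau> \<in> star_orders x - ?G"
      hence \<tau>': "\<tau> permutes {1..n}" "\<tau> 1 = x" by (auto simp: star_orders_def orders_def)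
      have "inv \<sigma> \<circ> \<tau> permutes {1..n}" using \<sigma> \<tau>' by (intro permutes_compose permutes_inv)
      moreover have "(inv \<sigma> \<circ> \<tau>) 1 = 1" using \<sigma> \<tau>' permutes_inverses(2)[OF \<sigma>(1), of 1] by simp
      ultimately have H: "inv \<sigma> \<circ> \<tau> permutes {2..n}"
      proof (rule_tac permutes_superset)
        fix y assume "y \<in> {1..n} - {2..n}"
        hence "y = 1" by auto
        thus "(inv \<sigma> \<circ> \<tau>) y = y" using \<open>(inv \<sigma> \<circ> \<tau>) 1 = 1\<close> by simp
      qed
      have "\<sigma> \<circ> (inv \<sigma> \<circ> \<tau>) = \<tau>" using permutes_inv_o(1)[OF \<sigma>(1)] by (simp add: comp_assoc[symmetric])
      thus "\<tau> \<in> (\<lambda>\<pi>. \<sigma> \<circ> \<pi>) ` {\<pi> \<in> ?H. \<sigma> \<circ> \<pi> \<notin> ?G}"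
        using \<tau> H by (intro image_eqI[of _ _ "inv \<sigma> \<circ> \<tau>"]) auto
    qed
    hence "card (star_orders x - ?G) \<le> card {\<pi> \<in> ?H. \<sigma> \<circ> \<pi> \<notin> ?G}"
      using finH by (intro surj_card_le) auto
    thus ?thesis using card_star_orders[OF x] pinned_star by (simp add: card_Diff_subset)
  qed
  have "card ?G * (fact (n - 1) - card ?G) = (\<Sum>\<sigma>\<in>?G. fact (n - 1) - card ?G)" by simp
  also have "\<dots> \<le> (\<Sum>\<sigma>\<in>?G. card {\<pi> \<in> ?H. \<sigma> \<circ> \<pi> \<notin> ?G})" by (intro sum_mono cov)
  also have "\<dots> = (\<Sum>\<sigma>\<in>?G. \<Sum>\<pi>\<in>?H. if \<sigma> \<circ> \<pi> \<notin> ?G then 1 else 0)"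
    using finH by (intro sum.cong refl) (simp add: sum.If_cases Int_def)
  also have "\<dots> = (\<Sum>\<pi>\<in>?H. f \<pi>)"
    unfolding f_def by (subst sum.swap) (intro sum.cong refl, simp add: sum.If_cases Int_def)
  also have "\<dots> \<le> (\<Sum>\<pi>\<in>?H. 2 * n ^ 2 * card (defective C))" by (intro sum_mono bound) auto
  also have "\<dots> = fact (n - 1) * (2 * n ^ 2 * card (defective C))" using cardH by simp
  finally show ?thesis .
qed

section \<open>Densities of pinned orders\<close>

lemma finite_bad [simp]: "finite (bad C)"
  using bad_subset finite_orders by (rule finite_subset)

lemma fact_split: "(fact n :: real) = real n * fact (n - 1)"
  using n_pos by (simp add: fact_reduce)

lemma pin_ratio_nonneg: "0 \<le> pin_ratio C x"
  by (simp add: pin_ratio_def)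

lemma pin_ratio_le1: "pin_ratio C x \<le> 1" if "x \<in> {1..n}"
proof -
  have "card (pinned C x) \<le> fact (n - 1)"
    using card_mono[OF finite_star_orders pinned_star] card_star_orders[OF that] by metis
  hence "real (card (pinned C x)) \<le> real (fact (n - 1))" by (simp only: of_nat_le_iff)
  thus ?thesis by (simp add: pin_ratio_def)
qed

lemma isoperimetry_ratio:
  assumes C: "C \<subseteq> nsets {1..n} k" and x: "x \<in> {1..n}"
  shows "pin_ratio C x * (1 - pin_ratio C x) \<le> 2 * real n ^ 3 * shortfall C"
proof -
  let ?M = "fact (n - 1) :: real"
  have M: "?M > 0" by simp
  have le: "card (pinned C x) \<le> fact (n - 1)"
    using card_mono[OF finite_star_orders pinned_star] card_star_orders[OF x] by metis
  have "real (card (pinned C x) * (fact (n - 1) - card (pinned C x)))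
      \<le> real (fact (n - 1) * (2 * n ^ 2 * card (defective C)))"
    using isoperimetry[OF x] by (simp only: of_nat_le_iff)
  hence "card (pinned C x) * (?M - card (pinned C x)) \<le> ?M * (2 * real n ^ 2 * card (defective C))"
    using le by (simp add: of_nat_diff)
  also have "\<dots> \<le> ?M * (2 * real n ^ 2 * (shortfall C * fact n))"
    using card_defective[OF C] by (intro mult_left_mono) auto
  also have "\<dots> = (2 * real n ^ 3 * shortfall C) * ?M ^ 2"
    unfolding fact_split by (simp add: power2_eq_square power3_eq_cube)
  finally have "card (pinned C x) * (?M - card (pinned C x)) / ?M ^ 2 \<le> 2 * real n ^ 3 * shortfall C"
    by (simp add: field_simps)
  moreover have "card (pinned C x) * (?M - card (pinned C x)) / ?M ^ 2 = pin_ratio C x * (1 - pin_ratio C x)"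
    unfolding pin_ratio_def by (simp add: field_simps power2_eq_square)
  ultimately show ?thesis by simp
qed

lemma defect_ratio:
  assumes "C \<subseteq> nsets {1..n} k" "x \<in> {1..n}" "pin_ratio C x \<ge> 1 / 2"
  shows "1 - pin_ratio C x \<le> 4 * real n ^ 3 * shortfall C"
proof -
  have "1 / 2 * (1 - pin_ratio C x) \<le> pin_ratio C x * (1 - pin_ratio C x)"
    using assms pin_ratio_le1 by (intro mult_right_mono) auto
  thus ?thesis using isoperimetry_ratio[OF assms(1,2)] by simp
qed

lemma rotate_orders:
  assumes "0 \<le> c" "c < int n"
  obtains \<rho> where "\<rho> permutes {1..n}" "\<And>i. \<rho> ` block i = block (i + c)"
proof -
  define \<rho> where "\<rho> j = (if j \<in> {1..n} then pos (int j - 1 + c) else j)" for j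
  have \<rho>pos: "\<rho> (pos i) = pos (i + c)" for i
  proof -
    have "int (pos i) - 1 = i mod int n" using n_pos by (simp add: pos_def)
    hence "\<rho> (pos i) = pos (i mod int n + c)" using pos_in[of i] by (simp add: \<rho>_def)
    also have "\<dots> = pos (i + c)" by (simp add: pos_eq_iff mod_add_left_eq)
    finally show ?thesis .
  qed
  have surj: "\<rho> ` {1..n} = {1..n}"
  proof
    show "\<rho> ` {1..n} \<subseteq> {1..n}" using pos_in by (auto simp: \<rho>_def)
    show "{1..n} \<subseteq> \<rho> ` {1..n}"
    proof
      fix j assume j: "j \<in> {1..n}"
      have "pos (int j - 1) = j" using pos_small[of "int j - 1"] j by auto
      hence "\<rho> (pos (int j - 1 - c)) = j" using \<rho>pos[of "int j - 1 - c"] by simp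
      thus "j \<in> \<rho> ` {1..n}" using pos_in[of "int j - 1 - c"] by (metis imageI)
    qed
  qed
  hence "bij_betw \<rho> {1..n} {1..n}" unfolding bij_betw_def
    using eq_card_imp_inj_on[of "{1..n}" \<rho>] by simp
  hence "\<rho> permutes {1..n}" by (rule bij_imp_permutes) (simp only: \<rho>_def if_False)
  moreover have "\<rho> ` block i = block (i + c)" for i
  proof -
    have eq: "{i + c..<i + c + int k} = (\<lambda>j. j + c) ` {i..<i + int k}"
      by (simp add: image_add_atLeastLessThan' add_ac)
    show ?thesis unfolding block_def eq image_image \<rho>pos ..
  qed
  ultimately show ?thesis using that by blast
qed

text \<open>Rotating by c moves a centre c to 0 and is injective on orders. So each of the n classes
  of non-defective orders, sorted by centre, is no larger than the union of the pinned sets.\<close>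

lemma pinned_cover:
  assumes C: "C \<subseteq> nsets {1..n} k"
  shows "fact n - card (defective C) \<le> n * (\<Sum>x\<in>{1..n}. card (pinned C x))"
proof -
  define Z where "Z c = {\<sigma> \<in> orders - defective C. centred n k (arc_in C \<sigma>) c}" for c
  let ?P = "\<Union>x\<in>{1..n}. pinned C x"
  have Z: "card (Z c) \<le> card ?P" if c: "c \<in> {0..<int n}" for c
  proof -
    obtain \<rho> where \<rho>: "\<rho> permutes {1..n}" "\<And>i. \<rho> ` block i = block (i + c)"
      using rotate_orders[of c] c by auto
    have arc: "arc_in C (\<sigma> \<circ> \<rho>) i = arc_in C \<sigma> (i + c)" for \<sigma> i
      by (metis arc_in_def image_comp \<rho>(2))
    have "(\<lambda>\<sigma>. \<sigma> \<circ> \<rho>) ` Z c \<subseteq> ?P"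
    proof (intro subsetI, elim imageE)
      fix \<tau> \<sigma> assume \<sigma>: "\<sigma> \<in> Z c" "\<tau> = \<sigma> \<circ> \<rho>"
      have o: "\<tau> \<in> orders" using \<sigma> \<rho> by (simp add: Z_def orders_def permutes_compose)
      have cen: "centred n k (arc_in C \<sigma>) c" and so: "\<sigma> \<in> orders" "\<sigma> \<notin> bad C"
        using \<sigma> by (auto simp: Z_def defective_def)
      have sh: "block (i mod int n) = block i" for i
        using periodic_mod[of n "\<lambda>j. block j = block i" i] by (simp add: periodic_def block_shift)
      have "\<tau> \<notin> bad C"
      proof
        assume "\<tau> \<in> bad C"
        then obtain i j where ij: "arc_in C \<tau> i" "arc_in C \<tau> j" "block i \<inter> block j = {}"
          unfolding bad_def by blast
        have "arc_in C \<sigma> ((i + c) mod int n)" "arc_in C \<sigma> ((j + c) mod int n)"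
          using ij(1,2) unfolding \<sigma>(2) arc by (simp_all only: arc_in_def sh)
        moreover have "block ((i + c) mod int n) \<inter> block ((j + c) mod int n) = {}"
          using ij(3) image_Int[OF permutes_inj[OF \<rho>(1)], of "block i" "block j"] unfolding sh \<rho>(2) by simp
        ultimately show False using so n_pos unfolding bad_def by force
      qed
      moreover have "\<And>i. 1 - int k \<le> i \<Longrightarrow> i \<le> 0 \<Longrightarrow> arc_in C \<tau> i"
        using cen kn unfolding \<sigma> arc centred_def by auto
      ultimately have "\<tau> \<in> pinned C (\<tau> 1)" using o by (intro pinnedI) auto
      moreover have "\<tau> 1 \<in> {1..n}" using o n_pos permutes_in_image[of \<tau> "{1..n}" 1] by (auto simp: orders_def)
      ultimately show "\<tau> \<in> ?P" by blast
    qed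
    moreover have "inj_on (\<lambda>\<sigma>. \<sigma> \<circ> \<rho>) (Z c)" using permutes_surj[OF \<rho>(1)] by (rule compose_right_inj)
    ultimately show ?thesis by (intro card_inj_on_le) auto
  qed
  have "fact n - card (defective C) = card (orders - defective C)"
    using defective_subset card_orders by (simp add: card_Diff_subset)
  also have "orders - defective C \<subseteq> (\<Union>c\<in>{0..<int n}. Z c)" using ex_centre unfolding Z_def by blast
  hence "card (orders - defective C) \<le> card (\<Union>c\<in>{0..<int n}. Z c)"
    by (intro card_mono) (auto simp: Z_def)
  also have "\<dots> \<le> (\<Sum>c\<in>{0..<int n}. card (Z c))" by (intro card_UN_le) auto
  also have "\<dots> \<le> (\<Sum>c\<in>{0..<int n}. card ?P)" by (intro sum_mono Z)
  also have "\<dots> = n * card ?P" by simp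
  also have "card ?P \<le> (\<Sum>x\<in>{1..n}. card (pinned C x))" by (intro card_UN_le) auto
  finally show ?thesis by simp
qed

lemma pin_ratio_sum:
  assumes C: "C \<subseteq> nsets {1..n} k"
  shows "1 - shortfall C \<le> (\<Sum>x\<in>{1..n}. pin_ratio C x)"
proof -
  have "card (defective C) \<le> fact n" using card_mono[OF finite_orders defective_subset] card_orders by metis
  hence "fact n - real (card (defective C)) = real (fact n - card (defective C))" by (simp add: of_nat_diff)
  also have "\<dots> \<le> real (n * (\<Sum>x\<in>{1..n}. card (pinned C x)))"
    using pinned_cover[OF C] by (simp only: of_nat_le_iff)
  finally have "(1 - shortfall C) * fact n \<le> real n * (\<Sum>x\<in>{1..n}. real (card (pinned C x)))"
    using card_defective[OF C] by (simp add: algebra_simps)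
  also have "\<dots> = (\<Sum>x\<in>{1..n}. pin_ratio C x) * fact n"
    unfolding pin_ratio_def fact_split by (simp add: sum_divide_distrib[symmetric])
  finally show ?thesis by simp
qed

text \<open>Isoperimetry forbids intermediate densities: a \<open>pin_ratio\<close> below 1/2 is at
  most 1 / (4 n). If all of them were that small they would sum to at most 1/4, but
  \<open>pin_ratio_sum\<close> makes the sum nearly 1.\<close>

lemma ex_pinned:
  assumes C: "C \<subseteq> nsets {1..n} k" and s: "shortfall C \<le> 1 / (16 * real n ^ 4)"
  shows "\<exists>x\<in>{1..n}. pin_ratio C x \<ge> 1 / 2"
proof (rule ccontr)
  assume "\<not> ?thesis"
  hence lt: "pin_ratio C x < 1 / 2" if "x \<in> {1..n}" for x using that by force
  have n1: "real n \<ge> 1" using n_pos by simp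
  have le: "pin_ratio C x \<le> 4 * real n ^ 3 * (1 / (16 * real n ^ 4))" if x: "x \<in> {1..n}" for x
  proof -
    have "pin_ratio C x * (1 / 2) \<le> pin_ratio C x * (1 - pin_ratio C x)"
      using lt[OF x] pin_ratio_nonneg by (intro mult_left_mono) auto
    also have "\<dots> \<le> 2 * real n ^ 3 * shortfall C" by (rule isoperimetry_ratio[OF C x])
    also have "\<dots> \<le> 2 * real n ^ 3 * (1 / (16 * real n ^ 4))" using s by (intro mult_left_mono) auto
    finally show ?thesis by simp
  qed
  have "1 - shortfall C \<le> (\<Sum>x\<in>{1..n}. pin_ratio C x)" by (rule pin_ratio_sum[OF C])
  also have "\<dots> \<le> (\<Sum>x\<in>{1..n}. 4 * real n ^ 3 * (1 / (16 * real n ^ 4)))" by (intro sum_mono le)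
  also have "\<dots> = 1 / 4" using n1 by (simp add: field_simps power4_eq_xxxx power3_eq_cube)
  finally have "3 / 4 \<le> shortfall C" by simp
  also have "\<dots> \<le> 1 / 16"
  proof -
    have "1 \<le> real n ^ 4" using n1 by simp
    thus ?thesis using s by (smt (verit) frac_le)
  qed
  finally show False by simp
qed

lemma star_ratio:
  assumes W: "W \<subseteq> nsets {1..n} k" "\<And>S. S \<in> W \<Longrightarrow> x \<in> S" and x: "x \<in> {1..n}" and "1 - int k \<le> i" "i \<le> 0"
  shows "real (card {\<sigma> \<in> star_orders x. arc_in W \<sigma> i}) / fact (n - 1) =
    real (card W) / real ((n - 1) choose (k - 1))"
proof -
  have "real (card {\<sigma> \<in> orders. \<sigma> 1 = x \<and> arc_in W \<sigma> i} * (n * ((n - 1) choose (k - 1)))) = real (card W * fact n)"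
    using star_arc_count[OF W assms(4,5)] by simp
  moreover have "{\<sigma> \<in> orders. \<sigma> 1 = x \<and> arc_in W \<sigma> i} = {\<sigma> \<in> star_orders x. arc_in W \<sigma> i}"
    by (auto simp: star_orders_def)
  ultimately show ?thesis using n_pos choose_pos(3) by (simp add: fact_split field_simps)
qed

lemma nonstar_ratio:
  assumes U: "U \<subseteq> nsets {1..n} k" "\<And>S. S \<in> U \<Longrightarrow> x \<notin> S" and x: "x \<in> {1..n}" and "1 \<le> i" "i \<le> int n - int k"
  shows "real (card {\<sigma> \<in> star_orders x. arc_in U \<sigma> i}) / fact (n - 1) =
    real (card U) / real ((n - 1) choose k)"
proof -
  have "real (card {\<sigma> \<in> orders. \<sigma> 1 = x \<and> arc_in U \<sigma> i} * (n * ((n - 1) choose k))) = real (card U * fact n)"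
    using nonstar_arc_count[OF U x assms(4,5)] by simp
  moreover have "{\<sigma> \<in> orders. \<sigma> 1 = x \<and> arc_in U \<sigma> i} = {\<sigma> \<in> star_orders x. arc_in U \<sigma> i}"
    by (auto simp: star_orders_def)
  ultimately show ?thesis using n_pos choose_pos(4) by (simp add: fact_split field_simps)
qed

lemma ratio_complement:
  assumes x: "x \<in> {1..n}" and A: "A \<subseteq> star_orders x" "A \<inter> pinned C x = {}"
  shows "real (card A) / fact (n - 1) \<le> 1 - pin_ratio C x"
proof -
  have "card A + card (pinned C x) = card (A \<union> pinned C x)"
    using A finite_subset[OF A(1) finite_star_orders] by (intro card_Un_disjoint[symmetric]) auto
  also have "\<dots> \<le> card (star_orders x)" using A pinned_star by (intro card_mono) auto
  finally have "real (card A + card (pinned C x)) \<le> real (fact (n - 1))"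
    using card_star_orders[OF x] by (simp only: of_nat_le_iff)
  thus ?thesis by (simp add: pin_ratio_def field_simps)
qed

text \<open>In a pinned order the arc starting at 0 contains x and lies in \<open>C\<close>. Orders
  showing a member of \<open>W\<close> there are thus unpinned, and their density is that of
  \<open>W\<close> in the star.\<close>

lemma missing_ratio:
  assumes W: "W \<subseteq> nsets {1..n} k" "\<And>S. S \<in> W \<Longrightarrow> x \<in> S" "W \<inter> C = {}" and x: "x \<in> {1..n}"
  shows "real (card W) / real ((n - 1) choose (k - 1)) \<le> 1 - pin_ratio C x"
proof -
  have "arc_in C \<sigma> 0" if "\<sigma> \<in> pinned C x" for \<sigma>
    using that kn k_pos by (auto simp: pinned_def centred_def)
  hence "{\<sigma> \<in> star_orders x. arc_in W \<sigma> 0} \<inter> pinned C x = {}"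
    using W(3) by (auto simp: arc_in_def)
  hence "real (card {\<sigma> \<in> star_orders x. arc_in W \<sigma> 0}) / fact (n - 1) \<le> 1 - pin_ratio C x"
    by (intro ratio_complement x) auto
  thus ?thesis using star_ratio[OF W(1,2) x, of 0] k_pos by simp
qed

text \<open>The arc starting at 1 is the first one to avoid position 1. Pinned orders have no member
  of \<open>C\<close> there.\<close>

lemma excess_ratio:
  assumes C: "C \<subseteq> nsets {1..n} k" and x: "x \<in> {1..n}"
  shows "real (card {S \<in> C. x \<notin> S}) / real ((n - 1) choose k) \<le> 1 - pin_ratio C x"
proof -
  let ?U = "{S \<in> C. x \<notin> S}"
  have "\<not> arc_in C \<sigma> 1" if "\<sigma> \<in> pinned C x" for \<sigma>
    using that kn k_pos by (auto simp: pinned_def centred_def)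
  hence "{\<sigma> \<in> star_orders x. arc_in ?U \<sigma> 1} \<inter> pinned C x = {}"
    by (auto simp: arc_in_def)
  hence "real (card {\<sigma> \<in> star_orders x. arc_in ?U \<sigma> 1}) / fact (n - 1) \<le> 1 - pin_ratio C x"
    by (intro ratio_complement x) auto
  moreover have "real (card {\<sigma> \<in> star_orders x. arc_in ?U \<sigma> 1}) / fact (n - 1) =
    real (card ?U) / real ((n - 1) choose k)"
    using C kn by (intro nonstar_ratio x) auto
  ultimately show ?thesis by simp
qed

text \<open>An order with x at position 1 is pinned unless it is bad or one of its k arcs through x
  lies in \<open>W\<close>. The first summand is a union bound over these arcs, the second bounds
  the bad orders.\<close>

lemma pin_ratio_lower:
  assumes C: "C \<subseteq> nsets {1..n} k" and x: "x \<in> {1..n}"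
    and W: "W \<subseteq> nsets {1..n} k" "\<And>S. S \<in> W \<Longrightarrow> x \<in> S" "\<And>S. S \<in> nsets {1..n} k \<Longrightarrow> x \<in> S \<Longrightarrow> S \<notin> W \<Longrightarrow> S \<in> C"
  shows "1 - pin_ratio C x \<le> real k * real (card W) / real ((n - 1) choose (k - 1))
    + real n ^ 3 * real (card (disjoint_pairs C)) / (real (n choose k) * real ((n - k) choose k))"
proof -
  let ?M = "fact (n - 1) :: real" and ?a = "real ((n - 1) choose (k - 1))"
  let ?Q = "(n choose k) * ((n - k) choose k)"
  have "star_orders x - pinned C x \<subseteq> (\<Union>i\<in>{1 - int k..0}. {\<sigma> \<in> star_orders x. arc_in W \<sigma> i}) \<union> bad C"
  proof
    fix \<sigma> assume \<sigma>: "\<sigma> \<in> star_orders x - pinned C x"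
    hence s: "\<sigma> \<in> orders" "\<sigma> 1 = x" "\<sigma> permutes {1..n}" by (auto simp: star_orders_def orders_def)
    show "\<sigma> \<in> (\<Union>i\<in>{1 - int k..0}. {\<sigma> \<in> star_orders x. arc_in W \<sigma> i}) \<union> bad C"
    proof (cases "\<sigma> \<in> bad C")
      case False
      then obtain i where i: "1 - int k \<le> i" "i \<le> 0" "\<not> arc_in C \<sigma> i"
        using pinnedI[OF s(1) False _ s(2)] \<sigma> by blast
      have "1 \<in> block i" using one_in_block[of i] i kn by simp
      hence "x \<in> \<sigma> ` block i" using s(2) by auto
      moreover have "\<sigma> ` block i \<in> nsets {1..n} k"
        using s(3) block_subset[of i] permutes_in_image[OF s(3)] permutes_inj[OF s(3)]
        by (auto simp: nsets_def card_image inj_on_subset)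
      ultimately have "\<sigma> ` block i \<in> W" using W(3) i(3) by (auto simp: arc_in_def)
      thus ?thesis using i \<sigma> by (auto simp: arc_in_def)
    qed simp
  qed
  hence "card (star_orders x - pinned C x) \<le> card ((\<Union>i\<in>{1 - int k..0}. {\<sigma> \<in> star_orders x. arc_in W \<sigma> i}) \<union> bad C)"
    by (intro card_mono) auto
  also have "\<dots> \<le> card (\<Union>i\<in>{1 - int k..0}. {\<sigma> \<in> star_orders x. arc_in W \<sigma> i}) + card (bad C)"
    by (rule card_Un_le)
  also have "card (\<Union>i\<in>{1 - int k..0}. {\<sigma> \<in> star_orders x. arc_in W \<sigma> i}) \<le>
    (\<Sum>i\<in>{1 - int k..0}. card {\<sigma> \<in> star_orders x. arc_in W \<sigma> i})" by (intro card_UN_le) auto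
  finally have "real (card (star_orders x - pinned C x)) \<le>
     real ((\<Sum>i\<in>{1 - int k..0}. card {\<sigma> \<in> star_orders x. arc_in W \<sigma> i}) + card (bad C))"
    by (simp only: of_nat_le_iff)
  also have "\<dots> = (\<Sum>i\<in>{1 - int k..0}. ?M * (real (card W) / ?a)) + card (bad C)"
  proof -
    have "real (card {\<sigma> \<in> star_orders x. arc_in W \<sigma> i}) = ?M * (real (card W) / ?a)"
      if "i \<in> {1 - int k..0}" for i
      using star_ratio[OF W(1,2) x, of i] that by (simp add: field_simps)
    thus ?thesis by simp
  qed
  finally have 1: "real (card (star_orders x - pinned C x)) \<le> real k * (?M * (real (card W) / ?a)) + card (bad C)"
    by simp
  have "real (card (bad C) * ?Q) \<le> real (n ^ 2 * card (disjoint_pairs C) * fact n)"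
    using bad_card[OF C] by (simp only: of_nat_le_iff)
  hence "card (bad C) \<le> real n ^ 2 * card (disjoint_pairs C) * fact n / (real (n choose k) * real ((n - k) choose k))"
    using choose_pos by (simp add: field_simps)
  also have "\<dots> = ?M * (real n ^ 3 * real (card (disjoint_pairs C)) / (real (n choose k) * real ((n - k) choose k)))"
    unfolding fact_split by (simp add: power2_eq_square power3_eq_cube)
  finally have 2: "real (card (star_orders x - pinned C x)) \<le>
    ?M * (real k * real (card W) / ?a + real n ^ 3 * real (card (disjoint_pairs C)) / (real (n choose k) * real ((n - k) choose k)))"
    using 1 by (simp add: algebra_simps)
  have le: "card (pinned C x) \<le> fact (n - 1)"
    using card_mono[OF finite_star_orders pinned_star] card_star_orders[OF x] by metis
  have "real (card (star_orders x - pinned C x)) = ?M * (1 - pin_ratio C x)"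
    using pinned_star card_star_orders[OF x] le
    by (simp add: card_Diff_subset of_nat_diff pin_ratio_def field_simps)
  thus ?thesis using 2 by simp
qed

end

section \<open>Fingerprints and stars\<close>

text \<open>Among the \<open>P\<close> that see at least t elements of \<open>Y\<close> per member,
  take one of maximum size: any v with t or more new neighbours could be added. Since t > 0, such a
  v lies outside \<open>P\<close>, whose members see nothing new.\<close>

lemma fingerprint:
  fixes nb :: "'a \<Rightarrow> 'b set" and t :: real
  assumes A: "finite A" and Y: "finite Y" and t: "t > 0"
  shows "\<exists>P\<subseteq>A. t * real (card P) \<le> real (card (Y \<inter> \<Union>(nb ` P))) \<and>
    (\<forall>v\<in>A. real (card (Y \<inter> nb v - \<Union>(nb ` P))) < t)"
proof -
  let ?S = "{P. P \<subseteq> A \<and> t * real (card P) \<le> real (card (Y \<inter> \<Union>(nb ` P)))}"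
  have "finite ?S" using A by simp
  hence fin: "finite (card ` ?S)" by (rule finite_imageI)
  have "{} \<in> ?S" by simp
  hence "Max (card ` ?S) \<in> card ` ?S" using Max_in[OF fin] by blast
  then obtain P where P: "P \<in> ?S" "card P = Max (card ` ?S)" by (metis (lifting) imageE)
  have max: "card Q \<le> card P" if "Q \<in> ?S" for Q
    unfolding P(2) by (rule Max_ge[OF fin imageI[OF that]])
  have "real (card (Y \<inter> nb v - \<Union>(nb ` P))) < t" if v: "v \<in> A" for v
  proof (rule ccontr)
    assume "\<not> ?thesis"
    hence ge: "t \<le> real (card (Y \<inter> nb v - \<Union>(nb ` P)))" by simp
    have "v \<notin> P"
    proof
      assume "v \<in> P"
      hence "card (Y \<inter> nb v - \<Union>(nb ` P)) = card ({} :: 'b set)" by (intro arg_cong[of _ _ card]) auto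
      thus False using ge t by (simp only: card.empty of_nat_0)
    qed
    have fP: "finite P" using P(1) finite_subset[OF _ A] by blast
    have "Y \<inter> \<Union>(nb ` insert v P) = (Y \<inter> \<Union>(nb ` P)) \<union> (Y \<inter> nb v - \<Union>(nb ` P))" by auto
    hence "card (Y \<inter> \<Union>(nb ` insert v P)) = card (Y \<inter> \<Union>(nb ` P)) + card (Y \<inter> nb v - \<Union>(nb ` P))"
      using Y by (simp only:) (rule card_Un_disjoint, auto)
    hence "insert v P \<in> ?S" using P(1) v ge \<open>v \<notin> P\<close> fP by (auto simp: algebra_simps)
    hence "card (insert v P) \<le> card P" by (rule max)
    thus False using \<open>v \<notin> P\<close> fP by simp
  qed
  thus ?thesis using P(1) by blast
qed

lemma card_small_subsets:
  assumes "finite U"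
  shows "card {A. A \<subseteq> U \<and> card A \<le> m} \<le> (card U + 1) ^ m"
proof (induction m)
  case 0
  have "{A. A \<subseteq> U \<and> card A \<le> 0} \<subseteq> {{}}"
  proof
    fix A assume "A \<in> {A. A \<subseteq> U \<and> card A \<le> 0}"
    moreover from this have "finite A" using finite_subset[OF _ assms] by blast
    ultimately show "A \<in> {{}}" by simp
  qed
  from card_mono[OF _ this] show ?case by simp
next
  case (Suc m)
  \<comment> \<open>A set of size at most m + 1 is a set of size at most m with at most one element
    inserted; \<open>None\<close> stands for no insertion.\<close>
  define g :: "'a set \<times> 'a option \<Rightarrow> 'a set"
    where "g = (\<lambda>(A, u). case u of None \<Rightarrow> A | Some v \<Rightarrow> insert v A)"
  let ?S = "\<lambda>m. {A. A \<subseteq> U \<and> card A \<le> m}"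
  have fin: "finite (?S m)" for m using assms by simp
  have "?S (Suc m) \<subseteq> g ` (?S m \<times> (insert None (Some ` U)))"
  proof
    fix A assume A: "A \<in> ?S (Suc m)"
    hence fA: "finite A" using assms finite_subset by auto
    show "A \<in> g ` (?S m \<times> (insert None (Some ` U)))"
    proof (cases "card A \<le> m")
      case True
      hence "A = g (A, None)" "(A, None) \<in> ?S m \<times> (insert None (Some ` U))" using A by (auto simp: g_def)
      thus ?thesis by blast
    next
      case False
      hence "A \<noteq> {}" by auto
      then obtain v where v: "v \<in> A" by blast
      have "A = g (A - {v}, Some v)" using v by (auto simp: g_def)
      moreover have "(A - {v}, Some v) \<in> ?S m \<times> (insert None (Some ` U))" using A v fA by auto
      ultimately show ?thesis by blast
    qed
  qed
  hence "card (?S (Suc m)) \<le> card (?S m \<times> (insert None (Some ` U)))"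
    using assms fin by (intro surj_card_le) auto
  also have "\<dots> = card (?S m) * (card U + 1)"
    using assms by (simp add: card_cartesian_product card_image card_insert_if)
  also have "\<dots> \<le> (card U + 1) ^ m * (card U + 1)" using Suc by (intro mult_right_mono) auto
  finally show ?case by (simp add: mult.commute)
qed

lemma card_small_subsets_powr:
  assumes "finite U" "card U < 2 ^ n" "0 \<le> r"
  shows "real (card {A. A \<subseteq> U \<and> real (card A) \<le> r}) \<le> 2 powr (real n * r)"
proof -
  define m where "m = nat \<lfloor>r\<rfloor>"
  have "real (card A) \<le> r \<longleftrightarrow> card A \<le> m" for A :: "'a set"
    unfolding m_def using le_nat_floor of_nat_floor[OF assms(3)] by (meson of_nat_mono order_trans)
  hence "{A. A \<subseteq> U \<and> real (card A) \<le> r} = {A. A \<subseteq> U \<and> card A \<le> m}" by simp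
  hence "real (card {A. A \<subseteq> U \<and> real (card A) \<le> r}) \<le> real ((card U + 1) ^ m)"
    using card_small_subsets[OF assms(1), of m] by (simp only: of_nat_le_iff)
  also have "\<dots> \<le> real ((2 ^ n) ^ m)" unfolding of_nat_le_iff using assms(2) by (intro power_mono) auto
  also have "\<dots> = 2 powr (real n * real m)" by (simp add: power_mult[symmetric] powr_realpow[symmetric])
  also have "\<dots> \<le> 2 powr (real n * r)"
    using assms(3) by (intro powr_mono mult_left_mono) (auto simp: m_def)
  finally show ?thesis .
qed

lemma card_UN_le_bound:
  fixes b :: real
  assumes "finite I" "\<And>i. i \<in> I \<Longrightarrow> real (card (A i)) \<le> b"
  shows "real (card (\<Union>i\<in>I. A i)) \<le> real (card I) * b"
proof -
  have "real (card (\<Union>i\<in>I. A i)) \<le> real (\<Sum>i\<in>I. card (A i))"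
    unfolding of_nat_le_iff by (rule card_UN_le[OF assms(1)])
  also have "\<dots> \<le> (\<Sum>i\<in>I. b)" unfolding of_nat_sum by (intro sum_mono assms)
  finally show ?thesis by simp
qed

lemma card_Sigma_le_bound:
  fixes b :: real and c :: nat
  assumes "finite E" "E \<subseteq> (SIGMA x:X. Y x)" "finite X" "\<And>x. x \<in> X \<Longrightarrow> finite (Y x)"
    and "\<And>x. x \<in> X \<Longrightarrow> real (card (Y x)) \<le> b"
  shows "real (card E) \<le> real (card X) * b"
proof -
  have "real (card E) \<le> real (card (SIGMA x:X. Y x))"
    unfolding of_nat_le_iff using assms by (intro card_mono) auto
  also have "\<dots> = (\<Sum>x\<in>X. real (card (Y x)))" using assms by simp
  also have "\<dots> \<le> (\<Sum>x\<in>X. b)" by (intro sum_mono assms)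
  finally show ?thesis by simp
qed

context cyclic_orders
begin

section \<open>The Kneser graph on the k-sets\<close>

definition ksets :: "nat set set" where
  "ksets = nsets {1..n} k"

definition star :: "nat \<Rightarrow> nat set set" where
  "star x = {S \<in> ksets. x \<in> S}"

text \<open>The neighbourhood of S in the Kneser graph. Intersecting families are its independent
  sets.\<close>

definition nb :: "nat set \<Rightarrow> nat set set" where
  "nb S = {T \<in> ksets. S \<inter> T = {}}"

lemma finite_ksets [simp]: "finite ksets"
  by (simp add: ksets_def finite_imp_finite_nsets)

lemma nb_subset: "nb S \<subseteq> ksets" and star_subset: "star x \<subseteq> ksets"
  by (auto simp: nb_def star_def)

lemma finite_nb [simp]: "finite (nb S)" and finite_star [simp]: "finite (star x)"
  by (rule finite_subset[OF nb_subset finite_ksets], rule finite_subset[OF star_subset finite_ksets])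

lemma card_ksets: "card ksets = n choose k"
  by (simp add: ksets_def)

lemma ksetsD: "S \<subseteq> {1..n}" "card S = k" "finite S" if "S \<in> ksets"
  using that by (simp_all add: ksets_def nsets_def)

lemma ksetsI: "S \<in> ksets" if "S \<subseteq> {1..n}" "card S = k"
  using that finite_subset[OF that(1)] by (simp add: ksets_def nsets_def)

text \<open>Strictness matters: with 1 added the number of k-sets is still at most 2^n, so listing a
  fingerprint costs at most n bits per member.\<close>

lemma card_ksets_less: "card ksets < 2 ^ n"
proof -
  have "{} \<notin> ksets" using ksetsD(2)[of "{}"] k_pos by auto
  moreover have "ksets \<subseteq> Pow {1..n}" using ksetsD(1) by blast
  moreover have "{} \<in> Pow {1..n}" by simp
  ultimately have "ksets \<subset> Pow {1..n}" by blast
  hence "card ksets < card (Pow {1..n})" by (rule psubset_card_mono[rotated]) simp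
  thus ?thesis by (simp add: card_Pow)
qed

lemma card_nb: "card (nb S) = (n - k) choose k" if "S \<in> ksets"
proof -
  have "nb S = {T. T \<subseteq> {1..n} - S \<and> card T = k}"
    unfolding nb_def using ksetsI ksetsD by blast
  thus ?thesis using ksetsD[OF that] by (simp add: n_subsets card_Diff_subset)
qed

lemma card_subsets_containing:
  assumes "finite U" "x \<in> U" "m > 0"
  shows "card {S. S \<subseteq> U \<and> card S = m \<and> x \<in> S} = (card U - 1) choose (m - 1)"
proof -
  have eq: "{S. S \<subseteq> U \<and> card S = m \<and> x \<in> S} = insert x ` {T. T \<subseteq> U - {x} \<and> card T = m - 1}"
  proof (intro equalityI subsetI)
    fix S assume S: "S \<in> {S. S \<subseteq> U \<and> card S = m \<and> x \<in> S}"
    moreover from this have "finite S" using finite_subset[OF _ assms(1)] by blast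
    ultimately have "S = insert x (S - {x})" "S - {x} \<in> {T. T \<subseteq> U - {x} \<and> card T = m - 1}"
      by auto
    thus "S \<in> insert x ` {T. T \<subseteq> U - {x} \<and> card T = m - 1}" by blast
  next
    fix S assume "S \<in> insert x ` {T. T \<subseteq> U - {x} \<and> card T = m - 1}"
    then obtain T where T: "S = insert x T" "T \<subseteq> U - {x}" "card T = m - 1" by blast
    moreover from this have "finite T" using finite_subset[of T U] assms(1) by blast
    moreover have "x \<notin> T" using T by blast
    ultimately show "S \<in> {S. S \<subseteq> U \<and> card S = m \<and> x \<in> S}" using assms by auto
  qed
  have "inj_on (insert x) {T. T \<subseteq> U - {x} \<and> card T = m - 1}"
    by (rule inj_onI) (auto simp: insert_ident)
  thus ?thesis unfolding eq using assms by (simp add: card_image n_subsets)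
qed

lemma card_star: "card (star x) = (n - 1) choose (k - 1)" if "x \<in> {1..n}"
proof -
  have "star x = {S. S \<subseteq> {1..n} \<and> card S = k \<and> x \<in> S}"
    unfolding star_def using ksetsI ksetsD by blast
  thus ?thesis using card_subsets_containing[of "{1..n}" x k] that k_pos by simp
qed

lemma card_nb_star: "card (nb S \<inter> star x) = (n - k - 1) choose (k - 1)"
  if "S \<in> ksets" "x \<in> {1..n}" "x \<notin> S"
proof -
  have "nb S \<inter> star x = {T. T \<subseteq> {1..n} - S \<and> card T = k \<and> x \<in> T}"
  proof (rule set_eqI)
    fix T
    have "T \<in> ksets \<longleftrightarrow> T \<subseteq> {1..n} \<and> card T = k" using ksetsI ksetsD by blast
    thus "T \<in> nb S \<inter> star x \<longleftrightarrow> T \<in> {T. T \<subseteq> {1..n} - S \<and> card T = k \<and> x \<in> T}"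
      unfolding nb_def star_def by auto
  qed
  thus ?thesis using card_subsets_containing[of "{1..n} - S" x k] that k_pos ksetsD[OF that(1)]
    by (simp add: card_Diff_subset)
qed

lemma nb_star_choose: "k * ((n - k) choose k) = (n - k) * ((n - k - 1) choose (k - 1))"
  using binomial_absorption[of "k - 1" "n - k"] k_pos by simp

lemma nonstar_choose: "k * ((n - 1) choose k) = (n - k) * ((n - 1) choose (k - 1))"
proof -
  have "k * ((n - 1) choose k) = (n - 1) * ((n - 1 - 1) choose (k - 1))"
    using binomial_absorption[of "k - 1" "n - 1"] k_pos by simp
  moreover have "(n - 1 - (k - 1)) * ((n - 1) choose (k - 1)) = (n - 1) * ((n - 1 - 1) choose (k - 1))"
    using binomial_absorb_comp[of "n - 1" "k - 1"] by simp
  moreover have "n - 1 - (k - 1) = n - k" using k_pos by simp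
  ultimately show ?thesis by simp
qed

end

section \<open>Containers for families far from every star\<close>

locale large_degree = cyclic_orders +
  assumes degree: "real n ^ 20 \<le> real ((n - k) choose k)" and n_large: "2 ^ 14 \<le> n"
begin

definition degr :: real where "degr = real ((n - k) choose k)"
definition tot :: real where "tot = real (n choose k)"
definition sz :: real where "sz = real ((n - 1) choose (k - 1))"
text \<open>The fingerprint threshold. The power n^9 makes the pair term of
  \<open>shortfall\<close>, about 2 n^3 thr / degr, equal to 2 / (128 n^6), small enough for the
  isoperimetric losses. With degr at least n^20 the threshold still exceeds n^10, which keeps
  fingerprints short.\<close>

definition thr :: real where "thr = degr / (128 * real n ^ 9)"

lemma n_ge: "real n \<ge> 16384"
  using n_large by simp

lemma n_real_pos: "real n > 0"
  using n_ge by simp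

lemma n_power_mono: "i \<le> j \<Longrightarrow> real n ^ i \<le> real n ^ j"
  using n_ge by (intro power_increasing) auto

lemma pos_params: "degr > 0" "tot > 0" "sz > 0" "thr > 0"
  using choose_pos n_ge by (simp_all add: degr_def tot_def sz_def thr_def)

lemma tot_sz: "real k * tot = real n * sz"
  unfolding tot_def sz_def using star_choose by (simp only: of_nat_mult[symmetric])

lemma k_half: "2 * real k \<le> real n"
  using kn by linarith

lemma tot_le: "tot \<le> real n * sz"
proof -
  have "1 * tot \<le> real k * tot" using k_pos pos_params by (intro mult_right_mono) auto
  thus ?thesis using tot_sz by simp
qed

lemma tot_ge: "2 * sz \<le> tot"
proof -
  have "real k * (2 * sz) \<le> real k * tot" unfolding tot_sz using k_half pos_params by simp
  thus ?thesis using k_pos by simp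
qed

lemma n_le_power: "0 < i \<Longrightarrow> real n \<le> real n ^ i"
  using n_ge by (intro self_le_power) auto

lemma degr_ge: "real n ^ 20 \<le> degr"
  using degree by (simp add: degr_def)

lemma degr_le_tot: "degr \<le> tot"
  unfolding degr_def tot_def of_nat_le_iff by (rule binomial_right_mono) simp

lemma sz_ge: "real n ^ 19 \<le> sz"
proof -
  have "real n * real n ^ 19 \<le> real n * sz"
    using degr_ge degr_le_tot tot_le by (simp add: power_Suc[symmetric] del: power_Suc)
  thus ?thesis using n_real_pos by simp
qed

lemma thr_ge: "real n ^ 11 / 128 \<le> thr"
proof -
  have "real n ^ 11 / 128 = real n ^ 20 / (128 * real n ^ 9)"
    using n_real_pos by (simp add: field_simps power_add[symmetric])
  also have "\<dots> \<le> thr" unfolding thr_def using degr_ge by (intro divide_right_mono) auto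
  finally show ?thesis .
qed

lemma thr_degr: "thr / degr = 1 / (128 * real n ^ 9)"
  using pos_params by (simp add: thr_def)

lemma shortfall_eq: "shortfall C = real n / tot * (sz - real (card C))
    + (real n + 1) * real n ^ 2 * real (card (disjoint_pairs C)) / (tot * degr)"
  by (simp add: shortfall_def tot_def sz_def degr_def)

lemma card_ksets_tot: "real (card ksets) = tot"
  by (simp add: card_ksets tot_def)

text \<open>The container determined by a fingerprint \<open>P\<close>. An intersecting family with
  fingerprint \<open>P\<close> avoids all neighbours of \<open>P\<close>, and by maximality its
  members have few other neighbours.\<close>

definition cont :: "nat set set \<Rightarrow> nat set set" where
  "cont P = {S \<in> ksets - \<Union>(nb ` P). real (card (nb S - \<Union>(nb ` P))) < thr}"

lemma cont_subset: "cont P \<subseteq> ksets"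
  by (auto simp: cont_def)

lemma finite_cont [simp]: "finite (cont P)"
  using cont_subset finite_ksets by (rule finite_subset)

lemma finite_disjoint_pairs: "finite (disjoint_pairs C)" if "finite C"
  by (rule finite_subset[of _ "C \<times> C"]) (use that in \<open>auto simp: disjoint_pairs_def\<close>)

text \<open>The container avoids the neighbours of \<open>P\<close>, so within it each member has
  fewer than \<open>thr\<close> neighbours.\<close>

lemma cont_pairs: "real (card (disjoint_pairs (cont P))) \<le> tot * thr"
proof -
  have "real (card (disjoint_pairs (cont P))) \<le> real (card (cont P)) * thr"
  proof (rule card_Sigma_le_bound)
    show "disjoint_pairs (cont P) \<subseteq> (SIGMA S:cont P. nb S - \<Union>(nb ` P))"
      unfolding disjoint_pairs_def cont_def nb_def by blast
    show "finite (disjoint_pairs (cont P))" by (simp add: finite_disjoint_pairs)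
  qed (auto simp: cont_def)
  also have "\<dots> \<le> tot * thr"
    unfolding card_ksets_tot[symmetric] using pos_params
    by (intro mult_right_mono) (auto intro!: card_mono cont_subset)
  finally show ?thesis .
qed

text \<open>The missing size contributes at most 1 / (128 n^6), using k \<le> n / 2, and the
  disjoint pairs at most 2 / (128 n^6).\<close>

lemma cont_shortfall:
  assumes "real (card (cont P)) > sz - sz / (64 * real n ^ 7)"
  shows "shortfall (cont P) \<le> 1 / (32 * real n ^ 6)"
proof -
  let ?n = "real n"
  have "?n / tot * (sz - real (card (cont P))) \<le> ?n / tot * (sz / (64 * ?n ^ 7))"
    using assms pos_params by (intro mult_left_mono) auto
  also have "\<dots> = (?n * sz / tot) / (64 * ?n ^ 7)" by simp
  also have "?n * sz / tot = real k" using pos_params tot_sz by (simp add: field_simps)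
  also have "real k / (64 * ?n ^ 7) \<le> (?n / 2) / (64 * ?n ^ 7)" using k_half by (intro divide_right_mono) auto
  also have "\<dots> = 1 / (128 * ?n ^ 6)" using n_real_pos by (simp add: field_simps power_Suc[symmetric] del: power_Suc)
  finally have 1: "?n / tot * (sz - real (card (cont P))) \<le> 1 / (128 * ?n ^ 6)" .
  have "(?n + 1) * ?n ^ 2 * real (card (disjoint_pairs (cont P))) / (tot * degr)
      \<le> (2 * ?n) * ?n ^ 2 * (tot * thr) / (tot * degr)"
    using n_ge pos_params cont_pairs by (intro divide_right_mono mult_mono) auto
  also have "\<dots> = 2 * ?n ^ 3 * (thr / degr)" using pos_params by (simp add: power2_eq_square power3_eq_cube)
  also have "\<dots> = 2 / (128 * ?n ^ 6)"
    unfolding thr_degr using n_real_pos by (simp add: field_simps power_add[symmetric])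
  finally have "shortfall (cont P) \<le> 1 / (128 * ?n ^ 6) + 2 / (128 * ?n ^ 6)"
    unfolding shortfall_eq using 1 by linarith
  also have "\<dots> = 3 / (128 * ?n ^ 6)" by (simp add: add_divide_distrib[symmetric])
  also have "\<dots> \<le> 1 / (32 * ?n ^ 6)" using n_real_pos by (simp add: field_simps)
  finally show ?thesis .
qed

text \<open>Stability: the small shortfall yields a point x whose unpinned proportion is at most 1 /
  (8 n^3). \<open>excess_ratio\<close> bounds the members avoiding x by this proportion of (n-1
  choose k), which is at most n sz.\<close>

lemma cont_near:
  assumes "real (card (cont P)) > sz - sz / (64 * real n ^ 7)"
  shows "\<exists>x\<in>{1..n}. real (card {S \<in> cont P. x \<notin> S}) \<le> sz / (8 * real n ^ 2)"
proof -
  let ?n = "real n"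
  have s: "shortfall (cont P) \<le> 1 / (32 * ?n ^ 6)" by (rule cont_shortfall[OF assms])
  also have "\<dots> \<le> 1 / (16 * ?n ^ 4)"
  proof (rule divide_left_mono)
    have "?n ^ 4 \<le> ?n ^ 6" "0 \<le> ?n ^ 6" using n_power_mono[of 4 6] by simp_all
    thus "16 * ?n ^ 4 \<le> 32 * ?n ^ 6" by linarith
  qed (use n_real_pos in auto)
  finally obtain x where x: "x \<in> {1..n}" "pin_ratio (cont P) x \<ge> 1 / 2"
    using ex_pinned[of "cont P"] cont_subset[of P] by (auto simp: ksets_def)
  have C: "cont P \<subseteq> nsets {1..n} k" using cont_subset by (simp add: ksets_def)
  let ?b = "real ((n - 1) choose k)"
  have b: "?b > 0" using choose_pos(4) by simp
  have "real (card {S \<in> cont P. x \<notin> S}) / ?b \<le> 4 * ?n ^ 3 * shortfall (cont P)"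
    using excess_ratio[OF C x(1)] defect_ratio[OF C x] by linarith
  also have "\<dots> \<le> 4 * ?n ^ 3 * (1 / (32 * ?n ^ 6))" using s by (intro mult_left_mono) auto
  also have "\<dots> = 1 / (8 * ?n ^ 3)" using n_real_pos by (simp add: field_simps power_add[symmetric])
  finally have "real (card {S \<in> cont P. x \<notin> S}) \<le> ?b / (8 * ?n ^ 3)" using b by (simp add: field_simps)
  also have "?b \<le> ?n * sz"
  proof -
    have "real (k * ((n - 1) choose k)) = real ((n - k) * ((n - 1) choose (k - 1)))"
      using nonstar_choose by simp
    hence "real k * ?b = real (n - k) * sz" by (simp add: sz_def)
    moreover have "1 * ?b \<le> real k * ?b" using k_pos by (intro mult_right_mono) auto
    moreover have "real (n - k) * sz \<le> ?n * sz" using pos_params by (intro mult_right_mono) auto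
    ultimately show ?thesis by linarith
  qed
  hence "?b / (8 * ?n ^ 3) \<le> (?n * sz) / (8 * ?n ^ 3)" by (intro divide_right_mono) auto
  also have "\<dots> = sz / (8 * ?n ^ 2)" using n_real_pos by (simp add: field_simps power2_eq_square power3_eq_cube)
  finally show ?thesis using x(1) by blast
qed

lemma card_Pow_powr: "real (card (Pow A)) \<le> 2 powr b" if "finite A" "real (card A) \<le> b"
  using that by (simp add: card_Pow powr_realpow[symmetric])

lemma card_ksets_subsets: "real (card {P. P \<subseteq> ksets \<and> real (card P) \<le> r}) \<le> 2 powr (real n * r)" if "0 \<le> r"
  using that by (rule card_small_subsets_powr[OF finite_ksets card_ksets_less])

definition away :: "nat set set \<Rightarrow> nat \<Rightarrow> nat set set" where
  "away F x = {S \<in> F. x \<notin> S}"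

text \<open>A large container lies close to some star by \<open>cont_near\<close>, and so would
  every family inside it. Far families therefore use only containers of size at most sz - sz / (64
  n^7).\<close>

lemma far_count:
  "real (card {F. F \<subseteq> ksets \<and> intersecting F \<and> (\<forall>x\<in>{1..n}. real (card (away F x)) > sz / (8 * real n ^ 2))})
    \<le> 2 powr (sz - real n)" (is "real (card ?Far) \<le> _")
proof -
  let ?n = "real n"
  let ?Ps = "{P. P \<subseteq> ksets \<and> real (card P) \<le> tot / thr}"
  let ?s = "sz - sz / (64 * ?n ^ 7)"
  define I where "I = {P \<in> ?Ps. real (card (cont P)) \<le> ?s}"
  have fI: "finite I" unfolding I_def by (rule finite_subset[of _ "Pow ksets"]) auto
  have "?Far \<subseteq> (\<Union>P\<in>I. Pow (cont P))"
  proof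
    fix F assume "F \<in> ?Far"
    hence F: "F \<subseteq> ksets" "intersecting F" "\<And>x. x \<in> {1..n} \<Longrightarrow> real (card (away F x)) > sz / (8 * ?n ^ 2)"
      by auto
    have fF: "finite F" using F(1) finite_ksets by (rule finite_subset)
    obtain P where P: "P \<subseteq> F" "thr * real (card P) \<le> real (card (ksets \<inter> \<Union>(nb ` P)))"
      "\<And>v. v \<in> F \<Longrightarrow> real (card (ksets \<inter> nb v - \<Union>(nb ` P))) < thr"
      using fingerprint[OF fF finite_ksets pos_params(4), of nb] by blast
    have "real (card (ksets \<inter> \<Union>(nb ` P))) \<le> tot"
      unfolding card_ksets_tot[symmetric] of_nat_le_iff by (rule card_mono) auto
    hence "real (card P) \<le> tot / thr" using P(2) pos_params by (simp add: field_simps)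
    hence Ps: "P \<in> ?Ps" using P(1) F(1) by blast
    have Fc: "F \<subseteq> cont P"
    proof
      fix v assume v: "v \<in> F"
      have "v \<notin> \<Union>(nb ` P)" using F(2) P(1) v unfolding intersecting_def nb_def by blast
      moreover have "ksets \<inter> nb v = nb v" using nb_subset by blast
      ultimately show "v \<in> cont P" using P(3)[OF v] F(1) v unfolding cont_def by auto
    qed
    have "real (card (cont P)) \<le> ?s"
    proof (rule ccontr)
      assume "\<not> ?thesis"
      hence "real (card (cont P)) > sz - sz / (64 * ?n ^ 7)" by simp
      then obtain x where x: "x \<in> {1..n}" "real (card {S \<in> cont P. x \<notin> S}) \<le> sz / (8 * ?n ^ 2)"
        using cont_near by blast
      have "card (away F x) \<le> card {S \<in> cont P. x \<notin> S}"
        using Fc by (intro card_mono) (auto simp: away_def)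
      thus False using F(3)[OF x(1)] x(2) by linarith
    qed
    thus "F \<in> (\<Union>P\<in>I. Pow (cont P))" using Ps Fc unfolding I_def by blast
  qed
  hence "real (card ?Far) \<le> real (card (\<Union>P\<in>I. Pow (cont P)))"
    unfolding of_nat_le_iff using fI by (intro card_mono) auto
  also have "\<dots> \<le> real (card I) * 2 powr ?s"
    by (intro card_UN_le_bound fI card_Pow_powr) (auto simp: I_def)
  also have "real (card I) \<le> 2 powr (?n * (tot / thr))"
  proof -
    have "real (card I) \<le> real (card ?Ps)"
      unfolding of_nat_le_iff by (intro card_mono) (auto simp: I_def)
    also have "\<dots> \<le> 2 powr (?n * (tot / thr))" using pos_params by (intro card_ksets_subsets) auto
    finally show ?thesis .
  qed
  finally have "real (card ?Far) \<le> 2 powr (?n * (tot / thr)) * 2 powr ?s" by simp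
  also have "\<dots> = 2 powr (?n * (tot / thr) + ?s)" by (simp add: powr_add)
  also have "\<dots> \<le> 2 powr (sz - ?n)"
  proof (rule powr_mono)
    \<comment> \<open>Half of the saving sz / (64 n^7) pays for the fingerprints; the other half is
      at least n because sz \<ge> n^19.\<close>
    have "?n * (tot / thr) \<le> ?n * ((?n * sz) / (?n ^ 11 / 128))"
      using tot_le thr_ge pos_params n_real_pos by (intro mult_left_mono frac_le) auto
    also have "\<dots> = sz * 128 / ?n ^ 9"
      using n_real_pos by (simp add: field_simps power_add[symmetric] power_Suc[symmetric] del: power_Suc)
    also have "\<dots> \<le> sz / (128 * ?n ^ 7)"
    proof -
      have "?n ^ 2 \<ge> 16384 ^ 2" using n_ge by (intro power_mono) auto
      hence "sz * 16384 * ?n ^ 7 \<le> sz * ?n ^ 2 * ?n ^ 7" using pos_params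
        by (intro mult_right_mono mult_left_mono) auto
      thus ?thesis using n_real_pos by (simp add: field_simps power_add[symmetric])
    qed
    finally have 1: "?n * (tot / thr) \<le> sz / (128 * ?n ^ 7)" .
    have "?n * (128 * ?n ^ 7) \<le> ?n ^ 11 * ?n ^ 8"
    proof -
      have "128 \<le> ?n ^ 11" using n_le_power[of 11] n_ge by linarith
      hence "128 * ?n ^ 8 \<le> ?n ^ 11 * ?n ^ 8" by (rule mult_right_mono) simp
      moreover have "?n * (128 * ?n ^ 7) = 128 * ?n ^ 8" by (simp add: eval_nat_numeral)
      ultimately show ?thesis by simp
    qed
    also have "\<dots> = ?n ^ 19" by (simp add: power_add[symmetric])
    also have "\<dots> \<le> sz" by (rule sz_ge)
    finally have "?n \<le> sz / (128 * ?n ^ 7)" using n_real_pos by (simp add: pos_le_divide_eq)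
    moreover have "sz / (64 * ?n ^ 7) = sz / (128 * ?n ^ 7) + sz / (128 * ?n ^ 7)" by simp
    ultimately show "?n * (tot / thr) + ?s \<le> sz - ?n" using 1 by linarith
  qed simp
  finally show ?thesis .
qed

text \<open>Here the off-star part needs no fingerprint. Listing it completely costs at most sz / (8
  n) bits, while it blocks at least sz / (4 n) members of the star.\<close>

lemma near_heavy_count:
  assumes x: "x \<in> {1..n}"
  shows "real (card {F. F \<subseteq> ksets \<and> intersecting F \<and> real (card (away F x)) \<le> sz / (8 * real n ^ 2) \<and>
      sz / (4 * real n) \<le> real (card (star x \<inter> \<Union>(nb ` away F x)))}) \<le> 2 powr (sz - real n)"
    (is "real (card ?H) \<le> _")
proof -
  let ?n = "real n"
  let ?Ps = "{P. P \<subseteq> ksets \<and> real (card P) \<le> sz / (8 * ?n ^ 2)}"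
  let ?s = "sz - sz / (4 * ?n)"
  define I where "I = {A \<in> ?Ps. sz / (4 * ?n) \<le> real (card (star x \<inter> \<Union>(nb ` A)))}"
  have fI: "finite I" unfolding I_def by (rule finite_subset[of _ "Pow ksets"]) auto
  let ?f = "\<lambda>A. (\<lambda>B. A \<union> B) ` Pow (star x - \<Union>(nb ` A))"
  have "?H \<subseteq> (\<Union>A\<in>I. ?f A)"
  proof
    fix F assume "F \<in> ?H"
    hence F: "F \<subseteq> ksets" "intersecting F" "away F x \<in> I"
      unfolding I_def away_def by auto
    have "F = away F x \<union> (F - away F x)" by (auto simp: away_def)
    moreover have "F - away F x \<subseteq> star x - \<Union>(nb ` away F x)"
    proof
      fix S assume S: "S \<in> F - away F x"
      have "S \<notin> nb T" if "T \<in> away F x" for T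
        using F(2) S that unfolding intersecting_def nb_def away_def by blast
      thus "S \<in> star x - \<Union>(nb ` away F x)" using S F(1) unfolding star_def away_def by blast
    qed
    ultimately show "F \<in> (\<Union>A\<in>I. ?f A)" using F(3) by blast
  qed
  hence "real (card ?H) \<le> real (card (\<Union>A\<in>I. ?f A))"
    unfolding of_nat_le_iff using fI by (intro card_mono) auto
  also have "\<dots> \<le> real (card I) * 2 powr ?s"
  proof (intro card_UN_le_bound fI)
    fix A assume A: "A \<in> I"
    have "card (?f A) \<le> card (Pow (star x - \<Union>(nb ` A)))" by (intro card_image_le) simp
    hence "real (card (?f A)) \<le> real (card (Pow (star x - \<Union>(nb ` A))))" by simp
    also have "\<dots> \<le> 2 powr ?s"
    proof (rule card_Pow_powr)
      have "star x - \<Union>(nb ` A) = star x - (star x \<inter> \<Union>(nb ` A))" by blast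
      hence "card (star x - \<Union>(nb ` A)) = card (star x) - card (star x \<inter> \<Union>(nb ` A))"
        by (simp add: card_Diff_subset)
      moreover have "card (star x \<inter> \<Union>(nb ` A)) \<le> card (star x)" by (intro card_mono) auto
      ultimately show "real (card (star x - \<Union>(nb ` A))) \<le> ?s"
        using A card_star[OF x] by (simp add: I_def sz_def of_nat_diff)
    qed simp
    finally show "real (card (?f A)) \<le> 2 powr ?s" .
  qed
  also have "real (card I) \<le> 2 powr (?n * (sz / (8 * ?n ^ 2)))"
  proof -
    have "real (card I) \<le> real (card ?Ps)"
      unfolding of_nat_le_iff by (intro card_mono) (auto simp: I_def)
    also have "\<dots> \<le> 2 powr (?n * (sz / (8 * ?n ^ 2)))" using pos_params by (intro card_ksets_subsets) auto
    finally show ?thesis .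
  qed
  finally have "real (card ?H) \<le> 2 powr (?n * (sz / (8 * ?n ^ 2))) * 2 powr ?s" by simp
  also have "\<dots> = 2 powr (?n * (sz / (8 * ?n ^ 2)) + ?s)" by (simp add: powr_add)
  also have "\<dots> \<le> 2 powr (sz - ?n)"
  proof (rule powr_mono)
    have "?n * (sz / (8 * ?n ^ 2)) = sz / (8 * ?n)" using n_real_pos by (simp add: power2_eq_square)
    moreover have "?n * (8 * ?n) \<le> ?n ^ 17 * ?n ^ 2"
    proof -
      have "8 \<le> ?n ^ 17" using n_le_power[of 17] n_ge by linarith
      hence "8 * ?n ^ 2 \<le> ?n ^ 17 * ?n ^ 2" by (rule mult_right_mono) simp
      thus ?thesis by (simp add: power2_eq_square)
    qed
    hence "?n * (8 * ?n) \<le> sz" using sz_ge by (simp add: power_add[symmetric])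
    hence "?n \<le> sz / (8 * ?n)" using n_real_pos by (simp add: pos_le_divide_eq)
    moreover have "sz / (4 * ?n) = sz / (8 * ?n) + sz / (8 * ?n)" by simp
    ultimately show "?n * (sz / (8 * ?n ^ 2)) + ?s \<le> sz - ?n" by linarith
  qed simp
  finally show ?thesis .
qed

end

section \<open>Containers for families near a star\<close>

context large_degree
begin

text \<open>The first fingerprint \<open>P\<close> only makes \<open>side\<close> sparse towards the star; the second one, \<open>Q\<close>, is
  taken inside \<open>side\<close> and makes \<open>core\<close> sparse within itself.\<close>

definition miss :: "nat \<Rightarrow> nat set set \<Rightarrow> nat set set" where
  "miss x P = star x \<inter> \<Union>(nb ` P)"

definition side :: "nat \<Rightarrow> nat set set \<Rightarrow> nat set set" where
  "side x P = {S \<in> ksets. x \<notin> S \<and> real (card (star x \<inter> nb S - \<Union>(nb ` P))) < thr}"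

definition core :: "nat \<Rightarrow> nat set set \<Rightarrow> nat set set \<Rightarrow> nat set set" where
  "core x P Q = {S \<in> side x P - \<Union>(nb ` Q). real (card (side x P \<inter> nb S - \<Union>(nb ` Q))) < thr}"

definition near_cont :: "nat \<Rightarrow> nat set set \<Rightarrow> nat set set \<Rightarrow> nat set set" where
  "near_cont x P Q = core x P Q \<union> (star x - miss x P)"

lemma side_subset: "side x P \<subseteq> ksets" and core_subset: "core x P Q \<subseteq> side x P"
  and near_cont_subset: "near_cont x P Q \<subseteq> ksets" and miss_subset: "miss x P \<subseteq> star x"
  by (auto simp: side_def core_def near_cont_def miss_def star_def)

lemma finite_side [simp]: "finite (side x P)" and finite_miss [simp]: "finite (miss x P)"
  and finite_near_cont [simp]: "finite (near_cont x P Q)"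
  by (rule finite_subset[OF side_subset finite_ksets], rule finite_subset[OF miss_subset finite_star],
      rule finite_subset[OF near_cont_subset finite_ksets])

lemma finite_core [simp]: "finite (core x P Q)"
  by (rule finite_subset[OF core_subset finite_side])

text \<open>A k-set off the star sends the fraction k / (n - k) of its Kneser degree into the star.
  The bound by 2 \<open>thr\<close> later ensures that at least half of these neighbours are blocked
  by the first fingerprint.\<close>

lemma star_degree:
  assumes "S \<in> ksets" "x \<in> {1..n}" "x \<notin> S"
  shows "degr \<le> real n * real (card (star x \<inter> nb S))"
    and "2 * thr \<le> real (card (star x \<inter> nb S))"
proof -
  let ?d = "real (card (star x \<inter> nb S))"
  have "real k * degr = real (n - k) * ?d"
    unfolding degr_def using nb_star_choose card_nb_star[OF assms]
    by (simp add: Int_commute of_nat_mult[symmetric] del: of_nat_mult)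
  moreover have "1 * degr \<le> real k * degr" using k_pos pos_params by (intro mult_right_mono) auto
  moreover have "real (n - k) * ?d \<le> real n * ?d" by (intro mult_right_mono) auto
  ultimately show 1: "degr \<le> real n * ?d" by linarith
  have "2 * thr = 2 * degr / (128 * real n ^ 9)" by (simp add: thr_def)
  also have "\<dots> \<le> 2 * (real n * ?d) / (128 * real n ^ 9)" using 1 by (intro divide_right_mono) auto
  also have "\<dots> = ?d * (2 / (128 * real n ^ 8))" using n_real_pos by (simp add: field_simps power_Suc[symmetric] del: power_Suc)
  also have "\<dots> \<le> ?d * 1"
  proof (rule mult_left_mono)
    have "1 \<le> real n ^ 8" using n_ge by (intro one_le_power) auto
    hence "2 \<le> 128 * real n ^ 8" "0 < 128 * real n ^ 8" by linarith+
    thus "2 / (128 * real n ^ 8) \<le> 1" by (simp only: divide_le_eq_1_pos)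
  qed simp
  finally show "2 * thr \<le> ?d" by simp
qed

text \<open>Double count the edges between \<open>side\<close> and \<open>miss\<close>: every member
  of \<open>side\<close> has at least degr / (2 n) neighbours in \<open>miss\<close>, and every
  member of \<open>miss\<close> has degree degr.\<close>

lemma card_side_le:
  assumes x: "x \<in> {1..n}"
  shows "real (card (side x P)) \<le> 2 * real n * real (card (miss x P))"
proof -
  define E where "E = (SIGMA S:side x P. miss x P \<inter> nb S)"
  have fE: "finite E" unfolding E_def by (intro finite_SigmaI) auto
  have low: "degr / (2 * real n) \<le> real (card (miss x P \<inter> nb S))" if S: "S \<in> side x P" for S
  proof -
    have S': "S \<in> ksets" "x \<notin> S" "real (card (star x \<inter> nb S - \<Union>(nb ` P))) < thr"
      using S by (auto simp: side_def)
    have "star x \<inter> nb S = (miss x P \<inter> nb S) \<union> (star x \<inter> nb S - \<Union>(nb ` P))" by (auto simp: miss_def)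
    hence "card (star x \<inter> nb S) = card (miss x P \<inter> nb S) + card (star x \<inter> nb S - \<Union>(nb ` P))"
      by (metis (no_types, lifting) Diff_disjoint Int_Diff card_Un_disjoint finite_Int finite_star
          finite_Diff inf_assoc inf_commute inf_bot_right miss_def)
    hence "2 * real (card (miss x P \<inter> nb S)) \<ge> real (card (star x \<inter> nb S))"
      using S'(3) star_degree(2)[OF S'(1) x S'(2)] by linarith
    hence "degr \<le> real n * (2 * real (card (miss x P \<inter> nb S)))"
      using star_degree(1)[OF S'(1) x S'(2)] n_real_pos by (smt (verit) mult_left_mono)
    thus ?thesis using n_real_pos by (simp add: field_simps)
  qed
  have "real (card (side x P)) * (degr / (2 * real n)) = (\<Sum>S\<in>side x P. degr / (2 * real n))" by simp
  also have "\<dots> \<le> (\<Sum>S\<in>side x P. real (card (miss x P \<inter> nb S)))" by (intro sum_mono low)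
  also have "\<dots> = real (card E)" unfolding E_def by simp
  also have "\<dots> = real (card (prod.swap ` E))" by (simp add: card_image)
  also have "\<dots> \<le> real (card (miss x P)) * degr"
  proof (rule card_Sigma_le_bound)
    show "prod.swap ` E \<subseteq> (SIGMA T:miss x P. nb T)"
      using side_subset by (fastforce simp: E_def nb_def)
    fix T assume "T \<in> miss x P"
    hence "T \<in> ksets" by (auto simp: miss_def star_def)
    thus "real (card (nb T)) \<le> degr" by (simp add: card_nb degr_def)
  qed (use fE in auto)
  finally show ?thesis using pos_params n_real_pos by (simp add: field_simps)
qed

text \<open>Two members of the star meet in x, so every disjoint pair has an end in
  \<open>core\<close>. The factor 3 counts pairs inside \<open>core\<close> and the mixed pairs in
  both orders.\<close>

lemma near_cont_pairs:
  "real (card (disjoint_pairs (near_cont x P Q))) \<le> 3 * (real (card (core x P Q)) * thr)"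
proof -
  let ?E1 = "SIGMA S:core x P Q. side x P \<inter> nb S - \<Union>(nb ` Q)"
  let ?E2 = "SIGMA S:core x P Q. star x \<inter> nb S - \<Union>(nb ` P)"
  have E1: "real (card ?E1) \<le> real (card (core x P Q)) * thr"
    by (rule card_Sigma_le_bound[OF _ order_refl]) (auto simp: core_def)
  have E2: "real (card ?E2) \<le> real (card (core x P Q)) * thr"
    by (rule card_Sigma_le_bound[OF _ order_refl]) (auto simp: core_def side_def)
  have "disjoint_pairs (near_cont x P Q) \<subseteq> ?E1 \<union> ?E2 \<union> prod.swap ` ?E2"
  proof
    fix p assume "p \<in> disjoint_pairs (near_cont x P Q)"
    then obtain S T where p: "p = (S, T)" "S \<in> near_cont x P Q" "T \<in> near_cont x P Q" "S \<inter> T = {}"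
      by (auto simp: disjoint_pairs_def)
    have nb: "T \<in> nb S" "S \<in> nb T" using p near_cont_subset unfolding nb_def by blast+
    consider "S \<in> core x P Q" "T \<in> core x P Q" | "S \<in> core x P Q" "T \<in> star x - miss x P"
      | "T \<in> core x P Q" "S \<in> star x - miss x P" | "S \<in> star x" "T \<in> star x"
      using p unfolding near_cont_def by blast
    thus "p \<in> ?E1 \<union> ?E2 \<union> prod.swap ` ?E2"
    proof cases
      case 1
      hence "(S, T) \<in> ?E1" using nb by (auto simp: core_def)
      thus ?thesis using p by blast
    next
      case 2
      hence "(S, T) \<in> ?E2" using nb by (auto simp: miss_def)
      thus ?thesis using p by blast
    next
      case 3
      hence "(T, S) \<in> ?E2" using nb by (auto simp: miss_def)
      hence "prod.swap (T, S) \<in> prod.swap ` ?E2" by (rule imageI)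
      thus ?thesis using p by simp
    next
      case 4
      then show ?thesis using p(4) by (auto simp: star_def)
    qed
  qed
  moreover have fin: "finite ?E1" "finite ?E2" by (auto intro!: finite_SigmaI)
  ultimately have "card (disjoint_pairs (near_cont x P Q)) \<le> card (?E1 \<union> ?E2 \<union> prod.swap ` ?E2)"
    by (intro card_mono) auto
  also have "\<dots> \<le> card ?E1 + card ?E2 + card (prod.swap ` ?E2)"
    by (meson card_Un_le add_right_mono order_trans)
  also have "card (prod.swap ` ?E2) = card ?E2" by (simp add: card_image)
  finally have "real (card (disjoint_pairs (near_cont x P Q))) \<le> real (card ?E1 + card ?E2 + card ?E2)"
    by (simp only: of_nat_le_iff)
  thus ?thesis using E1 E2 by simp
qed

text \<open>By \<open>card_side_le\<close> the number of disjoint pairs is at most 6 n w thr,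
  proportional to the number w of missing star members. Its contribution to the shortfall is then a
  small part of what the w missing members force through \<open>missing_ratio\<close> and
  \<open>defect_ratio\<close>, so the container itself must be small.\<close>

lemma near_cont_saving:
  assumes x: "x \<in> {1..n}" and w: "real (card (miss x P)) \<le> sz / (4 * real n)"
  shows "real (card (near_cont x P Q)) \<le> sz - real (card (miss x P)) / (8 * real n ^ 4)"
proof -
  let ?n = "real n" and ?C = "near_cont x P Q"
  define w where "w = real (card (miss x P))"
  define E where "E = real (card (disjoint_pairs ?C))"
  define c where "c = real (card ?C)"
  have w0: "0 \<le> w" by (simp add: w_def)
  have n1: "?n \<ge> 1" using n_ge by simp
  have "real (card (core x P Q)) \<le> real (card (side x P))"
    unfolding of_nat_le_iff by (intro card_mono core_subset) simp
  also have "\<dots> \<le> 2 * ?n * w" unfolding w_def by (rule card_side_le[OF x])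
  finally have "real (card (core x P Q)) * thr \<le> 2 * ?n * w * thr"
    using pos_params by (intro mult_right_mono) auto
  hence E: "E \<le> 6 * ?n * w * thr" using near_cont_pairs[of x P Q] unfolding E_def by linarith
  have "E / degr \<le> 6 * ?n * w * thr / degr" using E pos_params by (intro divide_right_mono) auto
  also have "\<dots> = 6 * ?n * w * (thr / degr)" by simp
  also have "\<dots> = 6 * w / (128 * ?n ^ 8)"
    unfolding thr_degr using n_real_pos by (simp add: field_simps power_Suc[symmetric] del: power_Suc)
  also have "\<dots> \<le> w / (16 * ?n ^ 8)" using w0 n_real_pos by (simp add: field_simps)
  finally have Ed: "E / degr \<le> w / (16 * ?n ^ 8)" .
  have wtot: "w \<le> tot"
    unfolding w_def card_ksets_tot[symmetric] of_nat_le_iff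
    by (rule card_mono[OF finite_ksets]) (use miss_subset star_subset in blast)
  have C: "?C \<subseteq> nsets {1..n} k" using near_cont_subset by (simp add: ksets_def)
  have W: "miss x P \<subseteq> nsets {1..n} k" "\<And>S. S \<in> miss x P \<Longrightarrow> x \<in> S" "miss x P \<inter> ?C = {}"
  proof -
    show "miss x P \<subseteq> nsets {1..n} k"
      using miss_subset star_subset unfolding ksets_def[symmetric] by blast
  qed (auto simp: star_def near_cont_def core_def side_def miss_def)
  have W': "S \<in> ?C" if "S \<in> nsets {1..n} k" "x \<in> S" "S \<notin> miss x P" for S
    using that by (simp add: near_cont_def star_def ksets_def)
  \<comment> \<open>The prescribed x must be the majority centre. The bound w \<le> sz / (4 n) keeps
    the arc term at most 1/8, and the pair term is at most 1/16.\<close>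
  have "1 - pin_ratio ?C x \<le> real k * w / sz + ?n ^ 3 * E / (tot * degr)"
    using pin_ratio_lower[OF C x W(1,2) W'] unfolding w_def E_def sz_def tot_def degr_def by simp
  also have "real k * w / sz \<le> ?n * w / 2 / sz"
    using mult_right_mono[OF k_half w0] pos_params by (intro divide_right_mono) auto
  also have "?n * w / 2 / sz \<le> 1 / 8"
    using w pos_params n_real_pos unfolding w_def[symmetric] by (simp add: field_simps)
  also have "?n ^ 3 * E / (tot * degr) = ?n ^ 3 * (E / degr) / tot" by (simp add: field_simps)
  also have "\<dots> \<le> ?n ^ 3 * (tot / (16 * ?n ^ 8)) / tot"
  proof (intro divide_right_mono mult_left_mono)
    show "E / degr \<le> tot / (16 * ?n ^ 8)" by (rule order_trans[OF Ed]) (intro divide_right_mono wtot, simp)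
  qed (use pos_params in auto)
  also have "\<dots> = 1 / (16 * ?n ^ 5)" using pos_params n_real_pos by (simp add: field_simps power_add[symmetric])
  also have "\<dots> \<le> 1 / 16"
  proof (rule frac_le)
    show "16 \<le> 16 * ?n ^ 5" using one_le_power[OF n1, of 5] by linarith
  qed auto
  finally have half: "pin_ratio ?C x \<ge> 1 / 2" by simp
  have "w / sz \<le> 1 - pin_ratio ?C x"
    using missing_ratio[OF W x] by (simp add: w_def sz_def)
  also have "\<dots> \<le> 4 * ?n ^ 3 * shortfall ?C" by (rule defect_ratio[OF C x half])
  also have "shortfall ?C = ?n / tot * (sz - c) + (?n + 1) * ?n ^ 2 * (E / degr) / tot"
    unfolding shortfall_eq c_def E_def by simp
  also have "(?n + 1) * ?n ^ 2 * (E / degr) / tot \<le> (2 * ?n) * ?n ^ 2 * (w / (16 * ?n ^ 8)) / tot"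
  proof (intro divide_right_mono mult_mono Ed)
    show "0 \<le> E / degr" using pos_params by (simp add: E_def)
  qed (use n1 pos_params in auto)
  also have "\<dots> = ?n / tot * (w / (8 * ?n ^ 6))"
    using pos_params n_real_pos by (simp add: field_simps power_add[symmetric] power2_eq_square power_Suc[symmetric] del: power_Suc)
  also have "4 * ?n ^ 3 * (?n / tot * (sz - c) + ?n / tot * (w / (8 * ?n ^ 6))) =
      4 * ?n ^ 4 / tot * ((sz - c) + w / (8 * ?n ^ 6))"
    by (simp add: algebra_simps power_Suc[symmetric] add_divide_distrib diff_divide_distrib eval_nat_numeral)
  finally have main: "w / sz \<le> 4 * ?n ^ 4 / tot * ((sz - c) + w / (8 * ?n ^ 6))"
    by (simp add: mult_left_mono)
  have "w / sz * (tot / (4 * ?n ^ 4)) \<le> 4 * ?n ^ 4 / tot * ((sz - c) + w / (8 * ?n ^ 6)) * (tot / (4 * ?n ^ 4))"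
    using main pos_params by (intro mult_right_mono) auto
  also have "\<dots> = (sz - c) + w / (8 * ?n ^ 6)" using pos_params n_real_pos by simp
  finally have main2: "w / sz * (tot / (4 * ?n ^ 4)) \<le> (sz - c) + w / (8 * ?n ^ 6)" .
  \<comment> \<open>Here tot \<ge> 2 sz turns the comparison of densities into one of
    cardinalities.\<close>
  have "w / (2 * ?n ^ 4) = w / sz * (2 * sz / (4 * ?n ^ 4))" using pos_params by simp
  also have "\<dots> \<le> w / sz * (tot / (4 * ?n ^ 4))"
    using tot_ge w0 pos_params by (intro mult_left_mono divide_right_mono) auto
  finally have main3: "w / (2 * ?n ^ 4) \<le> (sz - c) + w / (8 * ?n ^ 6)" using main2 by linarith
  have "w / (8 * ?n ^ 6) \<le> w / (8 * ?n ^ 4)"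
    using w0 n_power_mono[of 4 6] n_real_pos by (intro divide_left_mono) auto
  moreover have "w / (2 * ?n ^ 4) = 4 * (w / (8 * ?n ^ 4))" by simp
  moreover have "0 \<le> w / (8 * ?n ^ 4)" using w0 by simp
  ultimately show ?thesis using main3 unfolding w_def[symmetric] c_def[symmetric] by linarith
qed

text \<open>Sort the families by the size w of \<open>miss\<close>. Each member of \<open>P\<close>
  blocks at least \<open>thr\<close> star members on average, so \<open>P\<close> has at most w /
  thr members; in the same way \<open>Q\<close> has at most 2 n w / thr by
  \<open>card_side_le\<close>. Describing both costs at most w / (16 n^4) bits, half of the saving
  from \<open>near_cont_saving\<close>.\<close>

lemma near_light_count:
  assumes x: "x \<in> {1..n}"
  shows "real (card {F. F \<subseteq> ksets \<and> intersecting F \<and> away F x \<noteq> {} \<and>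
      real (card (star x \<inter> \<Union>(nb ` away F x))) < sz / (4 * real n)}) \<le> 2 powr (sz - real n)"
    (is "real (card ?L) \<le> _")
proof -
  let ?n = "real n"
  define B where "B r = {P. P \<subseteq> ksets \<and> real (card P) \<le> r}" for r :: real
  define J where "J = {w. w \<le> n choose k \<and> thr \<le> real w}"
  define I where "I w = {(P, Q) \<in> B (real w / thr) \<times> B (2 * ?n * real w / thr).
    card (miss x P) = w \<and> real w \<le> sz / (4 * ?n)}" for w :: nat
  have fB: "finite (B r)" for r unfolding B_def by (rule finite_subset[of _ "Pow ksets"]) auto
  have fI: "finite (I w)" for w
    unfolding I_def by (rule finite_subset[of _ "B (real w / thr) \<times> B (2 * ?n * real w / thr)"]) (auto simp: fB)
  have fJ: "finite J" unfolding J_def by (rule finite_subset[of _ "{..n choose k}"]) auto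
  have "?L \<subseteq> (\<Union>w\<in>J. \<Union>(P, Q)\<in>I w. Pow (near_cont x P Q))"
  proof
    fix F assume "F \<in> ?L"
    hence F: "F \<subseteq> ksets" "intersecting F" "away F x \<noteq> {}"
      "real (card (star x \<inter> \<Union>(nb ` away F x))) < sz / (4 * ?n)" by auto
    define A where "A = away F x"
    have A: "A \<subseteq> ksets" "A \<subseteq> F" "\<And>S. S \<in> A \<Longrightarrow> x \<notin> S" using F(1) by (auto simp: A_def away_def)
    have fA: "finite A" using A(1) finite_ksets by (rule finite_subset)
    obtain P where P: "P \<subseteq> A" "thr * real (card P) \<le> real (card (star x \<inter> \<Union>(nb ` P)))"
      "\<And>v. v \<in> A \<Longrightarrow> real (card (star x \<inter> nb v - \<Union>(nb ` P))) < thr"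
      using fingerprint[OF fA finite_star pos_params(4), of x nb] by blast
    have Aside: "A \<subseteq> side x P" using P(3) A unfolding side_def by blast
    obtain Q where Q: "Q \<subseteq> A" "thr * real (card Q) \<le> real (card (side x P \<inter> \<Union>(nb ` Q)))"
      "\<And>v. v \<in> A \<Longrightarrow> real (card (side x P \<inter> nb v - \<Union>(nb ` Q))) < thr"
      using fingerprint[OF fA finite_side pos_params(4), of x P nb] by blast
    define w where "w = card (miss x P)"
    have no: "S \<notin> \<Union>(nb ` R)" if "S \<in> F" "R \<subseteq> A" for S R
      using F(2) that A(2) unfolding intersecting_def nb_def by blast
    have Acore: "A \<subseteq> core x P Q" using Aside Q(3) no[OF _ Q(1)] A(2) unfolding core_def by blast
    have "F - A \<subseteq> star x - miss x P"
      using no[OF _ P(1)] F(1) unfolding star_def miss_def A_def away_def by blast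
    hence Fcont: "F \<subseteq> near_cont x P Q" using Acore unfolding near_cont_def by blast
    \<comment> \<open>An empty \<open>P\<close> would leave some v in \<open>A\<close> with fewer
      than \<open>thr\<close> neighbours in the star, contrary to \<open>star_degree\<close>. This
      yields w \<ge> thr, so that the saving exceeds n.\<close>
    have "P \<noteq> {}"
    proof
      assume "P = {}"
      obtain v where v: "v \<in> A" using F(3) A_def by blast
      have "real (card (star x \<inter> nb v)) < thr" using P(3)[OF v] \<open>P = {}\<close> by simp
      thus False using star_degree(2)[of v x] A v x pos_params by force
    qed
    hence "card P \<ge> 1" using P(1) fA finite_subset by (metis One_nat_def Suc_leI card_gt_0_iff)
    hence "thr * 1 \<le> thr * real (card P)" using pos_params by (intro mult_left_mono) auto
    hence tw: "thr \<le> real w" using P(2) by (simp add: w_def miss_def)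
    have "w \<le> card ksets" unfolding w_def by (rule card_mono[OF finite_ksets]) (use miss_subset star_subset in blast)
    hence wJ: "w \<in> J" using tw by (simp add: J_def card_ksets)
    have PB: "P \<in> B (real w / thr)"
      using P A(1) pos_params by (auto simp: B_def w_def miss_def field_simps)
    have "real (card (side x P \<inter> \<Union>(nb ` Q))) \<le> real (card (side x P))"
      unfolding of_nat_le_iff by (intro card_mono) auto
    hence "thr * real (card Q) \<le> 2 * ?n * real w"
      using Q(2) card_side_le[OF x, of P] unfolding w_def by linarith
    hence QB: "Q \<in> B (2 * ?n * real w / thr)"
      using Q(1) A(1) pos_params by (auto simp: B_def field_simps)
    have "w \<le> card (star x \<inter> \<Union>(nb ` away F x))"
      unfolding w_def miss_def using P(1) A_def by (intro card_mono) auto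
    hence "real w \<le> sz / (4 * ?n)" using F(4) by linarith
    hence "(P, Q) \<in> I w" using PB QB by (simp add: I_def w_def)
    thus "F \<in> (\<Union>w\<in>J. \<Union>(P, Q)\<in>I w. Pow (near_cont x P Q))" using wJ Fcont by blast
  qed
  hence "real (card ?L) \<le> real (card (\<Union>w\<in>J. \<Union>(P, Q)\<in>I w. Pow (near_cont x P Q)))"
    unfolding of_nat_le_iff using fJ fI by (intro card_mono) auto
  also have "\<dots> \<le> real (card J) * 2 powr (sz - 2 * ?n)"
  proof (intro card_UN_le_bound fJ)
    fix w assume w: "w \<in> J"
    hence tw: "thr \<le> real w" by (simp add: J_def)
    have "real (card (\<Union>(P, Q)\<in>I w. Pow (near_cont x P Q))) \<le> real (card (I w)) * 2 powr (sz - real w / (8 * ?n ^ 4))"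
    proof (intro card_UN_le_bound fI)
      fix p assume "p \<in> I w"
      then obtain P Q where p: "p = (P, Q)" "card (miss x P) = w" "real w \<le> sz / (4 * ?n)"
        by (auto simp: I_def)
      show "real (card (case p of (P, Q) \<Rightarrow> Pow (near_cont x P Q))) \<le> 2 powr (sz - real w / (8 * ?n ^ 4))"
        unfolding p(1) prod.case using near_cont_saving[OF x, of P Q] p by (intro card_Pow_powr) auto
    qed
    also have "real (card (I w)) \<le> 2 powr (?n * (real w / thr)) * 2 powr (?n * (2 * ?n * real w / thr))"
    proof -
      have "real (card (I w)) \<le> real (card (B (real w / thr) \<times> B (2 * ?n * real w / thr)))"
        unfolding of_nat_le_iff by (intro card_mono) (auto simp: I_def fB)
      also have "\<dots> = real (card (B (real w / thr))) * real (card (B (2 * ?n * real w / thr)))"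
        by (simp add: card_cartesian_product)
      also have "\<dots> \<le> 2 powr (?n * (real w / thr)) * 2 powr (?n * (2 * ?n * real w / thr))"
        unfolding B_def using pos_params by (intro mult_mono card_ksets_subsets) auto
      finally show ?thesis .
    qed
    finally have "real (card (\<Union>(P, Q)\<in>I w. Pow (near_cont x P Q))) \<le>
      2 powr (?n * (real w / thr)) * 2 powr (?n * (2 * ?n * real w / thr)) * 2 powr (sz - real w / (8 * ?n ^ 4))"
      by (simp add: mult_right_mono)
    also have "\<dots> = 2 powr (?n * (real w / thr) + ?n * (2 * ?n * real w / thr) + (sz - real w / (8 * ?n ^ 4)))"
      by (simp add: powr_add)
    also have "\<dots> \<le> 2 powr (sz - 2 * ?n)"
    proof (rule powr_mono)
      have n2: "?n + 2 * ?n ^ 2 \<le> 3 * ?n ^ 2" using n_power_mono[of 1 2] by simp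
      have "?n * (real w / thr) + ?n * (2 * ?n * real w / thr) = (?n + 2 * ?n ^ 2) * real w / thr"
        by (simp add: algebra_simps power2_eq_square add_divide_distrib)
      also have "\<dots> \<le> 3 * ?n ^ 2 * real w / (?n ^ 11 / 128)"
        using n2 thr_ge n_real_pos by (intro frac_le mult_right_mono) auto
      also have "\<dots> = 384 * real w / ?n ^ 9"
        using n_real_pos by (simp add: field_simps power_add[symmetric])
      also have "\<dots> \<le> real w / (16 * ?n ^ 4)"
      proof -
        have "16384 * 1 \<le> ?n * ?n ^ 4" using n_ge by (intro mult_mono one_le_power) auto
        hence "6144 \<le> ?n ^ 5" by (simp add: power_Suc[symmetric] del: power_Suc)
        hence "6144 * (real w * ?n ^ 4) \<le> ?n ^ 5 * (real w * ?n ^ 4)" by (intro mult_right_mono) auto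
        thus ?thesis using n_real_pos by (simp add: field_simps power_add[symmetric])
      qed
      finally have 1: "?n * (real w / thr) + ?n * (2 * ?n * real w / thr) \<le> real w / (16 * ?n ^ 4)" .
      have "16384 \<le> ?n ^ 6" using n_le_power[of 6] n_ge by linarith
      hence "16384 * ?n ^ 5 \<le> ?n ^ 6 * ?n ^ 5" by (rule mult_right_mono) simp
      hence "16384 * ?n ^ 5 \<le> ?n ^ 11" by (simp add: power_add[symmetric])
      moreover have "0 \<le> ?n ^ 5" by simp
      ultimately have "4096 * ?n ^ 5 \<le> ?n ^ 11" by linarith
      moreover have "2 * ?n * (16 * ?n ^ 4) = 32 * ?n ^ 5" by (simp add: eval_nat_numeral)
      ultimately have "2 * ?n * (16 * ?n ^ 4) \<le> ?n ^ 11 / 128" by simp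
      also have "\<dots> \<le> real w" using thr_ge tw by linarith
      finally have 2: "2 * ?n \<le> real w / (16 * ?n ^ 4)" using n_real_pos by (simp add: pos_le_divide_eq)
      have "real w / (8 * ?n ^ 4) = real w / (16 * ?n ^ 4) + real w / (16 * ?n ^ 4)" by simp
      thus "?n * (real w / thr) + ?n * (2 * ?n * real w / thr) + (sz - real w / (8 * ?n ^ 4)) \<le> sz - 2 * ?n"
        using 1 2 by linarith
    qed simp
    finally show "real (card (\<Union>(P, Q)\<in>I w. Pow (near_cont x P Q))) \<le> 2 powr (sz - 2 * ?n)" .
  qed
  \<comment> \<open>There are at most 2^n values of w, which is why each of them was bounded with 2
    n in the exponent.\<close>
  also have "real (card J) \<le> 2 powr ?n"
  proof -
    have "0 \<notin> J" using pos_params by (simp add: J_def)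
    hence "J \<subseteq> {1..n choose k}" by (auto simp: J_def Suc_le_eq intro: gr0I)
    hence "card J \<le> n choose k" using card_mono[of "{1..n choose k}" J] by simp
    also have "\<dots> \<le> 2 ^ n" by (rule binomial_le_pow2)
    finally have "real (card J) \<le> real (2 ^ n)" by (simp only: of_nat_le_iff)
    thus ?thesis by (simp add: powr_realpow)
  qed
  finally have "real (card ?L) \<le> 2 powr ?n * 2 powr (sz - 2 * ?n)" by (simp add: mult_right_mono)
  also have "\<dots> = 2 powr (sz - ?n)" by (simp add: powr_add[symmetric])
  finally show ?thesis .
qed

text \<open>If F is not far from every star, some x has few members of F avoiding it; the number of
  star members they block decides between the heavy and the light count. Nontriviality makes
  \<open>away F x\<close> nonempty, as the light count requires.\<close>

lemma nontrivial_count: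
  "real (card {F \<in> intersecting_families n k. \<not> trivial_on {1..n} F}) \<le> (2 * real n + 1) * 2 powr (sz - real n)"
proof -
  let ?n = "real n"
  let ?Far = "{F. F \<subseteq> ksets \<and> intersecting F \<and> (\<forall>x\<in>{1..n}. real (card (away F x)) > sz / (8 * ?n ^ 2))}"
  let ?H = "\<lambda>x. {F. F \<subseteq> ksets \<and> intersecting F \<and> real (card (away F x)) \<le> sz / (8 * ?n ^ 2) \<and>
      sz / (4 * ?n) \<le> real (card (star x \<inter> \<Union>(nb ` away F x)))}"
  let ?L = "\<lambda>x. {F. F \<subseteq> ksets \<and> intersecting F \<and> away F x \<noteq> {} \<and>
      real (card (star x \<inter> \<Union>(nb ` away F x))) < sz / (4 * ?n)}"
  let ?b = "2 powr (sz - ?n)"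
  have fin: "finite ?Far" "finite (?H x)" "finite (?L x)" for x
    by (auto intro!: finite_subset[of _ "Pow ksets"])
  have "{F \<in> intersecting_families n k. \<not> trivial_on {1..n} F} \<subseteq> ?Far \<union> (\<Union>x\<in>{1..n}. ?H x) \<union> (\<Union>x\<in>{1..n}. ?L x)"
  proof
    fix F assume "F \<in> {F \<in> intersecting_families n k. \<not> trivial_on {1..n} F}"
    hence F: "F \<subseteq> ksets" "intersecting F" "\<And>x. x \<in> {1..n} \<Longrightarrow> away F x \<noteq> {}"
      by (auto simp: intersecting_families_def ksets_def trivial_on_def away_def)
    show "F \<in> ?Far \<union> (\<Union>x\<in>{1..n}. ?H x) \<union> (\<Union>x\<in>{1..n}. ?L x)"
    proof (cases "\<forall>x\<in>{1..n}. real (card (away F x)) > sz / (8 * ?n ^ 2)")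
      case False
      then obtain x where x: "x \<in> {1..n}" "real (card (away F x)) \<le> sz / (8 * ?n ^ 2)" by force
      hence "F \<in> ?H x \<or> F \<in> ?L x"
        using F by (cases "sz / (4 * ?n) \<le> real (card (star x \<inter> \<Union>(nb ` away F x)))") auto
      thus ?thesis using x(1) by blast
    qed (use F in blast)
  qed
  hence "card {F \<in> intersecting_families n k. \<not> trivial_on {1..n} F} \<le>
      card (?Far \<union> (\<Union>x\<in>{1..n}. ?H x) \<union> (\<Union>x\<in>{1..n}. ?L x))"
    using fin by (intro card_mono) auto
  also have "\<dots> \<le> card ?Far + card (\<Union>x\<in>{1..n}. ?H x) + card (\<Union>x\<in>{1..n}. ?L x)"
    by (meson card_Un_le add_right_mono order_trans)
  finally have "real (card {F \<in> intersecting_families n k. \<not> trivial_on {1..n} F}) \<le>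
      real (card ?Far + card (\<Union>x\<in>{1..n}. ?H x) + card (\<Union>x\<in>{1..n}. ?L x))" by (simp only: of_nat_le_iff)
  also have "\<dots> = real (card ?Far) + real (card (\<Union>x\<in>{1..n}. ?H x)) + real (card (\<Union>x\<in>{1..n}. ?L x))" by simp
  also have "\<dots> \<le> ?b + real (card {1..n}) * ?b + real (card {1..n}) * ?b"
    by (intro add_mono far_count card_UN_le_bound near_heavy_count near_light_count) auto
  also have "\<dots> = (2 * ?n + 1) * ?b" by (simp add: algebra_simps)
  finally show ?thesis .
qed

end

section \<open>Trivial families and small set size\<close>

lemma ln_two_ge_half: "1 / 2 \<le> ln (2 :: real)"
  using ln_le_minus_one[of "1 / 2"] by (simp add: ln_div)

lemma card_subsets_containing_two:
  assumes "finite U" "x \<in> U" "y \<in> U" "x \<noteq> y"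
  shows "card {S. S \<subseteq> U \<and> card S = m \<and> x \<in> S \<and> y \<in> S} \<le> (card U - 2) choose (m - 2)"
proof -
  have "card {S. S \<subseteq> U \<and> card S = m \<and> x \<in> S \<and> y \<in> S} \<le> card {T. T \<subseteq> U - {x, y} \<and> card T = m - 2}"
  proof (rule card_inj_on_le)
    show "inj_on (\<lambda>S. S - {x, y}) {S. S \<subseteq> U \<and> card S = m \<and> x \<in> S \<and> y \<in> S}"
      by (rule inj_onI) blast
    show "(\<lambda>S. S - {x, y}) ` {S. S \<subseteq> U \<and> card S = m \<and> x \<in> S \<and> y \<in> S} \<subseteq> {T. T \<subseteq> U - {x, y} \<and> card T = m - 2}"
      using assms by (auto simp: card_Diff_subset)
  qed (use assms in auto)
  thus ?thesis using assms by (simp add: n_subsets card_Diff_subset numeral_2_eq_2)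
qed

context cyclic_orders
begin

section \<open>Trivial families and overlaps of stars\<close>

lemma card_star_Int: "card (star x \<inter> star y) \<le> (n - 2) choose (k - 2)"
  if "x \<in> {1..n}" "y \<in> {1..n}" "x \<noteq> y"
proof -
  have "star x \<inter> star y \<subseteq> {S. S \<subseteq> {1..n} \<and> card S = k \<and> x \<in> S \<and> y \<in> S}"
    using ksetsD by (auto simp: star_def)
  hence "card (star x \<inter> star y) \<le> card {S. S \<subseteq> {1..n} \<and> card S = k \<and> x \<in> S \<and> y \<in> S}"
    by (intro card_mono) auto
  also have "\<dots> \<le> (card {1..n} - 2) choose (k - 2)"
    using that by (intro card_subsets_containing_two) auto
  finally show ?thesis by simp
qed

lemma star_size_split: "(n - 1) choose (k - 1) = ((n - 2) choose (k - 2)) + ((n - 2) choose (k - 1))"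
proof -
  have "n - 1 = Suc (n - 2)" "k - 1 = Suc (k - 2)" using k2 kn by auto
  thus ?thesis by (simp add: binomial_Suc_Suc)
qed

lemma star_size_ge: "n - 1 \<le> (n - 1) choose (k - 1)" and star_rest_ge: "n - 2 \<le> (n - 2) choose (k - 1)"
  using binomial_mono[of 1 "k - 1" "n - 1"] binomial_mono[of 1 "k - 1" "n - 2"] k2 kn by auto

lemma finite_intersecting_families: "finite (intersecting_families n k)"
  by (rule finite_subset[of _ "Pow ksets"]) (auto simp: intersecting_families_def ksets_def finite_imp_finite_nsets)

lemma trivial_families_eq:
  "{F \<in> intersecting_families n k. trivial_on {1..n} F} = (\<Union>x\<in>{1..n}. Pow (star x))"
proof (intro equalityI subsetI)
  fix F assume "F \<in> {F \<in> intersecting_families n k. trivial_on {1..n} F}"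
  thus "F \<in> (\<Union>x\<in>{1..n}. Pow (star x))"
    unfolding intersecting_families_def trivial_on_def star_def ksets_def by blast
next
  fix F assume "F \<in> (\<Union>x\<in>{1..n}. Pow (star x))"
  then obtain x where x: "x \<in> {1..n}" "F \<subseteq> star x" by blast
  hence "\<forall>A\<in>F. x \<in> A" "F \<subseteq> nsets {1..n} k" by (auto simp: star_def ksets_def)
  thus "F \<in> {F \<in> intersecting_families n k. trivial_on {1..n} F}"
    using x(1) unfolding intersecting_families_def trivial_on_def intersecting_def by blast
qed

lemma trivial_upper:
  "real (card {F \<in> intersecting_families n k. trivial_on {1..n} F}) \<le> real n * 2 ^ ((n - 1) choose (k - 1))"
proof -
  have "real (card (\<Union>x\<in>{1..n}. Pow (star x))) \<le> real (card {1..n}) * 2 ^ ((n - 1) choose (k - 1))"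
    by (intro card_UN_le_bound) (auto simp: card_Pow card_star)
  thus ?thesis unfolding trivial_families_eq by simp
qed

lemma trivial_lower:
  "real n * 2 ^ ((n - 1) choose (k - 1)) * (1 - real n / 2 ^ (n - 2))
    \<le> real (card {F \<in> intersecting_families n k. trivial_on {1..n} F})"
proof -
  let ?a = "(n - 1) choose (k - 1)" and ?b = "(n - 2) choose (k - 2)"
  \<comment> \<open>The families whose only star is that of x. These sets are disjoint for different
    x. Two stars share at least n - 2 fewer members than one star has, so little is removed.\<close>
  define U where "U x = Pow (star x) - (\<Union>y\<in>{1..n} - {x}. Pow (star x \<inter> star y))" for x
  have U: "2 ^ ?a * (1 - real n / 2 ^ (n - 2)) \<le> real (card (U x))" if x: "x \<in> {1..n}" for x
  proof -
    have "real (card (\<Union>y\<in>{1..n} - {x}. Pow (star x \<inter> star y))) \<le> real (card ({1..n} - {x})) * 2 ^ ?b"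
    proof (rule card_UN_le_bound)
      fix y assume y: "y \<in> {1..n} - {x}"
      have "real (card (Pow (star x \<inter> star y))) = 2 ^ card (star x \<inter> star y)"
        by (subst card_Pow) auto
      also have "\<dots> \<le> 2 ^ ?b" using card_star_Int[OF x, of y] y by (intro power_increasing) auto
      finally show "real (card (Pow (star x \<inter> star y))) \<le> 2 ^ ?b" .
    qed simp
    also have "\<dots> \<le> real n * 2 ^ ?b"
      using x by (intro mult_right_mono) auto
    finally have 1: "real (card (\<Union>y\<in>{1..n} - {x}. Pow (star x \<inter> star y))) \<le> real n * 2 ^ ?b" .
    have "?b + (n - 2) \<le> ?a" using star_size_split star_rest_ge by linarith
    hence "(2 :: real) ^ (?b + (n - 2)) \<le> 2 ^ ?a" by (intro power_increasing) auto
    hence "(2 :: real) ^ ?b \<le> 2 ^ ?a / 2 ^ (n - 2)" by (simp add: power_add field_simps)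
    hence 2: "real n * 2 ^ ?b \<le> real n * (2 ^ ?a / 2 ^ (n - 2))" by (intro mult_left_mono) auto
    have "card (Pow (star x)) \<le> card (U x \<union> (\<Union>y\<in>{1..n} - {x}. Pow (star x \<inter> star y)))"
      unfolding U_def by (intro card_mono) auto
    also have "\<dots> \<le> card (U x) + card (\<Union>y\<in>{1..n} - {x}. Pow (star x \<inter> star y))" by (rule card_Un_le)
    finally have "real (card (Pow (star x))) \<le> real (card (U x) + card (\<Union>y\<in>{1..n} - {x}. Pow (star x \<inter> star y)))"
      by (simp only: of_nat_le_iff)
    hence "2 ^ ?a \<le> real (card (U x)) + real n * (2 ^ ?a / 2 ^ (n - 2))"
      using 1 2 card_star[OF x] by (simp add: card_Pow)
    thus ?thesis by (simp add: algebra_simps)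
  qed
  have disj: "U x \<inter> U y = {}" if "x \<in> {1..n}" "y \<in> {1..n}" "x \<noteq> y" for x y
  proof (rule ccontr)
    assume "U x \<inter> U y \<noteq> {}"
    then obtain F where "F \<in> U x" "F \<in> U y" by blast
    hence "F \<in> Pow (star x \<inter> star y)" "F \<notin> Pow (star x \<inter> star y)"
      using that unfolding U_def by (blast, blast)
    thus False by simp
  qed
  have "real n * 2 ^ ?a * (1 - real n / 2 ^ (n - 2)) = (\<Sum>x\<in>{1..n}. 2 ^ ?a * (1 - real n / 2 ^ (n - 2)))" by simp
  also have "\<dots> \<le> (\<Sum>x\<in>{1..n}. real (card (U x)))" by (intro sum_mono U)
  also have "\<dots> = real (card (\<Union>x\<in>{1..n}. U x))"
    using disj by (subst card_UN_disjoint) (auto simp: U_def)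
  also have "\<dots> \<le> real (card (\<Union>x\<in>{1..n}. Pow (star x)))"
    unfolding of_nat_le_iff by (intro card_mono) (auto simp: U_def)
  finally show ?thesis unfolding trivial_families_eq .
qed

lemma families_lower: "2 ^ ((n - 1) choose (k - 1)) \<le> real (card (intersecting_families n k))"
proof -
  have "Pow (star 1) \<subseteq> (\<Union>x\<in>{1..n}. Pow (star x))" using n_pos by (intro UN_upper) auto
  hence "Pow (star 1) \<subseteq> intersecting_families n k" unfolding trivial_families_eq[symmetric] by blast
  hence "card (Pow (star 1)) \<le> card (intersecting_families n k)"
    by (intro card_mono finite_intersecting_families)
  hence "real (card (Pow (star 1))) \<le> real (card (intersecting_families n k))" by (simp only: of_nat_le_iff)
  thus ?thesis using card_star[of 1] n_pos by (simp add: card_Pow)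
qed

lemma card_families_split:
  "card (intersecting_families n k) = card {F \<in> intersecting_families n k. trivial_on {1..n} F}
    + card {F \<in> intersecting_families n k. \<not> trivial_on {1..n} F}"
  using finite_intersecting_families
  by (subst card_Un_disjoint[symmetric]) (auto intro!: arg_cong[of _ _ card])

text \<open>Fix A in F and, for each x in A, a member B x avoiding x. Every S in F meets A in some x
  and then B x in some y \<noteq> x, which leaves k^2 pairs of points to choose from.\<close>

lemma nontrivial_card_le:
  assumes F: "F \<in> intersecting_families n k" "\<not> trivial_on {1..n} F"
  shows "card F \<le> k ^ 2 * ((n - 2) choose (k - 2))"
proof -
  have Fk: "F \<subseteq> ksets" and int: "intersecting F"
    using F(1) by (auto simp: intersecting_families_def ksets_def)
  have "F \<noteq> {}"
  proof
    assume "F = {}"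
    hence "trivial_on {1..n} F" using n_pos unfolding trivial_on_def by (intro bexI[of _ 1]) auto
    thus False using F(2) by simp
  qed
  then obtain A where A: "A \<in> F" by blast
  have Ak: "A \<subseteq> {1..n}" "card A = k" "finite A" using A Fk ksetsD by blast+
  have "\<forall>x\<in>A. \<exists>B\<in>F. x \<notin> B" using F(2) Ak unfolding trivial_on_def by blast
  then obtain B where B: "\<And>x. x \<in> A \<Longrightarrow> B x \<in> F" "\<And>x. x \<in> A \<Longrightarrow> x \<notin> B x" by metis
  have Bk: "B x \<subseteq> {1..n}" "card (B x) = k" "finite (B x)" if "x \<in> A" for x
    using B(1)[OF that] Fk ksetsD by blast+
  have "F \<subseteq> (\<Union>x\<in>A. \<Union>y\<in>B x. star x \<inter> star y)"
  proof
    fix S assume S: "S \<in> F"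
    obtain x where x: "x \<in> A" "x \<in> S" using int A S unfolding intersecting_def by blast
    obtain y where "y \<in> B x" "y \<in> S" using int B(1)[OF x(1)] S unfolding intersecting_def by blast
    thus "S \<in> (\<Union>x\<in>A. \<Union>y\<in>B x. star x \<inter> star y)" using x S Fk by (auto simp: star_def)
  qed
  hence "card F \<le> card (\<Union>x\<in>A. \<Union>y\<in>B x. star x \<inter> star y)"
    by (intro card_mono) (auto simp: Ak Bk)
  also have "\<dots> \<le> (\<Sum>x\<in>A. card (\<Union>y\<in>B x. star x \<inter> star y))" by (intro card_UN_le Ak)
  also have "\<dots> \<le> (\<Sum>x\<in>A. \<Sum>y\<in>B x. card (star x \<inter> star y))" by (intro sum_mono card_UN_le Bk)
  also have "\<dots> \<le> (\<Sum>x\<in>A. \<Sum>y\<in>B x. (n - 2) choose (k - 2))"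
  proof (intro sum_mono card_star_Int)
    fix x y assume xy: "x \<in> A" "y \<in> B x"
    show "x \<in> {1..n}" "y \<in> {1..n}" "x \<noteq> y" using xy Ak Bk B(2) by blast+
  qed
  also have "\<dots> = k ^ 2 * ((n - 2) choose (k - 2))" using Ak Bk by (simp add: power2_eq_square)
  finally show ?thesis .
qed

text \<open>The exponent of the crude count is 2 k^3 b log n, where b = (n-2 choose k-2), while a =
  (n-1 choose k-1) satisfies a (k - 1) = (n - 1) b. It suffices that 4 k^3 (k - 1) log n is at most
  n - 1, with log to base 2.\<close>

lemma nontrivial_count_small:
  assumes small: "k ^ 8 \<le> n" and large: "2 ^ 21 \<le> n"
  shows "real (card {F \<in> intersecting_families n k. \<not> trivial_on {1..n} F})
    \<le> 2 powr (real ((n - 1) choose (k - 1)) - (real n - 1) / 2)"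
proof -
  let ?a = "(n - 1) choose (k - 1)" and ?b = "(n - 2) choose (k - 2)"
  let ?r = "k ^ 2 * ?b"
  \<comment> \<open>In terms of the fourth root of n one has k^2 \<le> u and log n \<le> 8 u to base
    2, so the quantity to bound is at most 32 u^3. This is at most u^4 - 1 once u \<ge> 33, and 33^4
    < 2^21.\<close>
  define u where "u = sqrt (sqrt (real n))"
  have "(u ^ 2) ^ 2 = real n" by (simp add: u_def)
  hence u4: "u ^ 4 = real n" by (simp add: power_mult[symmetric])
  have u0: "u \<ge> 0" by (simp add: u_def)
  have u33: "u \<ge> 33"
  proof (rule ccontr)
    assume "\<not> ?thesis"
    hence "u ^ 4 \<le> 33 ^ 4" using u0 by (intro power_mono) auto
    thus False using u4 large by simp
  qed
  have ku: "real k ^ 2 \<le> u"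
  proof (rule ccontr)
    assume "\<not> ?thesis"
    hence "u ^ 4 < (real k ^ 2) ^ 4" using u0 by (intro power_strict_mono) auto
    hence "real n < real (k ^ 8)" using u4 by (simp add: power_mult[symmetric])
    thus False using small by linarith
  qed
  have lnu: "ln (real n) \<le> 4 * u"
  proof -
    have "ln (real n) = 4 * ln u" using u4 u33 ln_realpow[of u 4] by simp
    also have "ln u \<le> u" using ln_le_minus_one[of u] u33 by linarith
    finally show ?thesis by simp
  qed
  have fin: "finite {F. F \<subseteq> ksets \<and> card F \<le> ?r}" by (rule finite_subset[of _ "Pow ksets"]) auto
  have "{F \<in> intersecting_families n k. \<not> trivial_on {1..n} F} \<subseteq> {F. F \<subseteq> ksets \<and> card F \<le> ?r}"
    using nontrivial_card_le by (auto simp: intersecting_families_def ksets_def)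
  hence "card {F \<in> intersecting_families n k. \<not> trivial_on {1..n} F} \<le> card {F. F \<subseteq> ksets \<and> card F \<le> ?r}"
    by (intro card_mono fin)
  also have "\<dots> \<le> (card ksets + 1) ^ ?r" by (rule card_small_subsets) simp
  also have "\<dots> \<le> (n ^ (2 * k)) ^ ?r"
  proof (rule power_mono)
    have "n choose k \<le> n ^ k" using kn by (intro binomial_le_pow) auto
    moreover have "n ^ k + 1 \<le> n ^ k * n ^ k"
    proof -
      have "n ^ 1 \<le> n ^ k" using k_pos n_pos by (intro power_increasing) auto
      hence "2 \<le> n ^ k" using large by simp
      hence "n ^ k * 2 \<le> n ^ k * n ^ k" by (intro mult_left_mono) auto
      thus ?thesis using \<open>2 \<le> n ^ k\<close> by linarith
    qed
    ultimately show "card ksets + 1 \<le> n ^ (2 * k)" by (simp add: card_ksets mult_2 power_add)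
  qed simp
  also have "\<dots> = n ^ (2 * k * ?r)" by (simp only: power_mult)
  finally have "real (card {F \<in> intersecting_families n k. \<not> trivial_on {1..n} F}) \<le> real (n ^ (2 * k * ?r))"
    by (simp only: of_nat_le_iff)
  also have "\<dots> = 2 powr (log 2 (real n) * real (2 * k * ?r))"
  proof -
    have "2 powr (log 2 (real n) * real (2 * k * ?r)) = (2 powr log 2 (real n)) powr real (2 * k * ?r)"
      by (rule powr_powr[symmetric])
    also have "2 powr log 2 (real n) = real n" using n_pos by simp
    also have "real n powr real (2 * k * ?r) = real n ^ (2 * k * ?r)" using n_pos by (intro powr_realpow) simp
    finally show ?thesis by (simp only: of_nat_power)
  qed
  also have "\<dots> \<le> 2 powr (real ?a - (real n - 1) / 2)"
  proof (rule powr_mono)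
    have k1: "real k - 1 > 0" using k2 by simp
    have absorb: "real ?a * (real k - 1) = (real n - 1) * real ?b"
    proof -
      have "(k - 1) * ?a = (n - 1) * ?b"
        using binomial_absorption[of "k - 2" "n - 1"] k2 by (simp add: numeral_2_eq_2 Suc_diff_Suc)
      hence "real ((k - 1) * ?a) = real ((n - 1) * ?b)" by simp
      thus ?thesis using k2 n_pos by (simp add: of_nat_diff algebra_simps)
    qed
    have "log 2 (real n) \<le> 8 * u"
    proof -
      have "ln (real n) \<le> 8 * u * ln 2"
        using lnu u0 mult_left_mono[OF ln_two_ge_half, of "8 * u"] by simp
      thus ?thesis by (simp add: log_def field_simps)
    qed
    hence "log 2 (real n) * (4 * real k ^ 3 * (real k - 1)) \<le> 8 * u * (4 * real k ^ 3 * (real k - 1))"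
      using k1 by (intro mult_right_mono) auto
    also have "\<dots> \<le> 8 * u * (4 * u ^ 2)"
    proof -
      have "real k ^ 3 * (real k - 1) \<le> real k ^ 3 * real k" by (intro mult_left_mono) auto
      also have "\<dots> = (real k ^ 2) ^ 2" by (simp add: eval_nat_numeral)
      also have "\<dots> \<le> u ^ 2" using ku by (intro power_mono) auto
      finally show ?thesis using u0 by (intro mult_left_mono) auto
    qed
    also have "\<dots> = 32 * u ^ 3" by (simp add: eval_nat_numeral)
    also have "32 * u ^ 3 \<le> real n - 1"
    proof -
      have "33 * u ^ 3 \<le> u * u ^ 3" using u33 u0 by (intro mult_right_mono) auto
      moreover have "1 \<le> u ^ 3" using u33 by (intro one_le_power) auto
      moreover have "u * u ^ 3 = real n" unfolding u4[symmetric] by (simp add: eval_nat_numeral)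
      ultimately show ?thesis by linarith
    qed
    finally have key: "log 2 (real n) * (4 * real k ^ 3 * (real k - 1)) \<le> real n - 1" .
    have "log 2 (real n) * real (2 * k * ?r) * (2 * (real k - 1)) =
        log 2 (real n) * (4 * real k ^ 3 * (real k - 1)) * real ?b" by (simp add: eval_nat_numeral)
    also have "\<dots> \<le> (real n - 1) * real ?b" using key by (intro mult_right_mono) auto
    also have "\<dots> = real ?a / 2 * (2 * (real k - 1))" unfolding absorb[symmetric] by simp
    finally have "log 2 (real n) * real (2 * k * ?r) \<le> real ?a / 2" using k1 by simp
    moreover have "real n - 1 \<le> real ?a"
    proof -
      have "real (n - 1) \<le> real ?a" using star_size_ge by (simp only: of_nat_le_iff)
      thus ?thesis using n_pos by (simp add: of_nat_diff)
    qed
    moreover have "v \<le> a - m / 2" if "v \<le> a / 2" "m \<le> a" for v a m :: real using that by simp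
    ultimately show "log 2 (real n) * real (2 * k * ?r) \<le> real ?a - (real n - 1) / 2" by blast
  qed simp
  finally show ?thesis .
qed

end

section \<open>The main theorem\<close>

text \<open>The exponent splits as \<open>170 = 8 * 20 + 10\<close>, where \<open>k ^ 10\<close> pays for the denominator \<open>170 ^ 170\<close>.\<close>

lemma degree_large:
  fixes c :: nat
  assumes c: "c = 170" and k: "n < k ^ 8" and n: "2 * k + c \<le> n" "(c ^ 17) ^ 8 \<le> n"
  shows "real n ^ 20 \<le> real ((n - k) choose k)"
proof -
  have c0: "real c > 0" using c by simp
  \<comment> \<open>Forced by n < k^8 and the lower bound on n. Then k^10 \<ge> c^170, since 17 * 10
    = 170.\<close>
  have kc: "c ^ 17 \<le> k"
  proof (rule ccontr)
    assume "\<not> ?thesis"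
    hence "k ^ 8 \<le> (c ^ 17) ^ 8" by (intro power_mono) auto
    thus False using k n(2) by linarith
  qed
  have "real c ^ 170 = (real c ^ 17) ^ 10" by (simp add: power_mult[symmetric])
  also have "\<dots> \<le> real k ^ 10"
    using kc by (intro power_mono) (simp_all flip: of_nat_power)
  finally have ck: "real c ^ 170 \<le> real k ^ 10" .
  have "real n ^ 20 \<le> real (k ^ 8) ^ 20" using k by (intro power_mono) auto
  also have "\<dots> = real k ^ 160" by (simp add: power_mult[symmetric])
  also have "\<dots> \<le> real k ^ 160 * (real k ^ 10 / real c ^ 170)"
  proof -
    have "1 \<le> real k ^ 10 / real c ^ 170" using ck c0 by simp
    hence "real k ^ 160 * 1 \<le> real k ^ 160 * (real k ^ 10 / real c ^ 170)" by (intro mult_left_mono) auto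
    thus ?thesis by simp
  qed
  also have "\<dots> = (real k / real c) ^ c" unfolding c by (simp add: power_divide power_add[symmetric])
  \<comment> \<open>Since n - k \<ge> k + c, the degree is at least (k + c choose k), and by
    symmetry the lower index becomes the constant c. The result is a polynomial in k of degree
    c.\<close>
  also have "\<dots> \<le> (real (k + c) / real c) ^ c"
    using c0 by (intro power_mono divide_right_mono) auto
  also have "\<dots> \<le> real ((k + c) choose c)" by (rule binomial_ge_n_over_k_pow_k) simp
  also have "(k + c) choose c = (k + c) choose k" using binomial_symmetric[of k "k + c"] by simp
  also have "real ((k + c) choose k) \<le> real ((n - k) choose k)"
    unfolding of_nat_le_iff using n(1) by (intro binomial_right_mono) linarith
  finally show ?thesis .
qed

text \<open>The value 1 / sqrt 2: its n-th power squares to 2^(-n), and n times that power tends to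
  0, which handles both n 2^(-n) and n^2 2^(-n).\<close>

definition rate :: real where "rate = 2 powr (- (1 / 2))"

lemma rate: "0 < rate" "rate < 1" "rate * rate = 1 / 2"
proof -
  show "0 < rate" by (simp add: rate_def)
  show "rate < 1" unfolding rate_def by (subst powr_less_one) auto
  show "rate * rate = 1 / 2" unfolding rate_def by (simp add: powr_add[symmetric] powr_minus_divide)
qed

text \<open>The sum of the bounds (2 n + 1) 2^(-n) for large degree and 2^(-(n-1)/2) for small k.
  Adding them gives one error that does not depend on k.\<close>

definition nontrivial_error :: "nat \<Rightarrow> real" where
  "nontrivial_error n = (2 * real n + 1) * (rate ^ n * rate ^ n) + rate ^ n / rate"

text \<open>Equal to n^2 / 2^(n-2), the relative loss in \<open>trivial_lower\<close> multiplied by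
  n.\<close>

definition overlap_error :: "nat \<Rightarrow> real" where
  "overlap_error n = 4 * (real n * rate ^ n) ^ 2"

lemma errors_tendsto: "nontrivial_error \<longlonglongrightarrow> 0" "overlap_error \<longlonglongrightarrow> 0"
proof -
  have a: "(\<lambda>n. real n * rate ^ n) \<longlonglongrightarrow> 0" using rate by (intro powser_times_n_limit_0) auto
  have b: "(\<lambda>n. rate ^ n) \<longlonglongrightarrow> 0" using rate by (intro LIMSEQ_power_zero) auto
  have "(\<lambda>n. 2 * (real n * rate ^ n) * rate ^ n + rate ^ n * rate ^ n + rate ^ n / rate) \<longlonglongrightarrow> 2 * 0 * 0 + 0 * 0 + 0 / rate"
    using rate by (intro tendsto_intros a b) auto
  moreover have "nontrivial_error = (\<lambda>n. 2 * (real n * rate ^ n) * rate ^ n + rate ^ n * rate ^ n + rate ^ n / rate)"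
    by (simp add: nontrivial_error_def fun_eq_iff algebra_simps)
  ultimately show "nontrivial_error \<longlonglongrightarrow> 0" by simp
  have "(\<lambda>n. 4 * (real n * rate ^ n) ^ 2) \<longlonglongrightarrow> 4 * 0 ^ 2" by (intro tendsto_intros a)
  thus "overlap_error \<longlonglongrightarrow> 0" by (simp add: overlap_error_def[abs_def])
qed

lemma rate_power: "rate ^ n * rate ^ n = 1 / 2 ^ n"
  by (simp add: power_mult_distrib[symmetric] rate power_one_over)

lemma nontrivial_bound:
  assumes k: "2 \<le> k" and n: "2 * k + 170 \<le> n" "(170 ^ 17) ^ 8 \<le> n"
  shows "real (card {F \<in> intersecting_families n k. \<not> trivial_on {1..n} F})
    \<le> nontrivial_error n * 2 ^ ((n - 1) choose (k - 1))" (is "?NT \<le> _ * 2 ^ ?a")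
proof -
  interpret cyclic_orders n k by standard (use k n(1) in auto)
  have big: "2 ^ 21 \<le> n" using n(2) by (rule order_trans[rotated]) simp
  have r0: "0 \<le> rate ^ n / rate" "0 \<le> (2 * real n + 1) * (rate ^ n * rate ^ n)" using rate by simp_all
  show ?thesis
  proof (cases "k ^ 8 \<le> n")
    case True
    have "?NT \<le> 2 powr (real ?a - (real n - 1) / 2)" by (rule nontrivial_count_small[OF True big])
    also have "\<dots> = rate ^ n / rate * 2 ^ ?a"
    proof -
      have "rate ^ n / rate = rate powr (real n - 1)" using rate by (simp add: powr_diff powr_realpow)
      also have "\<dots> = 2 powr (- ((real n - 1) / 2))" by (simp add: rate_def powr_powr algebra_simps)
      finally have "rate ^ n / rate * 2 ^ ?a = 2 powr (- ((real n - 1) / 2)) * 2 powr real ?a"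
        by (simp add: powr_realpow)
      also have "\<dots> = 2 powr (real ?a - (real n - 1) / 2)" unfolding powr_add[symmetric] by simp
      finally show ?thesis ..
    qed
    also have "\<dots> \<le> nontrivial_error n * 2 ^ ?a"
      unfolding nontrivial_error_def using r0 by (intro mult_right_mono) auto
    finally show ?thesis .
  next
    case False
    hence "real n ^ 20 \<le> real ((n - k) choose k)" using n by (intro degree_large[OF refl]) (simp_all only: not_le)
    then interpret large_degree n k
    proof unfold_locales
      show "2 ^ 14 \<le> n" using big by (rule order_trans[rotated]) simp
    qed
    have "?NT \<le> (2 * real n + 1) * 2 powr (sz - real n)" by (rule nontrivial_count)
    also have "2 powr (sz - real n) = rate ^ n * rate ^ n * 2 ^ ?a"
      unfolding rate_power sz_def by (simp add: powr_diff powr_realpow)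
    also have "(2 * real n + 1) * (rate ^ n * rate ^ n * 2 ^ ?a) = (2 * real n + 1) * (rate ^ n * rate ^ n) * 2 ^ ?a"
      by simp
    also have "\<dots> \<le> nontrivial_error n * 2 ^ ?a"
      unfolding nontrivial_error_def using r0 by (intro mult_right_mono) auto
    finally show ?thesis .
  qed
qed

lemma proportion_and_count:
  assumes k: "2 \<le> k" and n: "2 * k + 170 \<le> n" "(170 ^ 17) ^ 8 \<le> n"
  shows "\<bar>trivial_proportion n k - 1\<bar> \<le> nontrivial_error n"
    and "\<exists>r. \<bar>r\<bar> \<le> nontrivial_error n + overlap_error n \<and>
      real (card (intersecting_families n k)) = (real n + r) * 2 ^ ((n - 1) choose (k - 1))"
proof -
  interpret cyclic_orders n k by standard (use k n(1) in auto)
  define p where "p = (2 :: real) ^ ((n - 1) choose (k - 1))"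
  define I where "I = real (card (intersecting_families n k))"
  define T where "T = real (card {F \<in> intersecting_families n k. trivial_on {1..n} F})"
  define NT where "NT = real (card {F \<in> intersecting_families n k. \<not> trivial_on {1..n} F})"
  have p0: "p > 0" by (simp add: p_def)
  have I: "I = T + NT" unfolding I_def T_def NT_def using card_families_split by simp
  have NT: "0 \<le> NT" "NT \<le> nontrivial_error n * p"
    unfolding NT_def p_def using nontrivial_bound[OF k n] by simp_all
  have Ip: "p \<le> I" unfolding I_def p_def by (rule families_lower)
  have T: "T \<le> real n * p" "real n * p * (1 - real n / 2 ^ (n - 2)) \<le> T"
    unfolding T_def p_def by (rule trivial_upper, rule trivial_lower)
  have e0: "0 \<le> nontrivial_error n" using rate by (simp add: nontrivial_error_def)
  have o0: "0 \<le> overlap_error n" by (simp add: overlap_error_def)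
  have ov: "real n * (real n / 2 ^ (n - 2)) = overlap_error n"
  proof -
    have "overlap_error n = 4 * real n ^ 2 * (rate ^ n * rate ^ n)"
      by (simp add: overlap_error_def power2_eq_square)
    also have "\<dots> = 4 * real n ^ 2 / 2 ^ n" unfolding rate_power by simp
    also have "(2 :: real) ^ n = 4 * 2 ^ (n - 2)"
    proof -
      have "n = (n - 2) + 2" using n(1) by simp
      hence "(2 :: real) ^ n = 2 ^ (n - 2) * 2 ^ 2" by (metis power_add)
      thus ?thesis by simp
    qed
    finally show ?thesis by (simp add: power2_eq_square)
  qed
  have "trivial_proportion n k - 1 = T / I - 1" by (simp add: trivial_proportion_def T_def I_def)
  also have "\<dots> = - (NT / I)" using I Ip p0 by (simp add: field_simps)
  finally have "\<bar>trivial_proportion n k - 1\<bar> = NT / I" using NT Ip p0 by simp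
  also have "\<dots> \<le> NT / p" using NT Ip p0 by (intro divide_left_mono) auto
  also have "\<dots> \<le> nontrivial_error n" using NT p0 by (simp add: field_simps)
  finally show "\<bar>trivial_proportion n k - 1\<bar> \<le> nontrivial_error n" .
  define r where "r = I / p - real n"
  have "I = (real n + r) * p" using p0 by (simp add: r_def)
  moreover have "I / p \<le> real n + nontrivial_error n"
    using I T(1) NT(2) p0 by (simp add: field_simps)
  moreover have "real n - overlap_error n \<le> I / p"
  proof -
    have "(real n - overlap_error n) * p = real n * p * (1 - real n / 2 ^ (n - 2))"
      unfolding ov[symmetric] by (simp add: algebra_simps)
    also have "\<dots> \<le> I" using T(2) I NT(1) by linarith
    finally show ?thesis using p0 by (simp add: pos_le_divide_eq)
  qed
  ultimately show "\<exists>r. \<bar>r\<bar> \<le> nontrivial_error n + overlap_error n \<and>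
      real (card (intersecting_families n k)) = (real n + r) * 2 ^ ((n - 1) choose (k - 1))"
    using e0 o0 unfolding I_def[symmetric] p_def[symmetric] by (intro exI[of _ r]) (auto simp: r_def)
qed

theorem theorem1p6:
  "\<exists>C::real. C > 0 \<and>
     (\<exists>\<delta>::nat \<Rightarrow> real. \<delta> \<longlonglongrightarrow> 0 \<and>
        (\<forall>(n::nat) (k::nat).
           k \<ge> 2 \<and> real n \<ge> 2 * real k + C * sqrt (real k * ln (real k)) \<longrightarrow>
             \<bar>trivial_proportion n k - 1\<bar> \<le> \<delta> n)) \<and>
     (\<exists>\<epsilon>::nat \<Rightarrow> real. \<epsilon> \<longlonglongrightarrow> 0 \<and>
        (\<forall>(n::nat) (k::nat).
           k \<ge> 2 \<and> real n \<ge> 2 * real k + C * sqrt (real k * ln (real k)) \<longrightarrow>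
             (\<exists>r::real. \<bar>r\<bar> \<le> \<epsilon> n \<and>
                real (card (intersecting_families n k))
                  = (real n + r) * 2 ^ ((n - 1) choose (k - 1)))))"
proof -
  \<comment> \<open>For k \<ge> 2 the square root is at least 1, because ln 2 \<ge> 1/2, so the
    hypothesis gives n \<ge> 2 k + c. This implies both n \<ge> 2 k + 170 and the size of n that
    \<open>degree_large\<close> requires.\<close>
  define c :: nat where "c = (170 ^ 17) ^ 8"
  have c: "170 \<le> c" unfolding c_def by simp
  have bounds: "2 * k + 170 \<le> n \<and> (170 ^ 17) ^ 8 \<le> n"
    if "k \<ge> 2 \<and> real n \<ge> 2 * real k + real c * sqrt (real k * ln (real k))" for n k
  proof -
    have "ln 2 \<le> ln (real k)" using that by simp
    hence "1 / 2 \<le> ln (real k)" using ln_two_ge_half by linarith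
    hence "2 * (1 / 2) \<le> real k * ln (real k)" using that by (intro mult_mono) auto
    hence "1 \<le> sqrt (real k * ln (real k))" by simp
    hence "real c * 1 \<le> real c * sqrt (real k * ln (real k))" by (intro mult_left_mono) auto
    hence "real (2 * k + c) \<le> real n" using that by simp
    hence "2 * k + c \<le> n" by (simp only: of_nat_le_iff)
    thus ?thesis using c unfolding c_def[symmetric] by linarith
  qed
  have lim: "(\<lambda>n. nontrivial_error n + overlap_error n) \<longlonglongrightarrow> 0"
    using tendsto_add[OF errors_tendsto] by simp
  show ?thesis
  proof (intro exI[of _ "real c"] conjI)
    show "real c > 0" using c by simp
    show "\<exists>\<delta>::nat \<Rightarrow> real. \<delta> \<longlonglongrightarrow> 0 \<and> (\<forall>(n::nat) (k::nat).
           k \<ge> 2 \<and> real n \<ge> 2 * real k + real c * sqrt (real k * ln (real k)) \<longrightarrow>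
             \<bar>trivial_proportion n k - 1\<bar> \<le> \<delta> n)"
      using errors_tendsto(1) bounds proportion_and_count(1) by blast
    show "\<exists>\<epsilon>::nat \<Rightarrow> real. \<epsilon> \<longlonglongrightarrow> 0 \<and> (\<forall>(n::nat) (k::nat).
           k \<ge> 2 \<and> real n \<ge> 2 * real k + real c * sqrt (real k * ln (real k)) \<longrightarrow>
             (\<exists>r::real. \<bar>r\<bar> \<le> \<epsilon> n \<and>
                real (card (intersecting_families n k))
                  = (real n + r) * 2 ^ ((n - 1) choose (k - 1))))"
      using bounds proportion_and_count(2)
      by (intro exI[of _ "\<lambda>n. nontrivial_error n + overlap_error n"] conjI lim) blast
  qed
qed

end
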